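(* Suppose $d \geq 2$. Given initial data $u_0,v_0$, let $u$ and $v$ denote the solutions of the free Schrödinger equation $i\partial_t u + \Delta u = 0$ on $\mathbb{R}^{1+d}$ with $u(0)=u_0$ and $v(0)=v_0$. For any $\sigma > \frac{1-d}{4}$ and initial data $(u_0,v_0) \in \Upsilon_\sigma$, the quantity $$\rho \mapsto \mathbf{OT}(d,\sigma) I_\sigma(e^{\rho\Delta}u_0,e^{\rho\Delta}v_0) - \|(-\Delta)^{\sigma}(e^{\rho\Delta}u\,\overline{e^{\rho\Delta}v}) \|_{L^2_{t,x}(\mathbb{R}^{1+d})}^2$$ is nonincreasing on $(0,\infty)$. Similarly, for any $\beta > \frac{1-d}{2}$ and $(u_0,v_0) \in \Upsilon_\beta$, the quantity $$\rho\mapsto 2^{-2\beta} \mathbf{C}(d) I_\beta(e^{\rho\Delta}u_0,e^{\rho\Delta}v_0) - \|\, |\mathfrak{D}|^\beta (e^{\rho\Delta}u \,e^{\rho\Delta}v) \|_{L^2_{t,x}(\mathbb{R}^{1+d})}^2$$ is nonincreasing on $(0,\infty)$.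
   Context: The Fourier transform is $\widehat{f}(\xi) = \int_{\mathbb{R}^d} f(x) e^{-ix \cdot \xi}\,\mathrm{d}x$. The solution with initial data $u_0$ is $u(t,\cdot)=e^{it\Delta}u_0$, i.e. the spatial Fourier transform of $u(t,\cdot)$ is $e^{-it|\xi|^2}\widehat{u}_0(\xi)$. The heat operator $e^{\rho\Delta}$ is the Fourier multiplier $e^{-\rho|\xi|^2}$ in the spatial variable $x$ (applied to $u(t,\cdot)$ for each fixed $t$). The operator $(-\Delta)^\sigma$ acts in the spatial variable as the Fourier multiplier $|\xi|^{2\sigma}$. Here $\mathfrak{D} = i\partial_t + \frac{1}{2}\Delta$, and $|\mathfrak{D}|^\beta$ is the space-time Fourier multiplier operator with multiplier $|\tau + \frac{1}{2}|\xi|^2|^\beta$, with respect to the space-time Fourier transform $\widetilde{F}(\tau,\xi) = \int_{\mathbb{R}^{1+d}} F(t,x) e^{-i(t\tau + x \cdot \xi)}\, \mathrm{d}t\, \mathrm{d}x$. For $\lambda\in\mathbb{R}$, $$I_\lambda(f,g) := \int_{\mathbb{R}^{2d}} |\widehat{f}(\zeta)|^2 |\widehat{g}(\eta)|^2 |\zeta - \eta|^{4\lambda+d-2} \, \mathrm{d}\zeta\, \mathrm{d}\eta,$$ $$\Upsilon_\lambda := \{ (f,g) : f,g : \mathbb{R}^d \to \mathbb{C} \text{ measurable and } I_\lambda(f,g) < \infty\}.$$ The constants are $$\mathbf{OT}(d,\sigma) = 2^{-3d} \pi^{\frac{1-5d}{2}} \frac{\Gamma(2\sigma+\frac{d-1}{2})}{\Gamma(2\sigma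 + d-1)},\qquad \mathbf{C}(d) = \frac{2^{2-4d} \pi^{\frac{2-5d}{2}}}{\Gamma(\frac{d}{2})}.$$ *)

theory Defs
  imports "HOL-Analysis.Analysis"
begin

text \<open>
  \<open>\<real>\<^sup>d\<close> is a type of class \<open>euclidean_space\<close> with \<open>d = DIM('a)\<close>; space-time is \<open>real \<times> 'a\<close>, whose
  inner product is \<open>(t, x) \<bullet> (\<tau>, \<xi>) = t * \<tau> + x \<bullet> \<xi>\<close>, so the definitions below serve for both.
\<close>

coinductive schwartz :: "('a::euclidean_space \<Rightarrow> complex) \<Rightarrow> bool" where
  "\<lbrakk>\<And>x. f differentiable (at x);
    \<And>k::nat. bounded (range (\<lambda>x. (1 + norm x) ^ k *\<^sub>R f x));
    \<And>b. b \<in> Basis \<Longrightarrow> schwartz (\<lambda>x. frechet_derivative f (at x) b)\<rbrakk>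
   \<Longrightarrow> schwartz f"

definition fourier_integral :: "('a::euclidean_space \<Rightarrow> complex) \<Rightarrow> 'a \<Rightarrow> complex" where
  "fourier_integral f \<xi> = (\<integral>x. f x * cis (- (x \<bullet> \<xi>)) \<partial>lborel)"

definition inverse_fourier_integral :: "('a::euclidean_space \<Rightarrow> complex) \<Rightarrow> 'a \<Rightarrow> complex" where
  "inverse_fourier_integral F x =
     (1 / (2 * pi) ^ DIM('a)) *\<^sub>R (\<integral>\<xi>. F \<xi> * cis (x \<bullet> \<xi>) \<partial>lborel)"

text \<open>
  The data are not assumed integrable (nor square integrable), so the Fourier transform is that of
  tempered distributions: \<open>F\<close> is the transform of \<open>f\<close> if \<open>\<integral> f \<phi>\<^sup>^ = \<integral> F \<phi>\<close> for all Schwartz \<open>\<phi>\<close>.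
  Such an \<open>F\<close> is unique up to null sets and agrees almost everywhere with \<open>fourier_integral f\<close> if
  \<open>f\<close> is integrable. Taking \<open>F\<close> Borel, for \<open>f\<close> merely Lebesgue measurable, is a choice of
  representative.
\<close>

definition has_fourier_transform ::
    "('a::euclidean_space \<Rightarrow> complex) \<Rightarrow> ('a \<Rightarrow> complex) \<Rightarrow> bool" where
  "has_fourier_transform f F \<longleftrightarrow>
     F \<in> borel_measurable borel \<and>
     (\<forall>\<phi>. schwartz \<phi> \<longrightarrow>
        integrable lebesgue (\<lambda>x. f x * fourier_integral \<phi> x) \<and>
        integrable lborel (\<lambda>\<xi>. F \<xi> * \<phi> \<xi>) \<and>
        (\<integral>x. f x * fourier_integral \<phi> x \<partial>lebesgue) = (\<integral>\<xi>. F \<xi> * \<phi> \<xi> \<partial>lborel))"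

definition fourier :: "('a::euclidean_space \<Rightarrow> complex) \<Rightarrow> 'a \<Rightarrow> complex" where
  "fourier f = (SOME F. has_fourier_transform f F)"

text \<open>
  In all uses below, for data in \<open>Upsilon\<close> and \<open>\<rho> > 0\<close>, the integral over the frequency variable
  converges absolutely, thanks to the Gaussian factor, so the multiplier operators are given
  pointwise by the inversion formula (which is independent of the choice made in \<open>fourier\<close>).
\<close>

definition fourier_multiplier ::
    "('a::euclidean_space \<Rightarrow> complex) \<Rightarrow> ('a \<Rightarrow> complex) \<Rightarrow> 'a \<Rightarrow> complex" where
  "fourier_multiplier m f = inverse_fourier_integral (\<lambda>\<xi>. m \<xi> * fourier f \<xi>)"

definition heat :: "real \<Rightarrow> ('a::euclidean_space \<Rightarrow> complex) \<Rightarrow> 'a \<Rightarrow> complex" where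
  "heat \<rho> = fourier_multiplier (\<lambda>\<xi>. of_real (exp (- \<rho> * (norm \<xi>)\<^sup>2)))"

text \<open>
  For general data in \<open>Upsilon\<close> the solution \<open>u(t) = e\<^bsup>it\<Delta>\<^esup> u\<^sub>0\<close> may be a distribution that is not a
  function, whereas \<open>e\<^bsup>\<rho>\<Delta>\<^esup> u(t)\<close> is always a function. Hence \<open>u(t)\<close> is represented by its spatial Fourier
  transform, and \<open>heat_solution \<rho> u\<^sub>0 t x\<close> is \<open>(e\<^bsup>\<rho>\<Delta>\<^esup> u(t))(x)\<close>.
\<close>

definition solution_hat :: "('a::euclidean_space \<Rightarrow> complex) \<Rightarrow> real \<Rightarrow> 'a \<Rightarrow> complex" where
  "solution_hat u\<^sub>0 t \<xi> = cis (- t * (norm \<xi>)\<^sup>2) * fourier u\<^sub>0 \<xi>"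

definition heat_solution ::
    "real \<Rightarrow> ('a::euclidean_space \<Rightarrow> complex) \<Rightarrow> real \<Rightarrow> 'a \<Rightarrow> complex" where
  "heat_solution \<rho> u\<^sub>0 t =
     inverse_fourier_integral (\<lambda>\<xi>. of_real (exp (- \<rho> * (norm \<xi>)\<^sup>2)) * solution_hat u\<^sub>0 t \<xi>)"

text \<open>\<open>(-\<Delta>)\<^sup>\<sigma>\<close> acting on the spatial variable of a space-time function.\<close>

definition frac_laplacian ::
    "real \<Rightarrow> (real \<times> 'a::euclidean_space \<Rightarrow> complex) \<Rightarrow> real \<times> 'a \<Rightarrow> complex" where
  "frac_laplacian \<sigma> w =
     (\<lambda>(t, x). fourier_multiplier (\<lambda>\<xi>. of_real (norm \<xi> powr (2 * \<sigma>))) (\<lambda>y. w (t, y)) x)"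

definition frac_D ::
    "real \<Rightarrow> (real \<times> 'a::euclidean_space \<Rightarrow> complex) \<Rightarrow> real \<times> 'a \<Rightarrow> complex" where
  "frac_D \<beta> = fourier_multiplier (\<lambda>(\<tau>, \<xi>). of_real (\<bar>\<tau> + (norm \<xi>)\<^sup>2 / 2\<bar> powr \<beta>))"

definition L2_norm_sq :: "(real \<times> 'a::euclidean_space \<Rightarrow> complex) \<Rightarrow> ennreal" where
  "L2_norm_sq w = (\<integral>\<^sup>+p. ennreal ((cmod (w p))\<^sup>2) \<partial>lborel)"

definition I_functional ::
    "real \<Rightarrow> ('a::euclidean_space \<Rightarrow> complex) \<Rightarrow> ('a \<Rightarrow> complex) \<Rightarrow> ennreal" where
  "I_functional s f g =
     (\<integral>\<^sup>+(\<zeta>, \<eta>). ennreal ((cmod (fourier f \<zeta>))\<^sup>2 * (cmod (fourier g \<eta>))\<^sup>2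
                * norm (\<zeta> - \<eta>) powr (4 * s + real DIM('a) - 2)) \<partial>lborel)"

definition Upsilon ::
    "real \<Rightarrow> (('a::euclidean_space \<Rightarrow> complex) \<times> ('a \<Rightarrow> complex)) set" where
  "Upsilon s = {(f, g). f \<in> borel_measurable lebesgue \<and> g \<in> borel_measurable lebesgue \<and>
                    (\<exists>F. has_fourier_transform f F) \<and> (\<exists>G. has_fourier_transform g G) \<and>
                    I_functional s f g < \<infinity>}"

definition OT :: "nat \<Rightarrow> real \<Rightarrow> real" where
  "OT d \<sigma> = 2 powr (- 3 * real d) * pi powr ((1 - 5 * real d) / 2)
            * (Gamma (2 * \<sigma> + (real d - 1) / 2) / Gamma (2 * \<sigma> + real d - 1))"

definition C_const :: "nat \<Rightarrow> real" where
  "C_const d = 2 powr (2 - 4 * real d) * pi powr ((2 - 5 * real d) / 2) / Gamma (real d / 2)"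

end

theory Submission
  imports Defs "HOL-Probability.Characteristic_Functions" "HOL-Probability.Sinc_Integral"
begin

text \<open>
  Write \<open>F\<close>, \<open>G\<close> for the Fourier transforms of the data. The space-time Fourier transform of
  \<open>u * cnj v\<close> at \<open>(\<tau>, \<xi>)\<close> is an integral of \<open>F \<zeta> * cnj (G \<eta>)\<close> over a hyperplane of pairs with
  \<open>\<zeta> - \<eta> = \<xi>\<close>, that of \<open>u * v\<close> is an integral of \<open>F \<zeta> * G \<eta>\<close> over a sphere of pairs with
  \<open>\<zeta> + \<eta> = \<xi>\<close>, and by Plancherel the \<open>L\<^sup>2\<close> norm is an integral of squares of such fibre integrals.

  On the sphere \<open>\<bar>\<zeta>\<bar>\<^sup>2 + \<bar>\<eta>\<bar>\<^sup>2 = - \<tau>\<close>, so the heat flow multiplies the fibre integral and its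
  Cauchy--Schwarz bound by powers of the same factor \<open>exp (\<rho> * \<tau>)\<close>. The difference of the two sides is
  therefore nonnegative times \<open>exp (2 * \<rho> * \<tau>)\<close>.

  On the hyperplane, squaring produces pairs \<open>(\<zeta>\<^sub>1, \<eta>\<^sub>1)\<close>, \<open>(\<zeta>\<^sub>2, \<eta>\<^sub>2)\<close> forming a rectangle, and
  \<open>\<bar>\<zeta>\<^sub>1\<bar>\<^sup>2 + \<bar>\<eta>\<^sub>2\<bar>\<^sup>2 = \<bar>\<zeta>\<^sub>2\<bar>\<^sup>2 + \<bar>\<eta>\<^sub>1\<bar>\<^sup>2\<close>. Regrouping the integrand as \<open>A * cnj A'\<close> with
  \<open>A = F \<zeta>\<^sub>1 * G \<eta>\<^sub>2\<close> and \<open>A' = F \<zeta>\<^sub>2 * G \<eta>\<^sub>1\<close>, the defect is half the integral of \<open>\<bar>A - A'\<bar>\<^sup>2\<close>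
  against a positive weight that decreases with \<open>\<rho>\<close>. Integrating \<open>\<bar>A\<bar>\<^sup>2\<close> over all rectangles with
  diagonal \<open>\<zeta>\<^sub>1 - \<eta>\<^sub>2\<close> gives exactly the weight \<open>\<bar>\<zeta> - \<eta>\<bar> powr (4 * \<sigma> + d - 2)\<close> and the constant
  \<open>OT d \<sigma>\<close>.
\<close>

text \<open>Data in \<open>Upsilon\<close> need be neither integrable nor square integrable; what is
  known is that their transforms are functions that can be paired with Schwartz functions. Pairing
  with Gaussians shows that \<open>F\<close> and \<open>G\<close> become integrable once damped by
  the heat factor, so every function in the statement is an inverse transform of an integrable one,
  and Fourier analysis of integrable functions suffices, provided that Plancherel may take the value
  infinity. On a fibre both multipliers are powers of |\<zeta> - \<eta>|: in the first case \<xi> =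
  \<zeta> - \<eta>, in the second the parallelogram law gives \<tau> + |\<xi>|^2 / 2 = - |\<zeta> -
  \<eta>|^2 / 2, the origin of the factor 2^(-2\<beta>). In the constants, two inverse transforms in
  space contribute (2 pi)^(-2d), squared in the norm, and Plancherel in dimension d + 1 contributes
  (2 pi)^(d+1); the rest of \<open>OT\<close> and \<open>C_const\<close> measures the fibres. As
  norms may a priori be infinite, the inequality on each fibre is stated for sums, integrated, and
  turned into one for differences only at the end.\<close>

lemma borel_measurable_cis [measurable (raw)]:
  "f \<in> borel_measurable M \<Longrightarrow> (\<lambda>x. cis (f x)) \<in> borel_measurable M"
  by (rule measurable_compose[where N=borel]) (auto intro!: borel_measurable_continuous_onI continuous_intros)

section \<open>Affine substitutions and integrals of product functions\<close>

lemma nn_integral_lborel_affine: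
  fixes f :: "'a::euclidean_space \<Rightarrow> ennreal"
  assumes [measurable]: "f \<in> borel_measurable borel" and c: "c \<noteq> 0"
  shows "(\<integral>\<^sup>+x. f x \<partial>lborel) = ennreal (\<bar>c\<bar> ^ DIM('a)) * (\<integral>\<^sup>+x. f (t + c *\<^sub>R x) \<partial>lborel)"
  by (subst lborel_affine[OF c, of t])
     (simp add: nn_integral_density nn_integral_distr nn_integral_cmult)

lemma nn_integral_lborel_translate:
  fixes f :: "'a::euclidean_space \<Rightarrow> ennreal"
  assumes [measurable]: "f \<in> borel_measurable borel"
  shows "(\<integral>\<^sup>+x. f (x + t) \<partial>lborel) = (\<integral>\<^sup>+x. f x \<partial>lborel)"
  using nn_integral_lborel_affine[OF assms, of 1 t] by (simp add: add.commute)

lemma integrable_lborel_affine: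
  fixes f :: "'a::euclidean_space \<Rightarrow> 'b::{banach, second_countable_topology}"
  assumes f: "integrable lborel f" and c: "c \<noteq> 0"
  shows "integrable lborel (\<lambda>x. f (t + c *\<^sub>R x))"
proof -
  have [measurable]: "f \<in> borel_measurable borel"
    using borel_measurable_integrable[OF f] by simp
  have "ennreal (\<bar>c\<bar> ^ DIM('a)) * (\<integral>\<^sup>+x. ennreal (norm (f (t + c *\<^sub>R x))) \<partial>lborel) < \<infinity>"
    using f nn_integral_lborel_affine[of "\<lambda>x. ennreal (norm (f x))" c t] c
    by (simp add: integrable_iff_bounded)
  with c show ?thesis
    by (auto simp: integrable_iff_bounded ennreal_mult_less_top)
qed

lemma integral_lborel_affine:
  fixes f :: "'a::euclidean_space \<Rightarrow> 'b::{banach, second_countable_topology}"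
  assumes [measurable]: "f \<in> borel_measurable borel" and c: "c \<noteq> 0"
  shows "(\<integral>x. f x \<partial>lborel) = (\<bar>c\<bar> ^ DIM('a)) *\<^sub>R (\<integral>x. f (t + c *\<^sub>R x) \<partial>lborel)"
proof -
  have "(\<integral>x. f x \<partial>lborel) = (\<integral>x. f x \<partial>density (distr lborel borel (\<lambda>x. t + c *\<^sub>R x)) (\<lambda>_. \<bar>c\<bar>^DIM('a)))"
    by (subst lborel_affine[OF c, of t]) simp
  also have "\<dots> = (\<integral>x. \<bar>c\<bar>^DIM('a) *\<^sub>R f x \<partial>distr lborel borel (\<lambda>x. t + c *\<^sub>R x))"
    by (subst integral_density) auto
  also have "\<dots> = (\<integral>x. \<bar>c\<bar>^DIM('a) *\<^sub>R f (t + c *\<^sub>R x) \<partial>lborel)"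
    by (subst integral_distr) auto
  finally show ?thesis by simp
qed

lemma integral_lborel_translate:
  fixes f :: "'a::euclidean_space \<Rightarrow> 'b::{banach, second_countable_topology}"
  assumes [measurable]: "f \<in> borel_measurable borel"
  shows "(\<integral>x. f (x + t) \<partial>lborel) = (\<integral>x. f x \<partial>lborel)"
  using integral_lborel_affine[OF assms, of 1 t] by (simp add: add.commute)

lemma integrable_lborel_translate:
  fixes f :: "'a::euclidean_space \<Rightarrow> 'b::{banach, second_countable_topology}"
  assumes "integrable lborel f"
  shows "integrable lborel (\<lambda>x. f (x + t))"
  using integrable_lborel_affine[OF assms, of 1 t] by (simp add: add.commute)

text \<open>Lebesgue measure is the image of the product of one-dimensional Lebesgue measures under
  the coordinate map (\<open>lborel_eq\<close>), so a product of functions of single coordinates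
  integrates factor by factor.\<close>

lemma
  fixes f :: "'a::euclidean_space \<Rightarrow> real \<Rightarrow> 'b::{real_normed_field, banach, second_countable_topology}"
  assumes "\<And>b. b \<in> Basis \<Longrightarrow> integrable lborel (f b)"
  shows integrable_lborel_prod: "integrable lborel (\<lambda>x. \<Prod>b\<in>Basis. f b (x \<bullet> b))"
    and integral_lborel_prod:
      "(\<integral>x. (\<Prod>b\<in>Basis. f b (x \<bullet> b)) \<partial>lborel) = (\<Prod>b\<in>Basis. (\<integral>x. f b x \<partial>lborel))"
proof -
  interpret product_sigma_finite "\<lambda>b::'a. lborel :: real measure"
    by standard
  define T :: "('a \<Rightarrow> real) \<Rightarrow> 'a" where "T = (\<lambda>f. \<Sum>b\<in>Basis. f b *\<^sub>R b)"
  have [measurable]: "T \<in> measurable (\<Pi>\<^sub>M b\<in>Basis. lborel) borel"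
    unfolding T_def by measurable
  have T: "T x \<bullet> b = x b" if "b \<in> Basis" for x b
    using that by (simp add: T_def)
  have [measurable]: "f b \<in> borel_measurable borel" if "b \<in> Basis" for b
    using borel_measurable_integrable[OF assms[OF that]] by simp
  have m[measurable]: "(\<lambda>x. \<Prod>b\<in>Basis. f b (x \<bullet> b)) \<in> borel_measurable borel"
    by measurable
  have e: "(\<Prod>b\<in>Basis. f b (T x \<bullet> b)) = (\<Prod>b\<in>Basis. f b (x b))" for x
    by (simp add: T)
  have l: "lborel = distr (\<Pi>\<^sub>M b\<in>Basis. lborel) borel T"
    unfolding T_def by (rule lborel_eq)
  show "integrable lborel (\<lambda>x. \<Prod>b\<in>Basis. f b (x \<bullet> b))"
    unfolding l by (subst integrable_distr_eq) (auto simp: e intro!: product_integrable_prod assms)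
  show "(\<integral>x. (\<Prod>b\<in>Basis. f b (x \<bullet> b)) \<partial>lborel) = (\<Prod>b\<in>Basis. (\<integral>x. f b x \<partial>lborel))"
    by (subst (1) l, subst integral_distr) (auto simp: e intro!: product_integral_prod assms)
qed

subsection \<open>Gaussians\<close>

text \<open>Up to the normalising factor \<open>sqrt (2 * pi)\<close> this is the characteristic
  function of the standard normal distribution.\<close>

lemma std_gaussian:
  shows "integrable lborel (\<lambda>x::real. exp (- x\<^sup>2 / 2) *\<^sub>R cis (x * s))"
    and "(\<integral>(x::real). exp (- x\<^sup>2 / 2) *\<^sub>R cis (x * s) \<partial>lborel) = of_real (sqrt (2 * pi) * exp (- s\<^sup>2 / 2))"
proof -
  have i: "integrable lborel (\<lambda>x::real. std_normal_density x)"
    by simp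
  have e: "std_normal_density x *\<^sub>R cis (x * s) = (1 / sqrt (2 * pi)) *\<^sub>R (exp (- x\<^sup>2 / 2) *\<^sub>R cis (x * s))" for x
    by (simp add: std_normal_density_def scaleR_conv_of_real)
  have i2: "integrable lborel (\<lambda>x::real. std_normal_density x *\<^sub>R cis (x * s))"
    by (rule Bochner_Integration.integrable_bound[OF i])
       (auto simp: normal_density_nonneg)
  then show i3: "integrable lborel (\<lambda>x::real. exp (- x\<^sup>2 / 2) *\<^sub>R cis (x * s))"
    using integrable_scaleR_right[of "sqrt (2 * pi)", OF i2] unfolding e by simp
  have "char std_normal_distribution s = (\<integral>x. std_normal_density x *\<^sub>R cis (x * s) \<partial>lborel)"
    unfolding char_def
    by (subst integral_density) (auto simp: normal_density_nonneg cis_conv_exp mult.commute[of s])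
  also have "\<dots> = (1 / sqrt (2 * pi)) *\<^sub>R (\<integral>(x::real). exp (- x\<^sup>2 / 2) *\<^sub>R cis (x * s) \<partial>lborel)"
    unfolding e by (simp only: integral_scaleR_right)
  finally have "complex_of_real (exp (- (s^2) / 2)) = (1 / sqrt (2 * pi)) *\<^sub>R (\<integral>(x::real). exp (- x\<^sup>2 / 2) *\<^sub>R cis (x * s) \<partial>lborel)"
    by (simp add: char_std_normal_distribution)
  then have "sqrt (2 * pi) *\<^sub>R complex_of_real (exp (- (s^2) / 2)) = sqrt (2 * pi) *\<^sub>R (1 / sqrt (2 * pi)) *\<^sub>R (\<integral>(x::real). exp (- x\<^sup>2 / 2) *\<^sub>R cis (x * s) \<partial>lborel)"
    by simp
  then show "(\<integral>(x::real). exp (- x\<^sup>2 / 2) *\<^sub>R cis (x * s) \<partial>lborel) = of_real (sqrt (2 * pi) * exp (- s\<^sup>2 / 2))"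
    by (simp add: scaleR_conv_of_real)
qed

lemma real_gaussian_cis:
  assumes a: "a > 0"
  shows "integrable lborel (\<lambda>x::real. exp (- a * x\<^sup>2) *\<^sub>R cis (x * s))"
    and "(\<integral>(x::real). exp (- a * x\<^sup>2) *\<^sub>R cis (x * s) \<partial>lborel) = of_real (sqrt (pi / a) * exp (- s\<^sup>2 / (4 * a)))"
proof -
  \<comment> \<open>Chosen so that (c x)^2 / 2 = a x^2.\<close>
  define c where "c = sqrt (2 * a)"
  have c: "c > 0" "c\<^sup>2 = 2 * a" using a by (auto simp: c_def)
  have e: "exp (- (c * x)\<^sup>2 / 2) *\<^sub>R cis (c * x * (s / c)) = exp (- a * x\<^sup>2) *\<^sub>R cis (x * s)" for x
    using c by (simp add: power_mult_distrib mult.commute)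
  have "integrable lborel (\<lambda>x. exp (- (0 + c * x)\<^sup>2 / 2) *\<^sub>R cis ((0 + c * x) * (s / c)))"
    by (rule lborel_integrable_real_affine[OF std_gaussian(1)]) (use c in auto)
  then show "integrable lborel (\<lambda>x::real. exp (- a * x\<^sup>2) *\<^sub>R cis (x * s))"
    using e by simp
  have "(\<integral>(x::real). exp (- x\<^sup>2 / 2) *\<^sub>R cis (x * (s / c)) \<partial>lborel)
      = \<bar>c\<bar> *\<^sub>R (\<integral>x. exp (- (0 + c * x)\<^sup>2 / 2) *\<^sub>R cis ((0 + c * x) * (s / c)) \<partial>lborel)"
    by (rule lborel_integral_real_affine) (use c in auto)
  also have "\<dots> = c *\<^sub>R (\<integral>x. exp (- a * x\<^sup>2) *\<^sub>R cis (x * s) \<partial>lborel)"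
    using c(1) e by simp
  finally have "c *\<^sub>R (\<integral>x. exp (- a * x\<^sup>2) *\<^sub>R cis (x * s) \<partial>lborel) = of_real (sqrt (2 * pi) * exp (- (s / c)\<^sup>2 / 2))"
    unfolding std_gaussian by simp
  then have "(\<integral>x. exp (- a * x\<^sup>2) *\<^sub>R cis (x * s) \<partial>lborel) = (1 / c) *\<^sub>R of_real (sqrt (2 * pi) * exp (- (s / c)\<^sup>2 / 2))"
    using c(1) by (metis (no_types, lifting) divide_inverse mult_1 less_irrefl scaleR_left_imp_eq scaleR_scaleR right_inverse scaleR_one)
  also have "\<dots> = of_real ((1 / c) * sqrt (2 * pi) * exp (- (s / c)\<^sup>2 / 2))"
    by (simp add: scaleR_conv_of_real)
  also have "(1 / c) * sqrt (2 * pi) = sqrt (pi / a)"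
    using a by (simp add: c_def real_sqrt_divide real_sqrt_mult)
  also have "- (s / c)\<^sup>2 / 2 = - s\<^sup>2 / (4 * a)"
    using c by (simp add: power_divide)
  finally show "(\<integral>(x::real). exp (- a * x\<^sup>2) *\<^sub>R cis (x * s) \<partial>lborel) = of_real (sqrt (pi / a) * exp (- s\<^sup>2 / (4 * a)))" .
qed

lemma prod_cis: "finite A \<Longrightarrow> (\<Prod>b\<in>A. cis (f b)) = cis (\<Sum>b\<in>A. f b)"
  by (induction A rule: finite_induct) (auto simp: cis_mult)

lemma norm_sq_eq_sum_Basis: "(norm (x::'a::euclidean_space))\<^sup>2 = (\<Sum>b\<in>Basis. (x \<bullet> b)\<^sup>2)"
  unfolding power2_norm_eq_inner by (subst euclidean_inner) (simp add: power2_eq_square)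

lemma
  fixes \<xi> :: "'a::euclidean_space"
  assumes a: "a > 0"
  shows integrable_gaussian_cis: "integrable lborel (\<lambda>x::'a. exp (- a * (norm x)\<^sup>2) *\<^sub>R cis (x \<bullet> \<xi>))"
    and integral_gaussian_cis: "(\<integral>(x::'a). exp (- a * (norm x)\<^sup>2) *\<^sub>R cis (x \<bullet> \<xi>) \<partial>lborel)
       = of_real (sqrt (pi / a) ^ DIM('a) * exp (- (norm \<xi>)\<^sup>2 / (4 * a)))"
proof -
  have e: "exp (- a * (norm x)\<^sup>2) *\<^sub>R cis (x \<bullet> \<xi>) =
     (\<Prod>b\<in>Basis. exp (- a * (x \<bullet> b)\<^sup>2) *\<^sub>R cis ((x \<bullet> b) * (\<xi> \<bullet> b)))" for x
  proof -
    have "exp (- a * (norm x)\<^sup>2) = (\<Prod>b\<in>Basis. exp (- a * (x \<bullet> b)\<^sup>2))"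
      by (simp add: norm_sq_eq_sum_Basis sum_distrib_left flip: exp_sum sum_negf)
    moreover have "cis (x \<bullet> \<xi>) = (\<Prod>b\<in>Basis. cis ((x \<bullet> b) * (\<xi> \<bullet> b)))"
      by (subst euclidean_inner) (simp add: prod_cis)
    ultimately show ?thesis
      by (simp add: scaleR_conv_of_real prod.distrib)
  qed
  show "integrable lborel (\<lambda>x::'a. exp (- a * (norm x)\<^sup>2) *\<^sub>R cis (x \<bullet> \<xi>))"
    unfolding e by (intro integrable_lborel_prod real_gaussian_cis a)
  have "(\<integral>(x::'a). exp (- a * (norm x)\<^sup>2) *\<^sub>R cis (x \<bullet> \<xi>) \<partial>lborel)
      = (\<Prod>b\<in>Basis. of_real (sqrt (pi / a) * exp (- (\<xi> \<bullet> b)\<^sup>2 / (4 * a))))"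
    unfolding e by (subst integral_lborel_prod) (simp_all only: real_gaussian_cis[OF a])
  also have "\<dots> = of_real (sqrt (pi / a) ^ DIM('a) * (\<Prod>b\<in>Basis. exp (- (\<xi> \<bullet> b)\<^sup>2 / (4 * a))))"
    by (simp add: prod.distrib)
  also have "(\<Prod>b\<in>Basis. exp (- (\<xi> \<bullet> b)\<^sup>2 / (4 * a))) = exp (- (norm \<xi>)\<^sup>2 / (4 * a))"
    by (simp add: norm_sq_eq_sum_Basis sum_divide_distrib flip: exp_sum sum_negf)
  finally show "(\<integral>(x::'a). exp (- a * (norm x)\<^sup>2) *\<^sub>R cis (x \<bullet> \<xi>) \<partial>lborel)
       = of_real (sqrt (pi / a) ^ DIM('a) * exp (- (norm \<xi>)\<^sup>2 / (4 * a)))" .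
qed

lemma
  assumes a: "a > 0"
  shows integrable_gaussian: "integrable lborel (\<lambda>x::'a::euclidean_space. exp (- a * (norm x)\<^sup>2))"
    and integral_gaussian: "(\<integral>(x::'a). exp (- a * (norm x)\<^sup>2) \<partial>lborel) = sqrt (pi / a) ^ DIM('a)"
proof -
  have i: "integrable lborel (\<lambda>x::'a. complex_of_real (exp (- a * (norm x)\<^sup>2)))"
    using integrable_gaussian_cis[OF a, of "0::'a"] by (simp add: scaleR_conv_of_real)
  then show "integrable lborel (\<lambda>x::'a. exp (- a * (norm x)\<^sup>2))"
    by (subst (asm) complex_of_real_integrable_eq)
  have "complex_of_real (\<integral>(x::'a). exp (- a * (norm x)\<^sup>2) \<partial>lborel) = complex_of_real (sqrt (pi / a) ^ DIM('a))"
    using integral_gaussian_cis[OF a, of "0::'a"] by (simp add: scaleR_conv_of_real)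
  then show "(\<integral>(x::'a). exp (- a * (norm x)\<^sup>2) \<partial>lborel) = sqrt (pi / a) ^ DIM('a)"
    using of_real_eq_iff by blast
qed

lemma nn_integral_gaussian:
  assumes a: "a > 0"
  shows "(\<integral>\<^sup>+(x::'a::euclidean_space). ennreal (exp (- a * (norm x)\<^sup>2)) \<partial>lborel) = ennreal (sqrt (pi / a) ^ DIM('a))"
  using nn_integral_eq_integral[OF integrable_gaussian[OF a, where 'a='a]] integral_gaussian[OF a, where 'a='a]
  by simp

text \<open>The exponent is chosen so that products of one-dimensional functions suffice: each of
  the \<open>DIM('a)\<close> factors \<open>1 + (x \<bullet> b)\<^sup>2\<close> is at most
  \<open>(1 + norm x)\<^sup>2\<close>. This is the integrable majorant behind the Schwartz
  estimates.\<close>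

lemma integrable_inverse_norm_power:
  "integrable lborel (\<lambda>x::'a::euclidean_space. inverse ((1 + norm x) ^ (2 * DIM('a))))"
proof -
  have 1: "integrable lborel (\<lambda>x::real. inverse (1 + x\<^sup>2))"
    using integrable_inverse_1_plus_square unfolding set_integrable_def by simp
  have 2: "integrable lborel (\<lambda>x::'a. \<Prod>b\<in>Basis. inverse (1 + (x \<bullet> b)\<^sup>2))"
    by (rule integrable_lborel_prod[OF 1])
  show ?thesis
  proof (rule Bochner_Integration.integrable_bound[OF 2])
    have "norm (inverse ((1 + norm x) ^ (2 * DIM('a)))) \<le> norm (\<Prod>b\<in>Basis. inverse (1 + (x \<bullet> b)\<^sup>2))" for x :: 'a
    proof -
      have "(\<Prod>b\<in>Basis. 1 + (x \<bullet> b)\<^sup>2) \<le> (\<Prod>b\<in>(Basis::'a set). (1 + norm x)\<^sup>2)"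
      proof (rule prod_mono, safe)
        fix b :: 'a assume b: "b \<in> Basis"
        have "(x \<bullet> b)\<^sup>2 \<le> (norm x)\<^sup>2"
          using Basis_le_norm[OF b, of x] by (metis abs_le_square_iff abs_norm_cancel)
        then show "1 + (x \<bullet> b)\<^sup>2 \<le> (1 + norm x)\<^sup>2"
          using norm_ge_zero[of x] power2_sum[of 1 "norm x"] unfolding one_power2 by linarith
      qed simp
      also have "\<dots> = (1 + norm x) ^ (2 * DIM('a))"
        by (simp add: power_mult)
      finally have "(\<Prod>b\<in>Basis. 1 + (x \<bullet> b)\<^sup>2) \<le> (1 + norm x) ^ (2 * DIM('a))" .
      moreover have "(\<Prod>b\<in>Basis. 1 + (x \<bullet> b)\<^sup>2) > 0"
        by (intro prod_pos) (auto simp: add_pos_nonneg)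
      ultimately show ?thesis
        by (simp add: prod_inversef[unfolded o_def] abs_of_pos le_imp_inverse_le abs_prod)
    qed
    then show "AE x in lborel. norm (inverse ((1 + norm (x::'a)) ^ (2 * DIM('a)))) \<le> norm (\<Prod>b\<in>Basis. inverse (1 + (x \<bullet> b)\<^sup>2))"
      by simp
  qed measurable
qed

subsection \<open>Approximation in the mean by Gaussian averages\<close>

text \<open>A point of an open set stays in it under small translations, whereas boundary points may
  behave badly. Writing the integrand as a sum of two indicators minus twice the product of the
  indicators of \<open>U\<close> at x and at x + h removes the difficulty: the product vanishes off
  \<open>U\<close> and is dominated by the indicator of \<open>U\<close>.\<close>

lemma L1_translation_open:
  fixes U :: "'a::euclidean_space set"
  assumes U: "open U" and fin: "emeasure lborel U < \<infinity>" and X: "X \<longlonglongrightarrow> 0"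
  shows "(\<lambda>n. \<integral>x. \<bar>indicator U (x + X n) - indicator U x\<bar> \<partial>lborel) \<longlonglongrightarrow> (0::real)"
proof -
  have [measurable]: "U \<in> sets borel" using U by simp
  have iU: "integrable lborel (indicator U :: 'a \<Rightarrow> real)"
    using fin by simp
  have iUX: "integrable lborel (\<lambda>x. indicator U (x + h) :: real)" for h
    by (rule integrable_lborel_translate[OF iU])
  have iP: "integrable lborel (\<lambda>x. indicator U x * indicator U (x + h) :: real)" for h
    by (rule Bochner_Integration.integrable_bound[OF iU]) (auto split: split_indicator)
  have "\<bar>indicator U (x + h) - indicator U x\<bar>
      = indicator U (x + h) + indicator U x - 2 * (indicator U x * indicator U (x + h) :: real)" for x h
    by (auto split: split_indicator)
  then have e: "(\<integral>x. \<bar>indicator U (x + h) - indicator U x :: real\<bar> \<partial>lborel)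
     = 2 * (\<integral>x. indicator U x \<partial>lborel) - 2 * (\<integral>x. indicator U x * indicator U (x + h) \<partial>lborel)" for h
    using iU iUX[of h] iP[of h] integral_lborel_translate[of "indicator U :: 'a \<Rightarrow> real" h] by simp
  have "(\<lambda>n. \<integral>x. indicator U x * indicator U (x + X n) \<partial>lborel) \<longlonglongrightarrow> (\<integral>x. indicator U x \<partial>lborel :: real)"
  proof (rule integral_dominated_convergence[OF _ _ iU])
    show "AE x in lborel. (\<lambda>n. indicator U x * indicator U (x + X n)) \<longlonglongrightarrow> (indicator U x :: real)"
    proof (rule AE_I2)
      fix x :: 'a
      show "(\<lambda>n. indicator U x * indicator U (x + X n)) \<longlonglongrightarrow> (indicator U x :: real)"
      proof (cases "x \<in> U")
        case True
        have "(\<lambda>n. x + X n) \<longlonglongrightarrow> x + 0" by (intro tendsto_intros X)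
        then have "eventually (\<lambda>n. x + X n \<in> U) sequentially"
          using U True by (auto dest: topological_tendstoD)
        then have "eventually (\<lambda>n. indicator U x * indicator U (x + X n) = (indicator U x :: real)) sequentially"
          by eventually_elim auto
        then show ?thesis by (rule tendsto_eventually)
      qed simp
    qed
  qed (auto split: split_indicator)
  then have "(\<lambda>n. 2 * (\<integral>x. indicator U x \<partial>lborel) - 2 * (\<integral>x. indicator U x * indicator U (x + X n) \<partial>lborel))
      \<longlonglongrightarrow> 2 * (\<integral>x. indicator U x \<partial>lborel) - 2 * (\<integral>x. indicator U x \<partial>lborel :: real)"
    by (intro tendsto_intros)
  then show ?thesis unfolding e by simp
qed

text \<open>The usual three-term estimate: translation preserves the integral, so the error
  \<open>f - g\<close> at \<open>x + h\<close> costs the same as at \<open>x\<close>. The hypothesis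
  asks for approximants that satisfy the conclusion, which serves both the indicator case and the
  limit case of the induction in \<open>L1_translation\<close>.\<close>

lemma L1_translation_approx:
  fixes f :: "'a::euclidean_space \<Rightarrow> 'b::{banach, second_countable_topology}"
  assumes f: "integrable lborel f"
    and approx: "\<And>e. e > 0 \<Longrightarrow> \<exists>g. integrable lborel g \<and> (\<integral>x. norm (f x - g x) \<partial>lborel) < e \<and>
       (\<lambda>n. \<integral>x. norm (g (x + X n) - g x) \<partial>lborel) \<longlonglongrightarrow> (0::real)"
  shows "(\<lambda>n. \<integral>x. norm (f (x + X n) - f x) \<partial>lborel) \<longlonglongrightarrow> (0::real)"
proof (rule LIMSEQ_I)
  fix e :: real assume "e > 0"
  then obtain g where g: "integrable lborel g" "(\<integral>x. norm (f x - g x) \<partial>lborel) < e / 3"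
    and lim: "(\<lambda>n. \<integral>x. norm (g (x + X n) - g x) \<partial>lborel) \<longlonglongrightarrow> (0::real)"
    using approx[of "e / 3"] by auto
  from LIMSEQ_D[OF lim, of "e / 3"] \<open>e > 0\<close> obtain N
    where N: "\<And>n. n \<ge> N \<Longrightarrow> \<bar>\<integral>x. norm (g (x + X n) - g x) \<partial>lborel\<bar> < e / 3" by auto
  have [measurable]: "f \<in> borel_measurable borel" "g \<in> borel_measurable borel"
    using borel_measurable_integrable[OF f] borel_measurable_integrable[OF g(1)] by auto
  have i: "integrable lborel (\<lambda>x. norm (f x - g x))"
    using f g by auto
  have *: "(\<integral>x. norm (f (x + h) - f x) \<partial>lborel) \<le> 2 * (\<integral>x. norm (f x - g x) \<partial>lborel) + (\<integral>x. norm (g (x + h) - g x) \<partial>lborel)" for h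
  proof -
    have "(\<integral>x. norm (f (x + h) - f x) \<partial>lborel)
       \<le> (\<integral>x. norm (f (x + h) - g (x + h)) + norm (f x - g x) + norm (g (x + h) - g x) \<partial>lborel)"
    proof (rule integral_mono)
      fix x
      have eq: "f (x + h) - f x = (f (x + h) - g (x + h)) - (f x - g x) + (g (x + h) - g x)" by simp
      show "norm (f (x + h) - f x) \<le> norm (f (x + h) - g (x + h)) + norm (f x - g x) + norm (g (x + h) - g x)"
        by (subst eq) (intro order_trans[OF norm_triangle_ineq] add_right_mono norm_triangle_ineq4)
    next
      show "integrable lborel (\<lambda>x. norm (f (x + h) - f x))"
        using f integrable_lborel_translate[OF f, of h] by simp
      show "integrable lborel (\<lambda>x. norm (f (x + h) - g (x + h)) + norm (f x - g x) + norm (g (x + h) - g x))"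
        using f g(1) integrable_lborel_translate[OF f, of h] integrable_lborel_translate[OF g(1), of h] by simp
    qed
    also have "\<dots> = (\<integral>x. norm (f (x + h) - g (x + h)) \<partial>lborel) + (\<integral>x. norm (f x - g x) \<partial>lborel) + (\<integral>x. norm (g (x + h) - g x) \<partial>lborel)"
      using f g(1) integrable_lborel_translate[OF f, of h] integrable_lborel_translate[OF g(1), of h] by simp
    also have "(\<integral>x. norm (f (x + h) - g (x + h)) \<partial>lborel) = (\<integral>x. norm (f x - g x) \<partial>lborel)"
      by (rule integral_lborel_translate[of "\<lambda>x. norm (f x - g x)"]) measurable
    finally show ?thesis by simp
  qed
  show "\<exists>N. \<forall>n\<ge>N. norm ((\<integral>x. norm (f (x + X n) - f x) \<partial>lborel) - 0) < e"
  proof (intro exI allI impI)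
    fix n assume "n \<ge> N"
    from *[of "X n"] N[OF this] g(2) show "norm ((\<integral>x. norm (f (x + X n) - f x) \<partial>lborel) - 0) < e"
      by (simp add: integral_nonneg_AE)
  qed
qed

text \<open>Continuity of translation in the mean. Indicators of Borel sets of finite measure are
  approximated by those of open sets through outer regularity, which reduces them to
  \<open>L1_translation_open\<close>.\<close>

lemma L1_translation:
  fixes f :: "'a::euclidean_space \<Rightarrow> 'b::{banach, second_countable_topology}"
  assumes f: "integrable lborel f" and X: "X \<longlonglongrightarrow> 0"
  shows "(\<lambda>n. \<integral>x. norm (f (x + X n) - f x) \<partial>lborel) \<longlonglongrightarrow> (0::real)"
  using f
proof (induction f rule: integrable_induct)
  case (base A c)
  have [measurable]: "A \<in> sets borel" using base by simp
  show ?case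
  proof (rule L1_translation_approx)
    show "integrable lborel (\<lambda>x. indicator A x *\<^sub>R c)" using base by simp
    fix e :: real assume "e > 0"
    \<comment> \<open>The summand 1 keeps the denominator positive when
      \<open>c = 0\<close>.\<close>
    define e' where "e' = e / (2 * (norm c + 1))"
    have "norm c + 1 > 0" by (simp add: add_nonneg_pos)
    with \<open>e > 0\<close> have e': "e' > 0" by (simp add: e'_def)
    from outer_regular_lborel[OF _ e'] obtain U where U: "open U" "A \<subseteq> U" "emeasure lborel (U - A) < e'"
      using outer_regular_lborel[OF \<open>A \<in> sets borel\<close> e'] by blast
    have finU: "emeasure lborel U < \<infinity>"
    proof -
      have "emeasure lborel U \<le> emeasure lborel A + emeasure lborel (U - A)"
        using emeasure_subadditive[of A lborel "U - A"] U base by (simp add: Un_absorb1)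
      also have "\<dots> < \<infinity>" using base U(3) by (metis ennreal_add_eq_top ennreal_less_top infinity_ennreal_def less_top order_less_trans)
      finally show ?thesis .
    qed
    have [measurable]: "U \<in> sets borel" using U by simp
    have "(\<integral>x. norm (indicator A x *\<^sub>R c - indicator U x *\<^sub>R c) \<partial>lborel) = (\<integral>x. norm c * indicator (U - A) x \<partial>lborel)"
      by (rule Bochner_Integration.integral_cong) (use U(2) in \<open>auto split: split_indicator\<close>)
    also have "\<dots> = norm c * measure lborel (U - A)" by simp
    also have "\<dots> \<le> norm c * e'"
    proof (rule mult_left_mono)
      show "measure lborel (U - A) \<le> e'"
        using U(3) e' unfolding measure_def by (intro enn2real_leI) auto
    qed simp
    also have "\<dots> \<le> (norm c + 1) * e'" using e' by simp
    also have "\<dots> = e / 2" 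
    proof -
      have "m * (e / (2 * m)) = e / 2" if "m > 0" for m using that by simp
      from this[OF \<open>norm c + 1 > 0\<close>] show ?thesis unfolding e'_def .
    qed
    also have "\<dots> < e" using \<open>e > 0\<close> by simp
    finally have 1: "(\<integral>x. norm (indicator A x *\<^sub>R c - indicator U x *\<^sub>R c) \<partial>lborel) < e" .
    have "(\<lambda>n. norm c * (\<integral>x. \<bar>indicator U (x + X n) - indicator U x\<bar> \<partial>lborel)) \<longlonglongrightarrow> norm c * 0"
      by (intro tendsto_intros L1_translation_open U finU X)
    also have "(\<lambda>n. norm c * (\<integral>x. \<bar>indicator U (x + X n) - indicator U x\<bar> \<partial>lborel))
       = (\<lambda>n. \<integral>x. norm (indicator U (x + X n) *\<^sub>R c - indicator U x *\<^sub>R c) \<partial>lborel)"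
      by (simp flip: scaleR_diff_left add: mult.commute)
    finally have 2: "(\<lambda>n. \<integral>x. norm (indicator U (x + X n) *\<^sub>R c - indicator U x *\<^sub>R c) \<partial>lborel) \<longlonglongrightarrow> 0" by simp
    show "\<exists>g. integrable lborel g \<and> (\<integral>x. norm (indicator A x *\<^sub>R c - g x) \<partial>lborel) < e \<and>
             (\<lambda>n. \<integral>x. norm (g (x + X n) - g x) \<partial>lborel) \<longlonglongrightarrow> 0"
      by (rule exI[of _ "\<lambda>x. indicator U x *\<^sub>R c"]) (use 1 2 finU in simp)
  qed
next
  case (add f g)
  have i: "integrable lborel (\<lambda>x. norm (f (x + h) - f x))" "integrable lborel (\<lambda>x. norm (g (x + h) - g x))" for h
    using add.hyps integrable_lborel_translate[OF add.hyps(1), of h] integrable_lborel_translate[OF add.hyps(2), of h] by simp_all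
  show ?case
  proof (rule tendsto_sandwich[OF _ _ tendsto_const])
    show "\<forall>\<^sub>F n in sequentially. 0 \<le> (\<integral>x. norm (f (x + X n) + g (x + X n) - (f x + g x)) \<partial>lborel)" by simp
    have "(\<integral>x. norm (f (x + h) + g (x + h) - (f x + g x)) \<partial>lborel)
      \<le> (\<integral>x. norm (f (x + h) - f x) + norm (g (x + h) - g x) \<partial>lborel)" for h
      by (rule integral_mono)
         (use i[of h] add.hyps integrable_lborel_translate[OF add.hyps(1), of h] integrable_lborel_translate[OF add.hyps(2), of h] in
           \<open>simp_all add: norm_diff_triangle_ineq\<close>)
    then show "\<forall>\<^sub>F n in sequentially. (\<integral>x. norm (f (x + X n) + g (x + X n) - (f x + g x)) \<partial>lborel)
      \<le> (\<integral>x. norm (f (x + X n) - f x) \<partial>lborel) + (\<integral>x. norm (g (x + X n) - g x) \<partial>lborel)"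
      using i by simp
    show "(\<lambda>n. (\<integral>x. norm (f (x + X n) - f x) \<partial>lborel) + (\<integral>x. norm (g (x + X n) - g x) \<partial>lborel)) \<longlonglongrightarrow> 0"
      using tendsto_add[OF add.IH(1) add.IH(2)] by simp
  qed
next
  case (lim f s)
  show ?case
  proof (rule L1_translation_approx[OF lim.hyps(4)])
    fix e :: real assume e: "e > 0"
    \<comment> \<open>The simple functions of \<open>integrable_induct\<close> converge pointwise
      and are bounded by \<open>2 * norm (f x)\<close>, hence the majorant
      \<open>3 * norm (f x)\<close>.\<close>
    have "(\<lambda>i. \<integral>x. norm (f x - s i x) \<partial>lborel) \<longlonglongrightarrow> (\<integral>(x::'a). 0 \<partial>lborel)"
    proof (rule integral_dominated_convergence)
      show "integrable lborel (\<lambda>x. 3 * norm (f x))" using lim.hyps(4) by simp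
      show "AE x in lborel. (\<lambda>i. norm (f x - s i x)) \<longlonglongrightarrow> 0"
        by (auto intro!: AE_I2 tendsto_eq_intros lim.hyps(2))
      show "AE x in lborel. norm (norm (f x - s i x)) \<le> 3 * norm (f x)" for i
      proof (rule AE_I2)
        fix x :: 'a
        have "norm (f x - s i x) \<le> norm (f x) + norm (s i x)" by (rule norm_triangle_ineq4)
        also have "\<dots> \<le> norm (f x) + 2 * norm (f x)" using lim.hyps(3)[of x i] by simp
        finally show "norm (norm (f x - s i x)) \<le> 3 * norm (f x)" by simp
      qed
      show "(\<lambda>x. norm (f x - s i x)) \<in> borel_measurable lborel" for i
        using borel_measurable_integrable[OF lim.hyps(1)[of i]] borel_measurable_integrable[OF lim.hyps(4)] by measurable
    qed simp
    from LIMSEQ_D[OF this e] obtain i where "(\<integral>x. norm (f x - s i x) \<partial>lborel) < e"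
      by (auto simp: integral_nonneg_AE)
    then show "\<exists>g. integrable lborel g \<and> (\<integral>x. norm (f x - g x) \<partial>lborel) < e \<and>
             (\<lambda>n. \<integral>x. norm (g (x + X n) - g x) \<partial>lborel) \<longlonglongrightarrow> 0"
      using lim.hyps(1) lim.IH by blast
  qed
qed

text \<open>The heat kernel at time \<open>1 / (4 * a)\<close>; it concentrates at 0 as
  \<open>a\<close> grows.\<close>

definition gauss_kernel :: "real \<Rightarrow> 'a::euclidean_space \<Rightarrow> real" where
  "gauss_kernel a x = sqrt (a / pi) ^ DIM('a) * exp (- a * (norm x)\<^sup>2)"

lemma borel_measurable_gauss_kernel [measurable]: "gauss_kernel a \<in> borel_measurable borel"
  unfolding gauss_kernel_def[abs_def] by measurable

lemma gauss_kernel_nonneg [simp]: "a > 0 \<Longrightarrow> gauss_kernel a x \<ge> 0"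
  by (simp add: gauss_kernel_def)

lemma gauss_kernel_minus [simp]: "gauss_kernel a (- x) = gauss_kernel a x"
  by (simp add: gauss_kernel_def)

lemma gauss_kernel_bounded: "a > 0 \<Longrightarrow> gauss_kernel a (x::'a::euclidean_space) \<le> sqrt (a / pi) ^ DIM('a)"
  by (simp add: gauss_kernel_def mult_left_le)

lemma
  assumes a: "a > 0"
  shows integrable_gauss_kernel: "integrable lborel (gauss_kernel a :: 'a::euclidean_space \<Rightarrow> real)"
    and integral_gauss_kernel: "(\<integral>(x::'a). gauss_kernel a x \<partial>lborel) = 1"
proof -
  show "integrable lborel (gauss_kernel a :: 'a \<Rightarrow> real)"
    using integrable_gaussian[OF a, where 'a='a] by (simp add: gauss_kernel_def[abs_def])
  show "(\<integral>(x::'a). gauss_kernel a x \<partial>lborel) = 1"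
    using integral_gaussian[OF a, where 'a='a] a
    by (simp add: gauss_kernel_def[abs_def] flip: power_mult_distrib real_sqrt_mult)
qed

lemma nn_integral_gauss_kernel:
  "a > 0 \<Longrightarrow> (\<integral>\<^sup>+(x::'a::euclidean_space). ennreal (gauss_kernel a x) \<partial>lborel) = 1"
  by (subst nn_integral_eq_integral[OF integrable_gauss_kernel]) (auto simp: integral_gauss_kernel)

lemma gauss_kernel_scale:
  assumes "a > 0"
  shows "sqrt (1 / a) ^ DIM('a) * gauss_kernel a (sqrt (1 / a) *\<^sub>R z) = gauss_kernel 1 (z::'a::euclidean_space)"
proof -
  have "a * (norm (sqrt (1 / a) *\<^sub>R z))\<^sup>2 = (norm z)\<^sup>2"
    using assms by (simp add: power_mult_distrib real_sqrt_pow2)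
  moreover have "sqrt (1 / a) ^ DIM('a) * sqrt (a / pi) ^ DIM('a) = sqrt (1 / pi) ^ DIM('a)"
    using assms by (simp flip: power_mult_distrib real_sqrt_mult)
  ultimately show ?thesis
    unfolding gauss_kernel_def by (simp flip: mult.assoc)
qed

definition mollify :: "real \<Rightarrow> ('a::euclidean_space \<Rightarrow> complex) \<Rightarrow> 'a \<Rightarrow> complex" where
  "mollify a k y = (\<integral>x. gauss_kernel a (y - x) *\<^sub>R k x \<partial>lborel)"

lemma integrable_mollify_integrand:
  fixes k :: "'a::euclidean_space \<Rightarrow> complex"
  assumes a: "a > 0" and k: "integrable lborel k"
  shows "integrable lborel (\<lambda>x. gauss_kernel a (y - x) *\<^sub>R k x)"
proof (rule Bochner_Integration.integrable_bound)
  have [measurable]: "k \<in> borel_measurable borel" using borel_measurable_integrable[OF k] by simp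
  show "integrable lborel (\<lambda>x. (sqrt (a / pi) ^ DIM('a)) *\<^sub>R k x)" using k by simp
  show "(\<lambda>x. gauss_kernel a (y - x) *\<^sub>R k x) \<in> borel_measurable lborel" by measurable
  show "AE x in lborel. norm (gauss_kernel a (y - x) *\<^sub>R k x) \<le> norm ((sqrt (a / pi) ^ DIM('a)) *\<^sub>R k x)"
    using a gauss_kernel_bounded[OF a, where 'a='a] by (auto intro!: mult_right_mono simp: abs_mult)
qed

lemma borel_measurable_mollify [measurable]:
  assumes [measurable]: "k \<in> borel_measurable borel"
  shows "mollify a k \<in> borel_measurable borel"
  unfolding mollify_def[abs_def] by measurable

text \<open>Rescaling makes the kernel independent of \<open>a\<close>, which then occurs only in
  the size of the translation \<open>sqrt (1 / a) *\<^sub>R z\<close>.\<close>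

lemma mollify_altdef:
  assumes a: "a > 0" and [measurable]: "k \<in> borel_measurable borel"
  shows "mollify a k y = (\<integral>z. gauss_kernel 1 z *\<^sub>R k (y + sqrt (1 / a) *\<^sub>R z) \<partial>lborel)"
proof -
  have c: "sqrt (1 / a) \<noteq> 0" using a by simp
  have "mollify a k y = (\<bar>sqrt (1 / a)\<bar> ^ DIM('a)) *\<^sub>R
     (\<integral>x. gauss_kernel a (y - (y + sqrt (1 / a) *\<^sub>R x)) *\<^sub>R k (y + sqrt (1 / a) *\<^sub>R x) \<partial>lborel)"
    unfolding mollify_def by (rule integral_lborel_affine) (use c in auto)
  also have "\<dots> = (\<integral>x. (\<bar>sqrt (1 / a)\<bar> ^ DIM('a)) *\<^sub>R
     gauss_kernel a (y - (y + sqrt (1 / a) *\<^sub>R x)) *\<^sub>R k (y + sqrt (1 / a) *\<^sub>R x) \<partial>lborel)"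
    by (rule integral_scaleR_right[symmetric])
  also have "\<dots> = (\<integral>z. gauss_kernel 1 z *\<^sub>R k (y + sqrt (1 / a) *\<^sub>R z) \<partial>lborel)"
  proof (rule Bochner_Integration.integral_cong)
    fix x :: 'a
    have "y - (y + sqrt (1 / a) *\<^sub>R x) = - (sqrt (1 / a) *\<^sub>R x)" by simp
    then show "(\<bar>sqrt (1 / a)\<bar> ^ DIM('a)) *\<^sub>R gauss_kernel a (y - (y + sqrt (1 / a) *\<^sub>R x)) *\<^sub>R k (y + sqrt (1 / a) *\<^sub>R x)
       = gauss_kernel 1 x *\<^sub>R k (y + sqrt (1 / a) *\<^sub>R x)"
      using a gauss_kernel_scale[OF a, of x] by (simp only: gauss_kernel_minus scaleR_scaleR) simp
  qed simp
  finally show ?thesis .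
qed

text \<open>The kernel has mass 1, so \<open>k y\<close> can be brought under the integral; Tonelli
  then bounds the error by a Gaussian average of the translation errors of \<open>k\<close>.\<close>

lemma mollify_L1_bound:
  fixes k :: "'a::euclidean_space \<Rightarrow> complex"
  assumes a: "a > 0" and k: "integrable lborel k"
  shows "(\<integral>\<^sup>+y. ennreal (norm (mollify a k y - k y)) \<partial>lborel)
     \<le> (\<integral>\<^sup>+z. ennreal (gauss_kernel 1 z) * (\<integral>\<^sup>+y. ennreal (norm (k (y + sqrt (1 / a) *\<^sub>R z) - k y)) \<partial>lborel) \<partial>lborel)"
proof -
  have [measurable]: "k \<in> borel_measurable borel" using borel_measurable_integrable[OF k] by simp
  have "(\<integral>\<^sup>+y. ennreal (norm (mollify a k y - k y)) \<partial>lborel)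
      \<le> (\<integral>\<^sup>+y. (\<integral>\<^sup>+z. ennreal (gauss_kernel 1 z) * ennreal (norm (k (y + sqrt (1 / a) *\<^sub>R z) - k y)) \<partial>lborel) \<partial>lborel)"
  proof (rule nn_integral_mono)
    fix y :: 'a
    have i1: "integrable lborel (\<lambda>z. gauss_kernel 1 z *\<^sub>R k (y + sqrt (1 / a) *\<^sub>R z))"
      by (rule Bochner_Integration.integrable_bound[where f="\<lambda>z. (sqrt (1 / pi) ^ DIM('a)) *\<^sub>R k (y + sqrt (1 / a) *\<^sub>R z)"])
        (use a k gauss_kernel_bounded[of 1, where 'a='a] integrable_lborel_affine[OF k, of "sqrt (1 / a)" y] in
          \<open>auto intro!: mult_right_mono simp: abs_mult real_sqrt_divide\<close>)
    have i2: "integrable lborel (\<lambda>z::'a. gauss_kernel 1 z *\<^sub>R k y)"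
      using integrable_gauss_kernel[of 1, where 'a='a] by simp
    have "mollify a k y - k y = (\<integral>z. gauss_kernel 1 z *\<^sub>R k (y + sqrt (1 / a) *\<^sub>R z) \<partial>lborel) - (\<integral>(z::'a). gauss_kernel 1 z *\<^sub>R k y \<partial>lborel)"
      using integrable_gauss_kernel[of 1, where 'a='a] a
      by (subst integral_scaleR_left) (simp_all add: mollify_altdef integral_gauss_kernel)
    also have "\<dots> = (\<integral>z. gauss_kernel 1 z *\<^sub>R (k (y + sqrt (1 / a) *\<^sub>R z) - k y) \<partial>lborel)"
      using i1 i2 by (simp add: scaleR_diff_right)
    also have "ennreal (norm \<dots>) \<le> (\<integral>\<^sup>+z. ennreal (norm (gauss_kernel 1 z *\<^sub>R (k (y + sqrt (1 / a) *\<^sub>R z) - k y))) \<partial>lborel)"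
      by (rule integral_norm_bound_ennreal) (use i1 i2 in \<open>simp add: scaleR_diff_right\<close>)
    finally show "ennreal (norm (mollify a k y - k y)) \<le> (\<integral>\<^sup>+z. ennreal (gauss_kernel 1 z) * ennreal (norm (k (y + sqrt (1 / a) *\<^sub>R z) - k y)) \<partial>lborel)"
      by (simp add: ennreal_mult)
  qed
  also have "\<dots> = (\<integral>\<^sup>+z. (\<integral>\<^sup>+y. ennreal (gauss_kernel 1 z) * ennreal (norm (k (y + sqrt (1 / a) *\<^sub>R z) - k y)) \<partial>lborel) \<partial>lborel)"
    by (subst lborel_pair.Fubini') simp_all
  also have "\<dots> = (\<integral>\<^sup>+z. ennreal (gauss_kernel 1 z) * (\<integral>\<^sup>+y. ennreal (norm (k (y + sqrt (1 / a) *\<^sub>R z) - k y)) \<partial>lborel) \<partial>lborel)"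
    by (simp add: nn_integral_cmult)
  finally show ?thesis .
qed

lemma mollify_L1:
  fixes k :: "'a::euclidean_space \<Rightarrow> complex"
  assumes a: "\<And>n. a n > 0" "filterlim a at_top sequentially" and k: "integrable lborel k"
  shows "\<And>n. integrable lborel (mollify (a n) k)"
    and "(\<lambda>n. \<integral>y. norm (mollify (a n) k y - k y) \<partial>lborel) \<longlonglongrightarrow> 0"
proof -
  have [measurable]: "k \<in> borel_measurable borel" using borel_measurable_integrable[OF k] by simp
  \<comment> \<open>The modulus of continuity of \<open>k\<close> in the mean. It is bounded by
    twice the norm of \<open>k\<close> and tends to 0 at 0, so the Gaussian averages
    \<open>D n\<close> tend to 0 by dominated convergence.\<close>
  define w where "w h = (\<integral>y. norm (k (y + h) - k y) \<partial>lborel)" for h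
  define D where "D n = (\<integral>z. gauss_kernel 1 z * w (sqrt (1 / a n) *\<^sub>R z) \<partial>lborel)" for n
  have wi: "integrable lborel (\<lambda>y. norm (k (y + h) - k y))" for h
    using k integrable_lborel_translate[OF k, of h] by simp
  have w0: "w h \<ge> 0" for h by (simp add: w_def)
  have wb: "w h \<le> 2 * (\<integral>y. norm (k y) \<partial>lborel)" for h
  proof -
    have "w h \<le> (\<integral>y. norm (k (y + h)) + norm (k y) \<partial>lborel)" unfolding w_def
      by (rule integral_mono)
         (use k integrable_lborel_translate[OF k, of h] in \<open>simp_all add: norm_triangle_ineq4\<close>)
    also have "\<dots> = 2 * (\<integral>y. norm (k y) \<partial>lborel)"
      using k integrable_lborel_translate[OF k, of h] integral_lborel_translate[of "\<lambda>x. norm (k x)" h] by simp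
    finally show ?thesis .
  qed
  have wm[measurable]: "w \<in> borel_measurable borel"
    unfolding w_def[abs_def] by measurable
  have iD: "integrable lborel (\<lambda>z. gauss_kernel 1 z * w (sqrt (1 / a n) *\<^sub>R z))" for n
  proof (rule Bochner_Integration.integrable_bound)
    show "integrable lborel (\<lambda>z::'a. gauss_kernel 1 z * (2 * (\<integral>y. norm (k y) \<partial>lborel)))"
      using integrable_gauss_kernel[of 1, where 'a='a] by simp
    show "AE z in lborel. norm (gauss_kernel 1 z * w (sqrt (1 / a n) *\<^sub>R z)) \<le> norm (gauss_kernel 1 z * (2 * (\<integral>y. norm (k y) \<partial>lborel)))"
      using wb w0 by (auto simp: abs_mult intro!: mult_left_mono)
  qed measurable
  have bd: "(\<integral>\<^sup>+y. ennreal (norm (mollify (a n) k y - k y)) \<partial>lborel) \<le> ennreal (D n)" for n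
  proof -
    have "(\<integral>\<^sup>+y. ennreal (norm (k (y + h) - k y)) \<partial>lborel) = ennreal (w h)" for h
      unfolding w_def by (rule nn_integral_eq_integral[OF wi]) simp
    then have "(\<integral>\<^sup>+y. ennreal (norm (mollify (a n) k y - k y)) \<partial>lborel)
       \<le> (\<integral>\<^sup>+z. ennreal (gauss_kernel 1 z * w (sqrt (1 / a n) *\<^sub>R z)) \<partial>lborel)"
      using mollify_L1_bound[OF a(1) k, of n] by (simp add: ennreal_mult w0)
    also have "\<dots> = ennreal (D n)"
      unfolding D_def by (rule nn_integral_eq_integral[OF iD]) (simp add: w0)
    finally show ?thesis .
  qed
  have id: "integrable lborel (\<lambda>y. mollify (a n) k y - k y)" for n
    using le_less_trans[OF bd[of n], of \<infinity>] by (simp add: integrable_iff_bounded)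
  then show "integrable lborel (mollify (a n) k)" for n
    using Bochner_Integration.integrable_add[OF id[of n] k] by simp
  have "D \<longlonglongrightarrow> (\<integral>(z::'a). 0 \<partial>lborel)"
    unfolding D_def[abs_def]
  proof (rule integral_dominated_convergence)
    show "integrable lborel (\<lambda>z::'a. gauss_kernel 1 z * (2 * (\<integral>y. norm (k y) \<partial>lborel)))"
      using integrable_gauss_kernel[of 1, where 'a='a] by simp
    show "AE z in lborel. norm (gauss_kernel 1 z * w (sqrt (1 / a n) *\<^sub>R z)) \<le> gauss_kernel 1 z * (2 * (\<integral>y. norm (k y) \<partial>lborel))" for n
      using wb w0 by (auto simp: abs_mult intro!: mult_left_mono)
    have s: "(\<lambda>n. sqrt (1 / a n)) \<longlonglongrightarrow> 0"
      using tendsto_real_sqrt[OF tendsto_divide_0[OF tendsto_const filterlim_at_top_imp_at_infinity[OF a(2)]], of 1] by simp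
    show "AE z in lborel. (\<lambda>n. gauss_kernel 1 z * w (sqrt (1 / a n) *\<^sub>R z)) \<longlonglongrightarrow> 0"
    proof (rule AE_I2)
      fix z :: 'a
      have "(\<lambda>n. sqrt (1 / a n) *\<^sub>R z) \<longlonglongrightarrow> 0" using tendsto_scaleR[OF s tendsto_const] by simp
      from L1_translation[OF k this] have "(\<lambda>n. w (sqrt (1 / a n) *\<^sub>R z)) \<longlonglongrightarrow> 0"
        unfolding w_def .
      from tendsto_mult[OF tendsto_const[of "gauss_kernel 1 z"] this] show "(\<lambda>n. gauss_kernel 1 z * w (sqrt (1 / a n) *\<^sub>R z)) \<longlonglongrightarrow> 0"
        unfolding mult_zero_right .
    qed
  qed measurable
  then have D0: "D \<longlonglongrightarrow> 0" by simp
  show "(\<lambda>n. \<integral>y. norm (mollify (a n) k y - k y) \<partial>lborel) \<longlonglongrightarrow> 0"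
  proof (rule tendsto_sandwich[OF _ _ tendsto_const D0])
    show "\<forall>\<^sub>F n in sequentially. (\<integral>y. norm (mollify (a n) k y - k y) \<partial>lborel) \<le> D n"
    proof (rule always_eventually, rule allI)
      fix n
      have "ennreal (\<integral>y. norm (mollify (a n) k y - k y) \<partial>lborel) \<le> ennreal (D n)"
        using bd[of n] id[of n] by (subst nn_integral_eq_integral[symmetric]) auto
      then show "(\<integral>y. norm (mollify (a n) k y - k y) \<partial>lborel) \<le> D n"
        using w0 by (subst (asm) ennreal_le_iff) (auto simp: D_def intro!: integral_nonneg_AE)
    qed
  qed simp
qed

text \<open>Convergence in the mean gives pointwise convergence only along a subsequence; this is
  enough wherever a limit merely has to be identified.\<close>

lemma mollify_AE_subseq:
  fixes k :: "'a::euclidean_space \<Rightarrow> complex"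
  assumes a: "\<And>n. a n > 0" "filterlim a at_top sequentially" and k: "integrable lborel k"
  obtains r :: "nat \<Rightarrow> nat" where "strict_mono r" "AE y in lborel. (\<lambda>n. mollify (a (r n)) k y) \<longlonglongrightarrow> k y"
proof -
  have "\<exists>r::nat\<Rightarrow>nat. strict_mono r \<and> (AE x in lborel. (\<lambda>n. mollify (a (r n)) k x - k x) \<longlonglongrightarrow> 0)"
    by (rule tendsto_L1_AE_subseq) (use mollify_L1[OF assms] k in auto)
  then show ?thesis using that by (auto simp: LIM_zero_iff)
qed

subsection \<open>Uniqueness, inversion and Plancherel for integrable functions\<close>

text \<open>The transform with the sign of the inversion formula and without its constant. It serves
  functions on space and on space-time alike.\<close>

definition osc_integral :: "('a::euclidean_space \<Rightarrow> complex) \<Rightarrow> 'a \<Rightarrow> complex" where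
  "osc_integral k p = (\<integral>y. k y * cis (p \<bullet> y) \<partial>lborel)"

lemma borel_measurable_cnj [measurable (raw)]:
  "f \<in> borel_measurable M \<Longrightarrow> (\<lambda>x. cnj (f x)) \<in> borel_measurable M"
  by (rule measurable_compose[where N=borel]) (auto intro!: borel_measurable_continuous_onI continuous_intros)

text \<open>Integrability is not assumed: the Bochner integral of a non-integrable function is
  0.\<close>

lemma norm_integral_le_nn_integral:
  fixes f :: "'a \<Rightarrow> 'b::{banach, second_countable_topology}"
  shows "ennreal (norm (integral\<^sup>L M f)) \<le> (\<integral>\<^sup>+x. ennreal (norm (f x)) \<partial>M)"
  by (cases "integrable M f") (simp_all add: integral_norm_bound_ennreal not_integrable_integral_eq)

lemma integrable_mult_cis:
  assumes k: "integrable M k" and [measurable]: "f \<in> borel_measurable M"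
  shows "integrable M (\<lambda>y. k y * cis (f y))"
proof (rule Bochner_Integration.integrable_bound[OF k])
  have [measurable]: "k \<in> borel_measurable M" using k by simp
  show "(\<lambda>y. k y * cis (f y)) \<in> borel_measurable M" by measurable
qed (simp add: norm_mult)

lemma borel_measurable_osc_integral [measurable]:
  assumes [measurable]: "k \<in> borel_measurable borel"
  shows "osc_integral k \<in> borel_measurable borel"
  unfolding osc_integral_def[abs_def] by measurable

lemma norm_osc_integral_le: "norm (osc_integral k p) \<le> (\<integral>y. norm (k y) \<partial>lborel)"
  unfolding osc_integral_def
  by (rule order_trans[OF integral_norm_bound]) (simp add: norm_mult)

lemma norm_mult_exp_le:
  assumes "b > 0"
  shows "norm (exp (- b * (norm p)\<^sup>2) *\<^sub>R (z::complex)) \<le> norm z"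
  using assms by (simp add: mult_left_le_one_le)

lemma integrable_gaussian_osc:
  fixes k :: "'a::euclidean_space \<Rightarrow> complex"
  assumes k: "integrable lborel k" and b: "b > 0"
  shows "integrable lborel (\<lambda>p. exp (- b * (norm p)\<^sup>2) *\<^sub>R osc_integral k p)"
proof (rule Bochner_Integration.integrable_bound)
  have [measurable]: "k \<in> borel_measurable borel" using borel_measurable_integrable[OF k] by simp
  show "integrable lborel (\<lambda>p::'a. exp (- b * (norm p)\<^sup>2) * (\<integral>y. norm (k y) \<partial>lborel))"
    using integrable_gaussian[OF b, where 'a='a] by simp
  show "AE p in lborel. norm (exp (- b * (norm p)\<^sup>2) *\<^sub>R osc_integral k p)
      \<le> norm (exp (- b * (norm p)\<^sup>2) * (\<integral>y. norm (k y) \<partial>lborel))"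
    using norm_osc_integral_le[of k]
    by (intro AE_I2) (auto simp: abs_mult intro!: mult_left_mono order_trans[OF norm_osc_integral_le])
  show "(\<lambda>p. exp (- b * (norm p)\<^sup>2) *\<^sub>R osc_integral k p) \<in> borel_measurable lborel" by measurable
qed

text \<open>The Gaussian makes the double integral absolutely convergent, which the inversion
  integral of \<open>osc_integral k\<close> alone need not be. After Fubini the integral over
  \<open>p\<close> is the transform of a Gaussian, a multiple of the kernel with parameter
  \<open>1 / (4 * b)\<close>.\<close>

lemma osc_integral_gaussian_osc:
  fixes k :: "'a::euclidean_space \<Rightarrow> complex"
  assumes k: "integrable lborel k" and b: "b > 0"
  shows "osc_integral (\<lambda>p. exp (- b * (norm p)\<^sup>2) *\<^sub>R osc_integral k p) (- y)
     = (2 * pi) ^ DIM('a) *\<^sub>R mollify (1 / (4 * b)) k y"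
proof -
  have [measurable]: "k \<in> borel_measurable borel" using borel_measurable_integrable[OF k] by simp
  have 1: "integrable (lborel \<Otimes>\<^sub>M lborel) (\<lambda>(p, x). k x * (exp (- b * (norm p)\<^sup>2) *\<^sub>R cis (p \<bullet> (x - y))))"
  proof (rule Bochner_Integration.integrable_bound)
    show "integrable (lborel \<Otimes>\<^sub>M lborel) (\<lambda>(p::'a, x). exp (- b * (norm p)\<^sup>2) * norm (k x))"
    proof (rule lborel_pair.Fubini_integrable)
      show "integrable lborel (\<lambda>p::'a. \<integral>x. norm (case (p, x) of (p, x) \<Rightarrow> exp (- b * (norm p)\<^sup>2) * norm (k x)) \<partial>lborel)"
        using integrable_gaussian[OF b, where 'a='a] k by (simp add: abs_mult)
    qed (use k in auto)
  qed (auto simp: norm_mult abs_mult)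
  have "osc_integral (\<lambda>p. exp (- b * (norm p)\<^sup>2) *\<^sub>R osc_integral k p) (- y)
      = (\<integral>p. (\<integral>x. k x * (exp (- b * (norm p)\<^sup>2) *\<^sub>R cis (p \<bullet> (x - y))) \<partial>lborel) \<partial>lborel)"
    unfolding osc_integral_def
  proof (rule Bochner_Integration.integral_cong[OF refl])
    fix p :: 'a
    have c: "cis (p \<bullet> (x - y)) = cis (p \<bullet> x) * cis (- y \<bullet> p)" for x
      by (simp add: cis_mult inner_diff_right inner_commute)
    have "exp (- b * (norm p)\<^sup>2) *\<^sub>R (\<integral>x. k x * cis (p \<bullet> x) \<partial>lborel) * cis (- y \<bullet> p)
       = (\<integral>x. (exp (- b * (norm p)\<^sup>2) *\<^sub>R cis (- y \<bullet> p)) * (k x * cis (p \<bullet> x)) \<partial>lborel)"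
      by simp
    also have "\<dots> = (\<integral>x. k x * (exp (- b * (norm p)\<^sup>2) *\<^sub>R cis (p \<bullet> (x - y))) \<partial>lborel)"
      by (rule Bochner_Integration.integral_cong[OF refl])
         (simp add: c)
    finally show "exp (- b * (norm p)\<^sup>2) *\<^sub>R (\<integral>x. k x * cis (p \<bullet> x) \<partial>lborel) * cis (- y \<bullet> p)
       = (\<integral>x. k x * (exp (- b * (norm p)\<^sup>2) *\<^sub>R cis (p \<bullet> (x - y))) \<partial>lborel)" .
  qed
  also have "\<dots> = (\<integral>x. (\<integral>p. k x * (exp (- b * (norm p)\<^sup>2) *\<^sub>R cis (p \<bullet> (x - y))) \<partial>lborel) \<partial>lborel)"
    by (rule lborel_pair.Fubini_integral[symmetric, OF 1])
  also have "\<dots> = (\<integral>x. (2 * pi) ^ DIM('a) *\<^sub>R (gauss_kernel (1 / (4 * b)) (y - x) *\<^sub>R k x) \<partial>lborel)"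
  proof (rule Bochner_Integration.integral_cong[OF refl])
    fix x :: 'a
    have "(2 * pi) ^ DIM('a) * sqrt ((1 / (4 * b)) / pi) ^ DIM('a) = sqrt (pi / b) ^ DIM('a)"
    proof -
      have "2 * pi * sqrt ((1 / (4 * b)) / pi) = sqrt (pi / b)"
        using b by (simp add: real_sqrt_divide real_sqrt_mult field_simps)
      then show ?thesis by (metis power_mult_distrib)
    qed
    then have e: "(2 * pi) ^ DIM('a) * gauss_kernel (1 / (4 * b)) (y - x) = sqrt (pi / b) ^ DIM('a) * exp (- (norm (x - y))\<^sup>2 / (4 * b))"
      by (simp add: gauss_kernel_def norm_minus_commute flip: mult.assoc)
    have "(\<integral>p. k x * (exp (- b * (norm p)\<^sup>2) *\<^sub>R cis (p \<bullet> (x - y))) \<partial>lborel)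
       = k x * of_real (sqrt (pi / b) ^ DIM('a) * exp (- (norm (x - y))\<^sup>2 / (4 * b)))"
      using integral_gaussian_cis[OF b, of "x - y"] by (subst integral_mult_right_zero) simp
    also have "\<dots> = (2 * pi) ^ DIM('a) *\<^sub>R (gauss_kernel (1 / (4 * b)) (y - x) *\<^sub>R k x)"
      unfolding e[symmetric] by (simp add: scaleR_conv_of_real)
    finally show "(\<integral>p. k x * (exp (- b * (norm p)\<^sup>2) *\<^sub>R cis (p \<bullet> (x - y))) \<partial>lborel)
       = (2 * pi) ^ DIM('a) *\<^sub>R (gauss_kernel (1 / (4 * b)) (y - x) *\<^sub>R k x)" .
  qed
  also have "\<dots> = (2 * pi) ^ DIM('a) *\<^sub>R mollify (1 / (4 * b)) k y"
    unfolding mollify_def by (rule integral_scaleR_right)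
  finally show ?thesis .
qed

text \<open>Damping by \<open>b\<close> on the frequency side corresponds to the kernel parameter
  \<open>1 / (4 * b)\<close>, so that vanishing damping means a concentrating kernel.\<close>

lemma mollify_osc_AE_subseq:
  fixes k :: "'a::euclidean_space \<Rightarrow> complex"
  assumes k: "integrable lborel k"
  obtains b :: "nat \<Rightarrow> real" where "\<And>n. b n > 0" "b \<longlonglongrightarrow> 0"
     "AE y in lborel. (\<lambda>n. mollify (1 / (4 * b n)) k y) \<longlonglongrightarrow> k y"
proof -
  define a where "a n = real (Suc n)" for n
  have a: "\<And>n. a n > 0" "filterlim a at_top sequentially"
    unfolding a_def using filterlim_compose[OF filterlim_real_sequentially filterlim_Suc] by simp_all
  from mollify_AE_subseq[OF a k] obtain r :: "nat \<Rightarrow> nat"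
    where r: "strict_mono r" "AE y in lborel. (\<lambda>n. mollify (a (r n)) k y) \<longlonglongrightarrow> k y" by blast
  define b where "b n = 1 / (4 * a (r n))" for n
  have "filterlim (\<lambda>n. 4 * a (r n)) at_top sequentially"
    by (intro filterlim_tendsto_pos_mult_at_top[OF tendsto_const] filterlim_compose[OF a(2)] filterlim_subseq r) simp
  then have "b \<longlonglongrightarrow> 0"
    unfolding b_def[abs_def] by (intro tendsto_divide_0[OF tendsto_const] filterlim_at_top_imp_at_infinity)
  moreover have "\<And>n. b n > 0" using a by (simp add: b_def)
  moreover have "1 / (4 * b n) = a (r n)" for n using a(1)[of "r n"] by (simp add: b_def)
  ultimately show ?thesis using that[of b] r(2) by simp
qed

text \<open>Let \<open>b\<close> tend to 0 in \<open>osc_integral_gaussian_osc\<close>: the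
  left-hand side converges everywhere by dominated convergence, as the transform is integrable, and
  the right-hand side converges almost everywhere along a subsequence.\<close>

lemma osc_integral_inversion:
  fixes k :: "'a::euclidean_space \<Rightarrow> complex"
  assumes k: "integrable lborel k" and ik: "integrable lborel (osc_integral k)"
  shows "AE y in lborel. osc_integral (osc_integral k) (- y) = (2 * pi) ^ DIM('a) *\<^sub>R k y"
proof -
  have [measurable]: "k \<in> borel_measurable borel" using borel_measurable_integrable[OF k] by simp
  obtain b :: "nat \<Rightarrow> real" where b: "\<And>n. b n > 0" "b \<longlonglongrightarrow> 0"
    "AE y in lborel. (\<lambda>n. mollify (1 / (4 * b n)) k y) \<longlonglongrightarrow> k y"
    using mollify_osc_AE_subseq[OF k] by blast
  have lim: "(\<lambda>n. osc_integral (\<lambda>p. exp (- b n * (norm p)\<^sup>2) *\<^sub>R osc_integral k p) (- y)) \<longlonglongrightarrow> osc_integral (osc_integral k) (- y)" for y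
    unfolding osc_integral_def[of _ "- y"]
  proof (rule integral_dominated_convergence)
    show "integrable lborel (\<lambda>p. norm (osc_integral k p))" using ik by simp
    show "AE p in lborel. norm (exp (- b n * (norm p)\<^sup>2) *\<^sub>R osc_integral k p * cis (- y \<bullet> p)) \<le> norm (osc_integral k p)" for n
      using norm_mult_exp_le[OF b(1)] by (auto simp: norm_mult)
    show "AE p in lborel. (\<lambda>n. exp (- b n * (norm p)\<^sup>2) *\<^sub>R osc_integral k p * cis (- y \<bullet> p)) \<longlonglongrightarrow> osc_integral k p * cis (- y \<bullet> p)"
    proof (rule AE_I2)
      fix p :: 'a
      have "(\<lambda>n. exp (- b n * (norm p)\<^sup>2) *\<^sub>R osc_integral k p * cis (- y \<bullet> p)) \<longlonglongrightarrow> exp (- 0 * (norm p)\<^sup>2) *\<^sub>R osc_integral k p * cis (- y \<bullet> p)"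
        by (intro tendsto_intros b(2))
      then show "(\<lambda>n. exp (- b n * (norm p)\<^sup>2) *\<^sub>R osc_integral k p * cis (- y \<bullet> p)) \<longlonglongrightarrow> osc_integral k p * cis (- y \<bullet> p)" by simp
    qed
  qed measurable
  from b(3) show ?thesis
  proof eventually_elim
    case (elim y)
    have "(\<lambda>n. (2 * pi) ^ DIM('a) *\<^sub>R mollify (1 / (4 * b n)) k y) \<longlonglongrightarrow> (2 * pi) ^ DIM('a) *\<^sub>R k y"
      by (intro tendsto_intros elim)
    moreover have "(\<lambda>n. (2 * pi) ^ DIM('a) *\<^sub>R mollify (1 / (4 * b n)) k y) \<longlonglongrightarrow> osc_integral (osc_integral k) (- y)"
      using lim[of y] osc_integral_gaussian_osc[OF k b(1)] by simp
    ultimately show ?case by (rule LIMSEQ_unique[symmetric])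
  qed
qed

text \<open>A Schur estimate: |k(x)| |k(y)| is at most the mean of the squares, and the kernel has
  mass 1 in either variable.\<close>

lemma nn_integral_norm_mollify_le:
  fixes k :: "'a::euclidean_space \<Rightarrow> complex"
  assumes k: "integrable lborel k" and a: "a > 0"
  shows "(\<integral>\<^sup>+y. ennreal (norm (k y) * norm (mollify a k y)) \<partial>lborel) \<le> (\<integral>\<^sup>+y. ennreal ((norm (k y))\<^sup>2) \<partial>lborel)"
proof -
  have [measurable]: "k \<in> borel_measurable borel" using borel_measurable_integrable[OF k] by simp
  define N where "N = (\<integral>\<^sup>+y. ennreal ((norm (k y))\<^sup>2) \<partial>lborel)"
  have "(\<integral>\<^sup>+y. ennreal (norm (k y) * norm (mollify a k y)) \<partial>lborel)
     \<le> (\<integral>\<^sup>+y. (\<integral>\<^sup>+x. ennreal (gauss_kernel a (y - x)) * ennreal (1/2 * (norm (k y))\<^sup>2 + 1/2 * (norm (k x))\<^sup>2) \<partial>lborel) \<partial>lborel)"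
  proof (rule nn_integral_mono)
    fix y :: 'a
    have "ennreal (norm (mollify a k y)) \<le> (\<integral>\<^sup>+x. ennreal (norm (gauss_kernel a (y - x) *\<^sub>R k x)) \<partial>lborel)"
      unfolding mollify_def by (rule integral_norm_bound_ennreal[OF integrable_mollify_integrand[OF a k]])
    then have "ennreal (norm (k y) * norm (mollify a k y)) \<le> ennreal (norm (k y)) * (\<integral>\<^sup>+x. ennreal (norm (gauss_kernel a (y - x) *\<^sub>R k x)) \<partial>lborel)"
      by (simp add: ennreal_mult mult_left_mono)
    also have "\<dots> = (\<integral>\<^sup>+x. ennreal (norm (k y)) * ennreal (norm (gauss_kernel a (y - x) *\<^sub>R k x)) \<partial>lborel)"
      by (rule nn_integral_cmult[symmetric]) measurable
    also have "\<dots> \<le> (\<integral>\<^sup>+x. ennreal (gauss_kernel a (y - x)) * ennreal (1/2 * (norm (k y))\<^sup>2 + 1/2 * (norm (k x))\<^sup>2) \<partial>lborel)"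
    proof (rule nn_integral_mono)
      fix x :: 'a
      have "norm (k y) * norm (k x) \<le> 1/2 * (norm (k y))\<^sup>2 + 1/2 * (norm (k x))\<^sup>2"
        using sum_squares_bound[of "norm (k y)" "norm (k x)"] by simp
      then have "gauss_kernel a (y - x) * (norm (k y) * norm (k x)) \<le> gauss_kernel a (y - x) * (1/2 * (norm (k y))\<^sup>2 + 1/2 * (norm (k x))\<^sup>2)"
        using a by (intro mult_left_mono) auto
      then show "ennreal (norm (k y)) * ennreal (norm (gauss_kernel a (y - x) *\<^sub>R k x)) \<le> ennreal (gauss_kernel a (y - x)) * ennreal (1/2 * (norm (k y))\<^sup>2 + 1/2 * (norm (k x))\<^sup>2)"
        using a by (simp add: mult_ac del: ennreal_plus flip: ennreal_mult)
    qed
    finally show "ennreal (norm (k y) * norm (mollify a k y)) \<le> (\<integral>\<^sup>+x. ennreal (gauss_kernel a (y - x)) * ennreal (1/2 * (norm (k y))\<^sup>2 + 1/2 * (norm (k x))\<^sup>2) \<partial>lborel)" .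
  qed
  also have "\<dots> = (\<integral>\<^sup>+y. (\<integral>\<^sup>+x. ennreal (1/2 * (norm (k y))\<^sup>2) * ennreal (gauss_kernel a (y - x)) \<partial>lborel) \<partial>lborel)
     + (\<integral>\<^sup>+y. (\<integral>\<^sup>+x. ennreal (1/2 * (norm (k x))\<^sup>2) * ennreal (gauss_kernel a (y - x)) \<partial>lborel) \<partial>lborel)"
    by (simp add: distrib_left nn_integral_add mult.commute)
  also have "(\<integral>\<^sup>+y. (\<integral>\<^sup>+x. ennreal (1/2 * (norm (k x))\<^sup>2) * ennreal (gauss_kernel a (y - x)) \<partial>lborel) \<partial>lborel)
     = (\<integral>\<^sup>+x. (\<integral>\<^sup>+y. ennreal (1/2 * (norm (k x))\<^sup>2) * ennreal (gauss_kernel a (y - x)) \<partial>lborel) \<partial>lborel)"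
    by (subst lborel_pair.Fubini') simp_all
  also have "(\<integral>\<^sup>+y. (\<integral>\<^sup>+x. ennreal (1/2 * (norm (k y))\<^sup>2) * ennreal (gauss_kernel a (y - x)) \<partial>lborel) \<partial>lborel)
      = (\<integral>\<^sup>+y. ennreal (1/2 * (norm (k y))\<^sup>2) \<partial>lborel)"
  proof (rule nn_integral_cong)
    fix y :: 'a
    have "(\<integral>\<^sup>+x. ennreal (gauss_kernel a (y - x)) \<partial>lborel) = (\<integral>\<^sup>+(x::'a). ennreal (gauss_kernel a x) \<partial>lborel)"
      using nn_integral_lborel_affine[of "\<lambda>x::'a. ennreal (gauss_kernel a x)" "- 1" y] by simp
    then show "(\<integral>\<^sup>+x. ennreal (1/2 * (norm (k y))\<^sup>2) * ennreal (gauss_kernel a (y - x)) \<partial>lborel) = ennreal (1/2 * (norm (k y))\<^sup>2)"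
      using nn_integral_gauss_kernel[OF a, where 'a='a] by (simp add: nn_integral_cmult)
  qed
  also have "(\<integral>\<^sup>+x. (\<integral>\<^sup>+y. ennreal (1/2 * (norm (k x))\<^sup>2) * ennreal (gauss_kernel a (y - x)) \<partial>lborel) \<partial>lborel)
      = (\<integral>\<^sup>+x. ennreal (1/2 * (norm (k x))\<^sup>2) \<partial>lborel)"
  proof (rule nn_integral_cong)
    fix x :: 'a
    have "(\<integral>\<^sup>+y. ennreal (gauss_kernel a (y - x)) \<partial>lborel) = (\<integral>\<^sup>+(x::'a). ennreal (gauss_kernel a x) \<partial>lborel)"
      using nn_integral_lborel_translate[of "\<lambda>x::'a. ennreal (gauss_kernel a x)" "- x"] by simp
    then show "(\<integral>\<^sup>+y. ennreal (1/2 * (norm (k x))\<^sup>2) * ennreal (gauss_kernel a (y - x)) \<partial>lborel) = ennreal (1/2 * (norm (k x))\<^sup>2)"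
      using nn_integral_gauss_kernel[OF a, where 'a='a] by (simp add: nn_integral_cmult)
  qed
  also have "(\<integral>\<^sup>+y. ennreal (1/2 * (norm (k y))\<^sup>2) \<partial>lborel) + (\<integral>\<^sup>+y. ennreal (1/2 * (norm (k y))\<^sup>2) \<partial>lborel) = N"
    unfolding N_def by (subst nn_integral_add[symmetric]) (simp_all flip: ennreal_plus)
  finally show ?thesis unfolding N_def .
qed

text \<open>With a Gaussian damping on the frequency side, Fubini turns the integral into the
  pairing of \<open>k\<close> with its Gaussian mollification, which
  \<open>nn_integral_norm_mollify_le\<close> bounds independently of \<open>b\<close>. Fatou's lemma
  removes the damping.\<close>

lemma osc_integral_plancherel_le:
  fixes k :: "'a::euclidean_space \<Rightarrow> complex"
  assumes k: "integrable lborel k"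
  shows "(\<integral>\<^sup>+p. ennreal ((norm (osc_integral k p))\<^sup>2) \<partial>lborel) \<le> ennreal ((2 * pi) ^ DIM('a)) * (\<integral>\<^sup>+y. ennreal ((norm (k y))\<^sup>2) \<partial>lborel)"
    (is "?L \<le> ?R")
proof -
  have [measurable]: "k \<in> borel_measurable borel" using borel_measurable_integrable[OF k] by simp
  define w where "w = osc_integral k"
  have [measurable]: "w \<in> borel_measurable borel" unfolding w_def by measurable
  have bd: "(\<integral>\<^sup>+p. ennreal (exp (- b * (norm p)\<^sup>2) * (norm (w p))\<^sup>2) \<partial>lborel) \<le> ?R" if b: "b > 0" for b
  proof -
    define g where "g p = exp (- b * (norm p)\<^sup>2) *\<^sub>R w p" for p
    have ig: "integrable lborel g"
      unfolding g_def[abs_def] w_def by (rule integrable_gaussian_osc[OF k b])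
    have [measurable]: "g \<in> borel_measurable borel" unfolding g_def[abs_def] by measurable
    have iF: "integrable (lborel \<Otimes>\<^sub>M lborel) (\<lambda>(p, y). g p * cnj (k y) * cis (- y \<bullet> p))"
    proof (rule Bochner_Integration.integrable_bound)
      show "integrable (lborel \<Otimes>\<^sub>M lborel) (\<lambda>(p::'a, y). norm (g p) * norm (k y))"
      proof (rule lborel_pair.Fubini_integrable)
        show "integrable lborel (\<lambda>p::'a. \<integral>x. norm (case (p, x) of (p, x) \<Rightarrow> norm (g p) * norm (k x)) \<partial>lborel)"
          using ig k by (simp add: abs_mult)
      qed (use k in auto)
    qed (auto simp: norm_mult abs_mult)
    have igw: "integrable lborel (\<lambda>p. exp (- b * (norm p)\<^sup>2) * (norm (w p))\<^sup>2)"
    proof (rule Bochner_Integration.integrable_bound)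
      show "integrable lborel (\<lambda>p. (\<integral>y. norm (k y) \<partial>lborel) *\<^sub>R g p)" using ig by simp
      show "AE p in lborel. norm (exp (- b * (norm p)\<^sup>2) * (norm (w p))\<^sup>2) \<le> norm ((\<integral>y. norm (k y) \<partial>lborel) *\<^sub>R g p)"
        unfolding g_def w_def using norm_osc_integral_le[of k]
        by (intro AE_I2) (auto simp: abs_mult power2_eq_square mult_ac intro!: mult_left_mono mult_right_mono)
    qed measurable
    have "complex_of_real (\<integral>p. exp (- b * (norm p)\<^sup>2) * (norm (w p))\<^sup>2 \<partial>lborel)
        = (\<integral>p. g p * cnj (w p) \<partial>lborel)"
      unfolding integral_complex_of_real[symmetric]
    proof (rule Bochner_Integration.integral_cong[OF refl])
      fix p
      have "complex_of_real ((norm (w p))\<^sup>2) = w p * cnj (w p)" by (simp add: complex_norm_square del: of_real_power)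
      then show "complex_of_real (exp (- b * (norm p)\<^sup>2) * (norm (w p))\<^sup>2) = g p * cnj (w p)"
        unfolding of_real_mult g_def by (simp add: scaleR_conv_of_real)
    qed
    also have "\<dots> = (\<integral>p. (\<integral>y. g p * cnj (k y) * cis (- y \<bullet> p) \<partial>lborel) \<partial>lborel)"
    proof (rule Bochner_Integration.integral_cong[OF refl])
      fix p
      have "cnj (w p) = (\<integral>y. cnj (k y * cis (p \<bullet> y)) \<partial>lborel)"
        unfolding w_def osc_integral_def by (rule Bochner_Integration.integral_cnj[symmetric])
      also have "\<dots> = (\<integral>y. cnj (k y) * cis (- y \<bullet> p) \<partial>lborel)"
        by (simp add: cis_cnj inner_commute)
      finally show "g p * cnj (w p) = (\<integral>y. g p * cnj (k y) * cis (- y \<bullet> p) \<partial>lborel)"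
        by (simp add: mult.assoc)
    qed
    also have "\<dots> = (\<integral>y. (\<integral>p. g p * cnj (k y) * cis (- y \<bullet> p) \<partial>lborel) \<partial>lborel)"
      by (rule lborel_pair.Fubini_integral[symmetric, OF iF])
    also have "\<dots> = (\<integral>y. cnj (k y) * ((2 * pi) ^ DIM('a) *\<^sub>R mollify (1 / (4 * b)) k y) \<partial>lborel)"
    proof (rule Bochner_Integration.integral_cong[OF refl])
      fix y
      have "(\<integral>p. g p * cnj (k y) * cis (- y \<bullet> p) \<partial>lborel) = (\<integral>p. cnj (k y) * (g p * cis (- y \<bullet> p)) \<partial>lborel)"
        by (simp add: mult_ac)
      also have "\<dots> = cnj (k y) * osc_integral g (- y)"
        unfolding osc_integral_def by simp
      also have "osc_integral g (- y) = (2 * pi) ^ DIM('a) *\<^sub>R mollify (1 / (4 * b)) k y"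
        unfolding g_def[abs_def] w_def by (rule osc_integral_gaussian_osc[OF k b])
      finally show "(\<integral>p. g p * cnj (k y) * cis (- y \<bullet> p) \<partial>lborel) = cnj (k y) * ((2 * pi) ^ DIM('a) *\<^sub>R mollify (1 / (4 * b)) k y)" .
    qed
    finally have eq: "complex_of_real (\<integral>p. exp (- b * (norm p)\<^sup>2) * (norm (w p))\<^sup>2 \<partial>lborel)
        = (\<integral>y. cnj (k y) * ((2 * pi) ^ DIM('a) *\<^sub>R mollify (1 / (4 * b)) k y) \<partial>lborel)" .
    have "(\<integral>\<^sup>+p. ennreal (exp (- b * (norm p)\<^sup>2) * (norm (w p))\<^sup>2) \<partial>lborel)
        = ennreal (\<integral>p. exp (- b * (norm p)\<^sup>2) * (norm (w p))\<^sup>2 \<partial>lborel)"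
      by (rule nn_integral_eq_integral[OF igw]) simp
    also have "(\<integral>p. exp (- b * (norm p)\<^sup>2) * (norm (w p))\<^sup>2 \<partial>lborel)
        = norm (complex_of_real (\<integral>p. exp (- b * (norm p)\<^sup>2) * (norm (w p))\<^sup>2 \<partial>lborel))"
      by (simp add: integral_nonneg_AE)
    also have "ennreal \<dots> \<le> (\<integral>\<^sup>+y. ennreal (norm (cnj (k y) * ((2 * pi) ^ DIM('a) *\<^sub>R mollify (1 / (4 * b)) k y))) \<partial>lborel)"
      unfolding eq by (rule norm_integral_le_nn_integral)
    also have "\<dots> = ennreal ((2 * pi) ^ DIM('a)) * (\<integral>\<^sup>+y. ennreal (norm (k y) * norm (mollify (1 / (4 * b)) k y)) \<partial>lborel)"
      by (subst nn_integral_cmult[symmetric])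
         (auto simp: norm_mult abs_mult mult_ac intro!: nn_integral_cong simp flip: ennreal_mult)
    also have "\<dots> \<le> ?R"
      using b by (intro mult_left_mono nn_integral_norm_mollify_le k) auto
    finally show ?thesis .
  qed
  have "?L = (\<integral>\<^sup>+p. liminf (\<lambda>n. ennreal (exp (- (1 / real (Suc n)) * (norm p)\<^sup>2) * (norm (w p))\<^sup>2)) \<partial>lborel)"
  proof (rule nn_integral_cong)
    fix p :: 'a
    have "(\<lambda>n. exp (- (1 / real (Suc n)) * (norm p)\<^sup>2) * (norm (w p))\<^sup>2) \<longlonglongrightarrow> exp (- 0 * (norm p)\<^sup>2) * (norm (w p))\<^sup>2"
      using LIMSEQ_inverse_real_of_nat by (intro tendsto_intros) (simp add: inverse_eq_divide)
    then have "(\<lambda>n. ennreal (exp (- (1 / real (Suc n)) * (norm p)\<^sup>2) * (norm (w p))\<^sup>2)) \<longlonglongrightarrow> ennreal ((norm (w p))\<^sup>2)"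
      by (intro tendsto_ennrealI) simp
    from lim_imp_Liminf[OF sequentially_bot this]
    show "ennreal ((norm (osc_integral k p))\<^sup>2) = liminf (\<lambda>n. ennreal (exp (- (1 / real (Suc n)) * (norm p)\<^sup>2) * (norm (w p))\<^sup>2))"
      by (simp add: w_def)
  qed
  also have "\<dots> \<le> liminf (\<lambda>n. \<integral>\<^sup>+p. ennreal (exp (- (1 / real (Suc n)) * (norm p)\<^sup>2) * (norm (w p))\<^sup>2) \<partial>lborel)"
    by (rule nn_integral_liminf) measurable
  also have "\<dots> \<le> liminf (\<lambda>n. ?R)"
    by (intro Liminf_mono always_eventually allI bd) simp
  also have "\<dots> = ?R" by (simp add: Liminf_const)
  finally show ?thesis .
qed

text \<open>For the converse, the inequality just shown is applied to the damped transform
  \<open>g\<close>, whose own transform is a multiple of a mollification of \<open>k\<close>; Fatou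
  along an almost everywhere convergent subsequence recovers \<open>k\<close>. The identity is in
  \<open>ennreal\<close> because \<open>k\<close> need not be square integrable.\<close>

theorem osc_integral_plancherel:
  fixes k :: "'a::euclidean_space \<Rightarrow> complex"
  assumes k: "integrable lborel k"
  shows "(\<integral>\<^sup>+p. ennreal ((norm (osc_integral k p))\<^sup>2) \<partial>lborel) = ennreal ((2 * pi) ^ DIM('a)) * (\<integral>\<^sup>+y. ennreal ((norm (k y))\<^sup>2) \<partial>lborel)"
    (is "?L = ?R")
proof (rule antisym[OF osc_integral_plancherel_le[OF k]])
  have [measurable]: "k \<in> borel_measurable borel" using borel_measurable_integrable[OF k] by simp
  define c where "c = (2 * pi) ^ DIM('a)"
  have c: "c > 0" by (simp add: c_def)
  have bd: "(\<integral>\<^sup>+y. ennreal ((norm (mollify (1 / (4 * b)) k y))\<^sup>2) \<partial>lborel) \<le> ennreal (1 / c) * ?L" if b: "b > 0" for b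
  proof -
    define g where "g p = exp (- b * (norm p)\<^sup>2) *\<^sub>R osc_integral k p" for p
    have ig: "integrable lborel g"
      unfolding g_def[abs_def] by (rule integrable_gaussian_osc[OF k b])
    have [measurable]: "g \<in> borel_measurable borel" unfolding g_def[abs_def] by measurable
    \<comment> \<open>Squaring the constant of \<open>osc_integral_gaussian_osc\<close> gives
      \<open>c\<close> twice; one copy cancels against the constant of the inequality for
      \<open>g\<close>.\<close>
    have "ennreal c * (ennreal c * (\<integral>\<^sup>+y. ennreal ((norm (mollify (1 / (4 * b)) k y))\<^sup>2) \<partial>lborel))
        = (\<integral>\<^sup>+y. ennreal ((norm (osc_integral g (- y)))\<^sup>2) \<partial>lborel)"
    proof -
      have "osc_integral g (- y) = c *\<^sub>R mollify (1 / (4 * b)) k y" for y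
        unfolding g_def[abs_def] c_def by (rule osc_integral_gaussian_osc[OF k b])
      then show ?thesis
        using c by (simp add: power_mult_distrib power2_eq_square[of c] ennreal_mult nn_integral_cmult mult.assoc)
    qed
    also have "\<dots> = (\<integral>\<^sup>+y. ennreal ((norm (osc_integral g y))\<^sup>2) \<partial>lborel)"
      using nn_integral_lborel_affine[of "\<lambda>y. ennreal ((norm (osc_integral g y))\<^sup>2)" "- 1" 0] by simp
    also have "\<dots> \<le> ennreal c * (\<integral>\<^sup>+p. ennreal ((norm (g p))\<^sup>2) \<partial>lborel)"
      unfolding c_def by (rule osc_integral_plancherel_le[OF ig])
    also have "\<dots> \<le> ennreal c * ?L"
      using norm_mult_exp_le[OF b] by (intro mult_left_mono nn_integral_mono ennreal_leI power_mono) (auto simp: g_def)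
    finally have "ennreal c * (\<integral>\<^sup>+y. ennreal ((norm (mollify (1 / (4 * b)) k y))\<^sup>2) \<partial>lborel) \<le> ?L"
      using c by (simp add: ennreal_mult_le_mult_iff)
    from mult_left_mono[OF this, of "ennreal (1 / c)"] show ?thesis
      using c by (simp add: mult.assoc[symmetric] flip: ennreal_mult)
  qed
  obtain b :: "nat \<Rightarrow> real" where b: "\<And>n. b n > 0"
    "AE y in lborel. (\<lambda>n. mollify (1 / (4 * b n)) k y) \<longlonglongrightarrow> k y"
    using mollify_osc_AE_subseq[OF k] by blast
  have "(\<integral>\<^sup>+y. ennreal ((norm (k y))\<^sup>2) \<partial>lborel) = (\<integral>\<^sup>+y. liminf (\<lambda>n. ennreal ((norm (mollify (1 / (4 * b n)) k y))\<^sup>2)) \<partial>lborel)"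
  proof (rule nn_integral_cong_AE)
    from b(2) show "AE y in lborel. ennreal ((norm (k y))\<^sup>2) = liminf (\<lambda>n. ennreal ((norm (mollify (1 / (4 * b n)) k y))\<^sup>2))"
    proof eventually_elim
      case (elim y)
      have "(\<lambda>n. ennreal ((norm (mollify (1 / (4 * b n)) k y))\<^sup>2)) \<longlonglongrightarrow> ennreal ((norm (k y))\<^sup>2)"
        by (intro tendsto_ennrealI tendsto_intros elim)
      from lim_imp_Liminf[OF sequentially_bot this] show ?case by simp
    qed
  qed
  also have "\<dots> \<le> liminf (\<lambda>n. \<integral>\<^sup>+y. ennreal ((norm (mollify (1 / (4 * b n)) k y))\<^sup>2) \<partial>lborel)"
    by (rule nn_integral_liminf) measurable
  also have "\<dots> \<le> liminf (\<lambda>n. ennreal (1 / c) * ?L)"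
    by (intro Liminf_mono always_eventually allI bd b)
  also have "\<dots> = ennreal (1 / c) * ?L" by (simp add: Liminf_const)
  finally have "?R \<le> ennreal c * (ennreal (1 / c) * ?L)"
    unfolding c_def by (rule mult_left_mono) simp
  also have "\<dots> = ?L"
    using c by (simp add: mult.assoc[symmetric] flip: ennreal_mult)
  finally show "?R \<le> ?L" .
qed

subsection \<open>Schwartz functions\<close>

lemma schwartz_differentiable: "schwartz f \<Longrightarrow> f differentiable (at x)"
  by (erule schwartz.cases) simp

lemma schwartz_derivative: "schwartz f \<Longrightarrow> b \<in> Basis \<Longrightarrow> schwartz (\<lambda>x. frechet_derivative f (at x) b)"
  by (erule schwartz.cases) simp

lemma schwartz_bound:
  assumes "schwartz f"
  obtains C where "C \<ge> 0" "\<And>x. norm (f x) \<le> C * inverse ((1 + norm x) ^ k)"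
proof -
  have "bounded (range (\<lambda>x. (1 + norm x) ^ k *\<^sub>R f x))"
    using assms by (rule schwartz.cases) simp
  then obtain C where C: "\<And>x. norm ((1 + norm x) ^ k *\<^sub>R f x) \<le> C"
    unfolding bounded_iff by auto
  have "norm (f x) \<le> C * inverse ((1 + norm x) ^ k)" for x
  proof -
    have "(1 + norm x) ^ k > 0" by (intro zero_less_power) (simp add: add_pos_nonneg)
    moreover have "(1 + norm x) ^ k * norm (f x) \<le> C" using C[of x] by (simp add: abs_of_nonneg)
    ultimately show ?thesis by (simp add: field_simps)
  qed
  moreover have "C \<ge> 0" using C[of 0] norm_ge_zero order_trans by blast
  ultimately show ?thesis using that by blast
qed

lemma borel_measurable_schwartz: "schwartz f \<Longrightarrow> f \<in> borel_measurable borel"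
  by (intro borel_measurable_continuous_onI continuous_at_imp_continuous_on ballI
      differentiable_imp_continuous_within schwartz_differentiable)

lemma integrable_schwartz:
  fixes f :: "'a::euclidean_space \<Rightarrow> complex"
  assumes f: "schwartz f"
  shows "integrable lborel f"
proof -
  note [measurable] = borel_measurable_schwartz[OF f]
  obtain C where C: "C \<ge> 0" "\<And>x. norm (f x) \<le> C * inverse ((1 + norm x) ^ (2 * DIM('a)))"
    using schwartz_bound[OF f] by blast
  show ?thesis
  proof (rule Bochner_Integration.integrable_bound)
    show "integrable lborel (\<lambda>x::'a. C * inverse ((1 + norm x) ^ (2 * DIM('a))))"
      by (intro integrable_mult_right integrable_inverse_norm_power)
    show "AE x in lborel. norm (f x) \<le> norm (C * inverse ((1 + norm x) ^ (2 * DIM('a))))"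
      using C by (intro AE_I2) (simp add: abs_mult)
  qed measurable
qed

section \<open>Decay of the Fourier transform of a Schwartz function\<close>

lemma has_vector_derivative_quotient:
  fixes g :: "real \<Rightarrow> 'b::real_normed_vector"
  assumes "(g has_vector_derivative d) (at 0)"
  shows "((\<lambda>s. (g s - g 0) /\<^sub>R s) \<longlongrightarrow> d) (at 0)"
proof -
  have "((\<lambda>y. norm (g y - g 0 - (y - 0) *\<^sub>R d) / norm (y - 0)) \<longlongrightarrow> 0) (at 0)"
    using assms unfolding has_vector_derivative_def has_derivative_iff_norm by simp
  then have "((\<lambda>s. norm ((g s - g 0) /\<^sub>R s - d)) \<longlongrightarrow> 0) (at 0)"
  proof (rule Lim_transform_eventually)
    show "\<forall>\<^sub>F s in at 0. norm (g s - g 0 - (s - 0) *\<^sub>R d) / norm (s - 0) = norm ((g s - g 0) /\<^sub>R s - d)"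
    proof (rule eventually_at_ball'[OF zero_less_one, THEN eventually_mono])
      fix s :: real assume "s \<in> ball 0 1 \<and> s \<noteq> 0 \<and> s \<in> UNIV"
      then have s: "s \<noteq> 0" by simp
      then have "(g s - g 0) /\<^sub>R s - d = (g s - g 0 - s *\<^sub>R d) /\<^sub>R s" by (simp add: scaleR_diff_right)
      then show "norm (g s - g 0 - (s - 0) *\<^sub>R d) / norm (s - 0) = norm ((g s - g 0) /\<^sub>R s - d)"
        by (simp add: divide_inverse mult.commute)
    qed
  qed
  then show ?thesis by (simp add: tendsto_norm_zero_iff LIM_zero_iff)
qed

text \<open>Provides a majorant, integrable and independent of \<open>h\<close>, for the difference
  quotients in \<open>fourier_integral_derivative\<close>. The mean value inequality is combined
  with the decay of the derivative; moving the base point by at most 1 costs at most a factor 2 in 1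
  + |x|, whence the power of 2 in \<open>C'\<close>.\<close>

lemma schwartz_increment:
  fixes f :: "'a::euclidean_space \<Rightarrow> complex"
  assumes f: "schwartz f" and b: "b \<in> Basis"
  obtains C where "C \<ge> 0"
    "\<And>x h. 0 < h \<Longrightarrow> h \<le> 1 \<Longrightarrow> norm (f (x + h *\<^sub>R b) - f x) \<le> h * (C * inverse ((1 + norm x) ^ (2 * DIM('a))))"
proof -
  let ?g = "\<lambda>x. frechet_derivative f (at x) b"
  obtain C where C: "C \<ge> 0" "\<And>x. norm (?g x) \<le> C * inverse ((1 + norm x) ^ (2 * DIM('a)))"
    using schwartz_bound[OF schwartz_derivative[OF f b]] by blast
  define C' where "C' = C * 2 ^ (2 * DIM('a))"
  have bd: "norm (?g (x + s *\<^sub>R b)) \<le> C' * inverse ((1 + norm x) ^ (2 * DIM('a)))" if s: "0 \<le> s" "s \<le> 1" for x s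
  proof -
    have "norm x \<le> norm (x + s *\<^sub>R b) + norm (s *\<^sub>R b)" by (metis add_diff_cancel_right' norm_triangle_ineq4)
    also have "\<dots> \<le> norm (x + s *\<^sub>R b) + 1" using s b by (intro add_left_mono) simp
    finally have "1 + norm x \<le> 2 * (1 + norm (x + s *\<^sub>R b))"
      using norm_ge_zero[of "x + s *\<^sub>R b"] by argo
    then have "(1 + norm x) ^ (2 * DIM('a)) \<le> (2 * (1 + norm (x + s *\<^sub>R b))) ^ (2 * DIM('a))"
      by (intro power_mono) auto
    then have le: "(1 + norm x) ^ (2 * DIM('a)) \<le> 2 ^ (2 * DIM('a)) * (1 + norm (x + s *\<^sub>R b)) ^ (2 * DIM('a))"
      by (simp only: power_mult_distrib)
    have p: "(1 + norm y) ^ (2 * DIM('a)) > 0" for y :: 'a by (intro zero_less_power) (simp add: add_pos_nonneg)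
    have "inverse ((1 + norm (x + s *\<^sub>R b)) ^ (2 * DIM('a))) \<le> 2 ^ (2 * DIM('a)) * inverse ((1 + norm x) ^ (2 * DIM('a)))"
      using le p[of x] p[of "x + s *\<^sub>R b"] by (simp add: field_simps)
    then have "C * inverse ((1 + norm (x + s *\<^sub>R b)) ^ (2 * DIM('a))) \<le> C * (2 ^ (2 * DIM('a)) * inverse ((1 + norm x) ^ (2 * DIM('a))))"
      using C(1) by (rule mult_left_mono)
    with C(2)[of "x + s *\<^sub>R b"] show ?thesis by (simp add: C'_def mult.assoc)
  qed
  show ?thesis
  proof
    show "C' \<ge> 0" using C by (simp add: C'_def)
    fix x :: 'a and h :: real assume h: "0 < h" "h \<le> 1"
    define B where "B = C' * inverse ((1 + norm x) ^ (2 * DIM('a)))"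
    have der: "((\<lambda>s. f (x + s *\<^sub>R b)) has_vector_derivative ?g (x + s *\<^sub>R b)) (at s)" for s
    proof -
      have "(f has_derivative frechet_derivative f (at (x + s *\<^sub>R b))) (at (x + s *\<^sub>R b))"
        using schwartz_differentiable[OF f] frechet_derivative_works by blast
      moreover have "((\<lambda>s. x + s *\<^sub>R b) has_vector_derivative b) (at s)"
        by (auto intro!: derivative_eq_intros)
      ultimately show ?thesis
        using vector_derivative_diff_chain_within[of "\<lambda>s. x + s *\<^sub>R b" b s UNIV f]
        by (auto simp: o_def has_derivative_at_withinI)
    qed
    have "norm (f (x + h *\<^sub>R b) - f (x + 0 *\<^sub>R b)) \<le> B * h - B * 0"
    proof (rule differentiable_bound_general[where f="\<lambda>s. f (x + s *\<^sub>R b)" and \<phi>="\<lambda>s. B * s" and \<phi>'="\<lambda>_. B"])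
      show "continuous_on {0..h} (\<lambda>s. f (x + s *\<^sub>R b))"
        by (intro continuous_at_imp_continuous_on ballI) (metis der has_vector_derivative_continuous)
      show "((\<lambda>s. B * s) has_vector_derivative B) (at s)" if "0 < s" "s < h" for s
        by (auto intro!: derivative_eq_intros simp: has_real_derivative_iff_has_vector_derivative[symmetric])
    qed (use h bd der in \<open>auto simp: B_def intro!: continuous_intros\<close>)
    then show "norm (f (x + h *\<^sub>R b) - f x) \<le> h * (C' * inverse ((1 + norm x) ^ (2 * DIM('a))))"
      by (simp add: B_def mult.commute)
  qed
qed

text \<open>Integration by parts is replaced by a limit of difference quotients: translation
  invariance turns the transform of a difference quotient into
  \<open>(cis (h * (b \<bullet> \<xi>)) - 1) /\<^sub>R h\<close> times the transform of
  \<open>f\<close>, and dominated convergence lets \<open>h\<close> tend to 0.\<close>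

lemma fourier_integral_derivative:
  fixes f :: "'a::euclidean_space \<Rightarrow> complex"
  assumes f: "schwartz f" and b: "b \<in> Basis"
  shows "fourier_integral (\<lambda>x. frechet_derivative f (at x) b) \<xi> = \<i> * of_real (b \<bullet> \<xi>) * fourier_integral f \<xi>"
proof -
  let ?g = "\<lambda>x. frechet_derivative f (at x) b"
  note [measurable] = borel_measurable_schwartz[OF f] borel_measurable_schwartz[OF schwartz_derivative[OF f b]]
  obtain C where C: "C \<ge> 0" "\<And>x h. 0 < h \<Longrightarrow> h \<le> 1 \<Longrightarrow> norm (f (x + h *\<^sub>R b) - f x) \<le> h * (C * inverse ((1 + norm x) ^ (2 * DIM('a))))"
    using schwartz_increment[OF f b] by blast
  define h where "h n = 1 / real (Suc n)" for n
  have h: "0 < h n" "h n \<le> 1" for n by (auto simp: h_def)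
  have hlim: "h \<longlonglongrightarrow> 0" unfolding h_def[abs_def] using LIMSEQ_inverse_real_of_nat by (simp add: inverse_eq_divide)
  have hat: "filterlim h (at 0) sequentially"
    using hlim h(1) by (auto simp: filterlim_at h_def)
  have L: "(\<lambda>n. \<integral>x. ((f (x + h n *\<^sub>R b) - f x) /\<^sub>R h n) * cis (- (x \<bullet> \<xi>)) \<partial>lborel) \<longlonglongrightarrow> fourier_integral ?g \<xi>"
    unfolding fourier_integral_def
  proof (rule integral_dominated_convergence)
    show "integrable lborel (\<lambda>x::'a. C * inverse ((1 + norm x) ^ (2 * DIM('a))))"
      by (intro integrable_mult_right integrable_inverse_norm_power)
    show "AE x in lborel. norm (((f (x + h n *\<^sub>R b) - f x) /\<^sub>R h n) * cis (- (x \<bullet> \<xi>))) \<le> C * inverse ((1 + norm x) ^ (2 * DIM('a)))" for n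
    proof (rule AE_I2)
      fix x :: 'a
      have "norm (f (x + h n *\<^sub>R b) - f x) / h n \<le> C * inverse ((1 + norm x) ^ (2 * DIM('a)))"
        using C(2)[OF h(1)[of n] h(2)[of n], of x] h(1)[of n] by (simp add: pos_divide_le_eq mult.commute)
      then show "norm (((f (x + h n *\<^sub>R b) - f x) /\<^sub>R h n) * cis (- (x \<bullet> \<xi>))) \<le> C * inverse ((1 + norm x) ^ (2 * DIM('a)))"
        using h(1)[of n] by (simp add: norm_mult divide_inverse mult.commute)
    qed
    show "AE x in lborel. (\<lambda>n. ((f (x + h n *\<^sub>R b) - f x) /\<^sub>R h n) * cis (- (x \<bullet> \<xi>))) \<longlonglongrightarrow> ?g x * cis (- (x \<bullet> \<xi>))"
    proof (rule AE_I2)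
      fix x :: 'a
      have "((\<lambda>s. f (x + s *\<^sub>R b)) has_vector_derivative ?g x) (at 0)"
      proof -
        have "(f has_derivative frechet_derivative f (at x)) (at x)"
          using schwartz_differentiable[OF f] frechet_derivative_works by blast
        moreover have "((\<lambda>s. x + s *\<^sub>R b) has_vector_derivative b) (at 0)"
          by (auto intro!: derivative_eq_intros)
        ultimately show ?thesis
          using vector_derivative_diff_chain_within[of "\<lambda>s. x + s *\<^sub>R b" b 0 UNIV f "frechet_derivative f (at x)"]
          by (auto simp: o_def has_derivative_at_withinI)
      qed
      then have "((\<lambda>s. (f (x + s *\<^sub>R b) - f x) /\<^sub>R s) \<longlongrightarrow> ?g x) (at 0)"
        using has_vector_derivative_quotient by fastforce
      from filterlim_compose[OF this hat] have "(\<lambda>n. (f (x + h n *\<^sub>R b) - f x) /\<^sub>R h n) \<longlonglongrightarrow> ?g x" .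
      then show "(\<lambda>n. ((f (x + h n *\<^sub>R b) - f x) /\<^sub>R h n) * cis (- (x \<bullet> \<xi>))) \<longlonglongrightarrow> ?g x * cis (- (x \<bullet> \<xi>))"
        by (intro tendsto_intros)
    qed
  qed measurable
  have e: "(\<integral>x. ((f (x + h *\<^sub>R b) - f x) /\<^sub>R h) * cis (- (x \<bullet> \<xi>)) \<partial>lborel) = ((cis (h * (b \<bullet> \<xi>)) - 1) /\<^sub>R h) * fourier_integral f \<xi>" for h
  proof -
    have i1: "integrable lborel (\<lambda>x. f x * cis (- (x \<bullet> \<xi>)))"
      by (intro integrable_mult_cis integrable_schwartz f) simp
    have i2: "integrable lborel (\<lambda>x. f (x + h *\<^sub>R b) * cis (- (x \<bullet> \<xi>)))"
      by (intro integrable_mult_cis integrable_lborel_translate integrable_schwartz f) simp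
    have s: "f (x + h *\<^sub>R b) * cis (- (x \<bullet> \<xi>)) = f (x + h *\<^sub>R b) * cis (- ((x + h *\<^sub>R b) \<bullet> \<xi>)) * cis (h * (b \<bullet> \<xi>))" for x
      by (simp add: mult.assoc cis_mult inner_add_left)
    have "(\<integral>x. f (x + h *\<^sub>R b) * cis (- (x \<bullet> \<xi>)) \<partial>lborel) = (\<integral>x. f (x + h *\<^sub>R b) * cis (- ((x + h *\<^sub>R b) \<bullet> \<xi>)) \<partial>lborel) * cis (h * (b \<bullet> \<xi>))"
      unfolding integral_mult_left_zero[symmetric] by (rule Bochner_Integration.integral_cong[OF refl s])
    also have "(\<integral>x. f (x + h *\<^sub>R b) * cis (- ((x + h *\<^sub>R b) \<bullet> \<xi>)) \<partial>lborel) = fourier_integral f \<xi>"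
      unfolding fourier_integral_def by (rule integral_lborel_translate[where f="\<lambda>x. f x * cis (- (x \<bullet> \<xi>))"]) measurable
    finally have 1: "(\<integral>x. f (x + h *\<^sub>R b) * cis (- (x \<bullet> \<xi>)) \<partial>lborel) = fourier_integral f \<xi> * cis (h * (b \<bullet> \<xi>))" .
    have "(\<integral>x. ((f (x + h *\<^sub>R b) - f x) /\<^sub>R h) * cis (- (x \<bullet> \<xi>)) \<partial>lborel)
        = (\<integral>x. inverse h *\<^sub>R (f (x + h *\<^sub>R b) * cis (- (x \<bullet> \<xi>)) - f x * cis (- (x \<bullet> \<xi>))) \<partial>lborel)"
      by (simp add: left_diff_distrib)
    also have "\<dots> = inverse h *\<^sub>R (fourier_integral f \<xi> * cis (h * (b \<bullet> \<xi>)) - fourier_integral f \<xi>)"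
      unfolding integral_scaleR_right Bochner_Integration.integral_diff[OF i2 i1] 1 by (simp add: fourier_integral_def)
    finally show ?thesis by (simp add: algebra_simps scaleR_conv_of_real)
  qed
  have "((\<lambda>s. cis (s * (b \<bullet> \<xi>))) has_vector_derivative \<i> * of_real (b \<bullet> \<xi>)) (at 0)"
  proof -
    have "((\<lambda>s. exp (\<i> * of_real (s * (b \<bullet> \<xi>)))) has_vector_derivative \<i> * of_real (b \<bullet> \<xi>)) (at 0)"
      by (auto intro!: derivative_eq_intros has_vector_derivative_real_field simp: has_field_derivative_def)
    then show ?thesis by (simp add: cis_conv_exp)
  qed
  then have "((\<lambda>s. (cis (s * (b \<bullet> \<xi>)) - 1) /\<^sub>R s) \<longlongrightarrow> \<i> * of_real (b \<bullet> \<xi>)) (at 0)"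
    using has_vector_derivative_quotient by fastforce
  from filterlim_compose[OF this hat] have "(\<lambda>n. (cis (h n * (b \<bullet> \<xi>)) - 1) /\<^sub>R h n) \<longlonglongrightarrow> \<i> * of_real (b \<bullet> \<xi>)" .
  then have "(\<lambda>n. ((cis (h n * (b \<bullet> \<xi>)) - 1) /\<^sub>R h n) * fourier_integral f \<xi>) \<longlonglongrightarrow> \<i> * of_real (b \<bullet> \<xi>) * fourier_integral f \<xi>"
    by (intro tendsto_intros)
  with L show ?thesis unfolding e by (rule LIMSEQ_unique)
qed

lemma norm_fourier_integral_le: "norm (fourier_integral f \<xi>) \<le> (\<integral>x. norm (f x) \<partial>lborel)"
  unfolding fourier_integral_def
  by (rule order_trans[OF integral_norm_bound]) (simp add: norm_mult)

lemma borel_measurable_fourier_integral [measurable]: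
  assumes [measurable]: "f \<in> borel_measurable borel"
  shows "fourier_integral f \<in> borel_measurable borel"
  unfolding fourier_integral_def[abs_def] by measurable

text \<open>The induction varies \<open>f\<close>, because each power of the coordinate is traded
  for a derivative.\<close>

lemma fourier_integral_schwartz_decay:
  fixes f :: "'a::euclidean_space \<Rightarrow> complex"
  assumes b: "b \<in> Basis" and f: "schwartz f"
  shows "\<exists>C. \<forall>\<xi>. \<bar>b \<bullet> \<xi>\<bar> ^ m * norm (fourier_integral f \<xi>) \<le> C"
  using f
proof (induction m arbitrary: f)
  case 0
  then show ?case using norm_fourier_integral_le by auto
next
  case (Suc m)
  from Suc.IH[OF schwartz_derivative[OF Suc.prems b]]
  show ?case
    by (simp add: fourier_integral_derivative[OF Suc.prems b] norm_mult mult_ac)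
qed

lemma integrable_fourier_integral_schwartz:
  fixes f :: "'a::euclidean_space \<Rightarrow> complex"
  assumes f: "schwartz f"
  shows "integrable lborel (fourier_integral f)"
proof -
  note [measurable] = borel_measurable_schwartz[OF f]
  define N where "N = 2 * DIM('a)"
  have "\<forall>b\<in>Basis. \<exists>C. \<forall>\<xi>. \<bar>b \<bullet> \<xi>\<bar> ^ N * norm (fourier_integral f \<xi>) \<le> C"
    using fourier_integral_schwartz_decay[OF _ f] by blast
  then obtain C where C: "\<And>b \<xi>. b \<in> Basis \<Longrightarrow> \<bar>b \<bullet> \<xi>\<bar> ^ N * norm (fourier_integral f \<xi>) \<le> C b"
    by metis
  obtain C0 where C0: "\<And>\<xi>. norm (fourier_integral f \<xi>) \<le> C0"
    using norm_fourier_integral_le by blast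
  define D where "D = real (Suc DIM('a)) ^ N * (C0 + (\<Sum>b\<in>Basis. C b))"
  have bd: "(1 + norm \<xi>) ^ N * norm (fourier_integral f \<xi>) \<le> D" for \<xi>
  proof -
    \<comment> \<open>Each coordinate bound controls one direction only. The largest of 1 and the
      coordinates controls \<open>1 + norm \<xi>\<close> up to the factor
      \<open>Suc DIM('a)\<close>, and the term that attains the maximum selects the bound to
      use.\<close>
    define M where "M = Max (insert 1 ((\<lambda>b. \<bar>b \<bullet> \<xi>\<bar>) ` Basis))"
    have M: "1 \<le> M" "\<And>b. b \<in> Basis \<Longrightarrow> \<bar>b \<bullet> \<xi>\<bar> \<le> M" unfolding M_def by (intro Max_ge; simp)+
    have "norm \<xi> \<le> (\<Sum>b\<in>Basis. \<bar>\<xi> \<bullet> b\<bar>)" by (rule norm_le_l1)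
    also have "\<dots> \<le> (\<Sum>b\<in>(Basis::'a set). M)" by (intro sum_mono) (use M in \<open>simp add: inner_commute\<close>)
    finally have "1 + norm \<xi> \<le> real (Suc DIM('a)) * M" using M(1) by (simp add: algebra_simps)
    then have "(1 + norm \<xi>) ^ N \<le> real (Suc DIM('a)) ^ N * M ^ N"
      by (metis add_nonneg_nonneg norm_ge_zero power_mono power_mult_distrib zero_le_one)
    then have "(1 + norm \<xi>) ^ N * norm (fourier_integral f \<xi>) \<le> real (Suc DIM('a)) ^ N * M ^ N * norm (fourier_integral f \<xi>)"
      by (intro mult_right_mono) auto
    also have "\<dots> = real (Suc DIM('a)) ^ N * (M ^ N * norm (fourier_integral f \<xi>))" by simp
    also have "\<dots> \<le> D"
      unfolding D_def
    proof (rule mult_left_mono)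
      have Cn: "C b \<ge> 0" if "b \<in> Basis" for b
        using C[OF that, of \<xi>] by (meson abs_ge_zero mult_nonneg_nonneg norm_ge_zero order_trans zero_le_power)
      have C0n: "C0 \<ge> 0" using C0 norm_ge_zero order_trans by blast
      have "M \<in> insert 1 ((\<lambda>b. \<bar>b \<bullet> \<xi>\<bar>) ` Basis)" unfolding M_def by (rule Max_in) auto
      then consider "M = 1" | b where "b \<in> Basis" "M = \<bar>b \<bullet> \<xi>\<bar>" by auto
      then show "M ^ N * norm (fourier_integral f \<xi>) \<le> C0 + (\<Sum>b\<in>Basis. C b)"
      proof cases
        case 1
        then show ?thesis using C0[of \<xi>] sum_nonneg[of Basis C] Cn by simp
      next
        case 2
        then show ?thesis using C[of b \<xi>] C0n member_le_sum[of b Basis C] Cn by force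
      qed
    qed simp
    finally show ?thesis .
  qed
  show ?thesis
  proof (rule Bochner_Integration.integrable_bound)
    show "integrable lborel (\<lambda>x::'a. D * inverse ((1 + norm x) ^ (2 * DIM('a))))"
      by (intro integrable_mult_right integrable_inverse_norm_power)
    show "AE x in lborel. norm (fourier_integral f x) \<le> norm (D * inverse ((1 + norm x) ^ (2 * DIM('a))))"
    proof (rule AE_I2)
      fix \<xi> :: 'a
      have "(1 + norm \<xi>) ^ N > 0" by (intro zero_less_power) (simp add: add_pos_nonneg)
      then have "norm (fourier_integral f \<xi>) \<le> D * inverse ((1 + norm \<xi>) ^ N)"
        using bd[of \<xi>] by (simp add: field_simps)
      then show "norm (fourier_integral f \<xi>) \<le> norm (D * inverse ((1 + norm \<xi>) ^ (2 * DIM('a))))"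
        unfolding N_def by (smt (verit) real_norm_def)
    qed
  qed measurable
qed

lemma fourier_inversion_schwartz:
  fixes f :: "'a::euclidean_space \<Rightarrow> complex"
  assumes f: "schwartz f"
  shows "AE y in lborel. osc_integral (fourier_integral f) y = (2 * pi) ^ DIM('a) *\<^sub>R f y"
proof -
  note [measurable] = borel_measurable_schwartz[OF f]
  have e: "osc_integral f p = fourier_integral f (- p)" for p
    by (simp add: osc_integral_def fourier_integral_def inner_commute)
  have "integrable lborel (osc_integral f)"
    unfolding e[abs_def] using integrable_lborel_affine[OF integrable_fourier_integral_schwartz[OF f], of "- 1" 0] by simp
  from osc_integral_inversion[OF integrable_schwartz[OF f] this]
  show ?thesis
  proof eventually_elim
    case (elim y)
    have "osc_integral (osc_integral f) (- y) = (\<integral>p. fourier_integral f (- p) * cis (y \<bullet> (- p)) \<partial>lborel)"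
      by (simp add: osc_integral_def[of "osc_integral f"] e)
    also have "\<dots> = osc_integral (fourier_integral f) y"
      unfolding osc_integral_def
      using integral_lborel_affine[of "\<lambda>p. fourier_integral f p * cis (y \<bullet> p)" "- 1" 0] by simp
    finally show ?case using elim by simp
  qed
qed

subsection \<open>Distributional Fourier transforms\<close>

lemma inverse_fourier_integral_eq: "inverse_fourier_integral F x = (1 / (2 * pi) ^ DIM('a)) *\<^sub>R osc_integral F (x::'a::euclidean_space)"
  by (simp add: inverse_fourier_integral_def osc_integral_def)

text \<open>Fubini moves the inverse transform from \<open>H\<close> to
  \<open>fourier_integral \<phi>\<close>, where inversion for Schwartz functions gives back
  \<open>\<phi>\<close>. The inverse transform is Borel, so the integral over
  \<open>lebesgue\<close> in the definition is one over \<open>lborel\<close>.\<close>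

theorem has_fourier_transform_inverse:
  fixes H :: "'a::euclidean_space \<Rightarrow> complex"
  assumes H: "integrable lborel H"
  shows "has_fourier_transform (inverse_fourier_integral H) H"
  unfolding has_fourier_transform_def
proof (intro conjI allI impI)
  show [measurable]: "H \<in> borel_measurable borel" using borel_measurable_integrable[OF H] by simp
  fix \<phi> :: "'a \<Rightarrow> complex" assume s: "schwartz \<phi>"
  note [measurable] = borel_measurable_schwartz[OF s]
  define c where "c = 1 / (2 * pi) ^ DIM('a)"
  have c: "c > 0" by (simp add: c_def)
  have f: "inverse_fourier_integral H x = c *\<^sub>R osc_integral H x" for x
    by (simp add: inverse_fourier_integral_eq c_def)
  have [measurable]: "inverse_fourier_integral H \<in> borel_measurable borel"
    unfolding f[abs_def] by measurable
  note iphi = integrable_fourier_integral_schwartz[OF s]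
  have i1: "integrable lborel (\<lambda>x. inverse_fourier_integral H x * fourier_integral \<phi> x)"
  proof (rule Bochner_Integration.integrable_bound)
    show "integrable lborel (\<lambda>x. (c * (\<integral>y. norm (H y) \<partial>lborel)) *\<^sub>R fourier_integral \<phi> x)" using iphi by simp
    show "AE x in lborel. norm (inverse_fourier_integral H x * fourier_integral \<phi> x) \<le> norm ((c * (\<integral>y. norm (H y) \<partial>lborel)) *\<^sub>R fourier_integral \<phi> x)"
      unfolding f using norm_osc_integral_le[of H] c
      by (intro AE_I2) (auto simp: norm_mult abs_mult integral_nonneg_AE intro!: mult_right_mono)
  qed measurable
  then show "integrable lebesgue (\<lambda>x. inverse_fourier_integral H x * fourier_integral \<phi> x)"
    by (simp add: integrable_completion)
  obtain C where C: "\<And>x. norm (\<phi> x) \<le> C" 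
    using schwartz_bound[OF s, of 0] by auto
  show "integrable lborel (\<lambda>\<xi>. H \<xi> * \<phi> \<xi>)"
  proof (rule Bochner_Integration.integrable_bound)
    show "integrable lborel (\<lambda>x. C *\<^sub>R H x)" using H by simp
    show "AE x in lborel. norm (H x * \<phi> x) \<le> norm (C *\<^sub>R H x)"
    proof (rule AE_I2)
      fix x
      have "norm (H x) * norm (\<phi> x) \<le> norm (H x) * \<bar>C\<bar>" using C[of x] by (intro mult_left_mono) auto
      then show "norm (H x * \<phi> x) \<le> norm (C *\<^sub>R H x)" by (simp add: norm_mult mult.commute)
    qed
  qed measurable
  have iF: "integrable (lborel \<Otimes>\<^sub>M lborel) (\<lambda>(x, \<xi>). c *\<^sub>R (H \<xi> * cis (x \<bullet> \<xi>) * fourier_integral \<phi> x))"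
  proof (rule Bochner_Integration.integrable_bound)
    show "integrable (lborel \<Otimes>\<^sub>M lborel) (\<lambda>(x::'a, y). c * (norm (fourier_integral \<phi> x) * norm (H y)))"
    proof (rule lborel_pair.Fubini_integrable)
      show "integrable lborel (\<lambda>p::'a. \<integral>x. norm (case (p, x) of (p, x) \<Rightarrow> c * (norm (fourier_integral \<phi> p) * norm (H x))) \<partial>lborel)"
        using iphi H by (simp add: abs_mult)
    qed (use H in auto)
  qed (auto simp: norm_mult abs_mult)
  have "(\<integral>x. inverse_fourier_integral H x * fourier_integral \<phi> x \<partial>lebesgue)
      = (\<integral>x. inverse_fourier_integral H x * fourier_integral \<phi> x \<partial>lborel)"
    by (rule integral_completion) measurable
  also have "\<dots> = (\<integral>x. (\<integral>\<xi>. c *\<^sub>R (H \<xi> * cis (x \<bullet> \<xi>) * fourier_integral \<phi> x) \<partial>lborel) \<partial>lborel)"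
    unfolding f osc_integral_def by simp
  also have "\<dots> = (\<integral>\<xi>. (\<integral>x. c *\<^sub>R (H \<xi> * cis (x \<bullet> \<xi>) * fourier_integral \<phi> x) \<partial>lborel) \<partial>lborel)"
    by (rule lborel_pair.Fubini_integral[symmetric, OF iF])
  also have "\<dots> = (\<integral>\<xi>. c *\<^sub>R (H \<xi> * osc_integral (fourier_integral \<phi>) \<xi>) \<partial>lborel)"
  proof (rule Bochner_Integration.integral_cong[OF refl])
    fix \<xi> :: 'a
    have "(\<integral>x. c *\<^sub>R (H \<xi> * cis (x \<bullet> \<xi>) * fourier_integral \<phi> x) \<partial>lborel) = (\<integral>x. c *\<^sub>R (H \<xi> * (fourier_integral \<phi> x * cis (\<xi> \<bullet> x))) \<partial>lborel)"
      by (simp add: mult_ac inner_commute)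
    then show "(\<integral>x. c *\<^sub>R (H \<xi> * cis (x \<bullet> \<xi>) * fourier_integral \<phi> x) \<partial>lborel) = c *\<^sub>R (H \<xi> * osc_integral (fourier_integral \<phi>) \<xi>)"
      by (simp add: osc_integral_def)
  qed
  also have "\<dots> = (\<integral>\<xi>. H \<xi> * \<phi> \<xi> \<partial>lborel)"
  proof (rule integral_cong_AE)
    show "AE \<xi> in lborel. c *\<^sub>R (H \<xi> * osc_integral (fourier_integral \<phi>) \<xi>) = H \<xi> * \<phi> \<xi>"
      using fourier_inversion_schwartz[OF s] by eventually_elim (simp add: c_def)
  qed measurable
  finally show "(\<integral>x. inverse_fourier_integral H x * fourier_integral \<phi> x \<partial>lebesgue) = (\<integral>\<xi>. H \<xi> * \<phi> \<xi> \<partial>lborel)" .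
qed

text \<open>Polynomials times a Gaussian, presented by closure rules. This is the invariant for the
  coinductive predicate \<open>schwartz\<close>: the class is closed under partial derivatives and
  its members decay rapidly. The linear term with \<open>v\<close> in the exponent allows Gaussians
  with any centre, up to a constant.\<close>

inductive gauss_poly :: "real \<Rightarrow> 'a \<Rightarrow> ('a::euclidean_space \<Rightarrow> complex) \<Rightarrow> bool" for a v where
  base: "gauss_poly a v (\<lambda>x. of_real (exp (- a * (norm x)\<^sup>2 + x \<bullet> v)))"
| mult: "gauss_poly a v f \<Longrightarrow> gauss_poly a v (\<lambda>x. of_real (x \<bullet> b) * f x)"
| lin: "gauss_poly a v f \<Longrightarrow> gauss_poly a v g \<Longrightarrow> gauss_poly a v (\<lambda>x. of_real c * f x + of_real c' * g x)"

text \<open>The power \<open>k\<close> varies in the induction because a coordinate factor raises it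
  by one. For the Gaussian itself, \<open>1 + norm x \<le> exp (norm x)\<close> moves the power into
  the exponent, where completing the square gives the bound.\<close>

lemma gauss_poly_bounded:
  assumes a: "a > 0" and "gauss_poly a v f"
  shows "\<exists>C. \<forall>x. (1 + norm x) ^ k * norm (f x) \<le> C"
  using assms(2)
proof (induction arbitrary: k)
  case base
  have "(1 + norm x) ^ k * exp (- a * (norm x)\<^sup>2 + x \<bullet> v) \<le> exp ((real k + norm v)\<^sup>2 / (4 * a))" for x
  proof -
    have "(1 + norm x) ^ k \<le> exp (norm x) ^ k" by (intro power_mono) auto
    also have "\<dots> = exp (real k * norm x)" by (simp add: exp_of_nat_mult)
    finally have "(1 + norm x) ^ k * exp (- a * (norm x)\<^sup>2 + x \<bullet> v) \<le> exp (real k * norm x) * exp (- a * (norm x)\<^sup>2 + x \<bullet> v)"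
      by (intro mult_right_mono) auto
    also have "\<dots> = exp (real k * norm x + (- a * (norm x)\<^sup>2 + x \<bullet> v))" by (simp add: exp_add)
    also have "real k * norm x + (- a * (norm x)\<^sup>2 + x \<bullet> v) \<le> (real k + norm v)\<^sup>2 / (4 * a)"
    proof -
      have "x \<bullet> v \<le> norm x * norm v" by (rule norm_cauchy_schwarz)
      then have 1: "real k * norm x + (- a * (norm x)\<^sup>2 + x \<bullet> v) \<le> (real k + norm v) * norm x - a * (norm x)\<^sup>2"
        by (simp add: algebra_simps)
      have "0 \<le> ((real k + norm v) - 2 * a * norm x)\<^sup>2" by simp
      then have "4 * a * ((real k + norm v) * norm x - a * (norm x)\<^sup>2) \<le> (real k + norm v)\<^sup>2"
        by (simp add: power2_eq_square algebra_simps)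
      then have "(real k + norm v) * norm x - a * (norm x)\<^sup>2 \<le> (real k + norm v)\<^sup>2 / (4 * a)"
        using a by (simp add: field_simps)
      with 1 show ?thesis by simp
    qed
    finally show ?thesis by simp
  qed
  then show ?case by (intro exI[of _ "exp ((real k + norm v)\<^sup>2 / (4 * a))"]) (simp add: norm_of_real del: exp_add)
next
  case (mult f b)
  obtain C where C: "\<And>x. (1 + norm x) ^ Suc k * norm (f x) \<le> C" using mult.IH by blast
  have "(1 + norm x) ^ k * norm (of_real (x \<bullet> b) * f x) \<le> norm b * C" for x
  proof -
    have "\<bar>x \<bullet> b\<bar> \<le> norm x * norm b" by (rule Cauchy_Schwarz_ineq2)
    also have "\<dots> \<le> (1 + norm x) * norm b" by (intro mult_right_mono) auto
    finally have "(1 + norm x) ^ k * norm (f x) * \<bar>x \<bullet> b\<bar> \<le> (1 + norm x) ^ k * norm (f x) * ((1 + norm x) * norm b)"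
      by (intro mult_left_mono) auto
    also have "\<dots> = norm b * ((1 + norm x) ^ Suc k * norm (f x))" by simp
    also have "\<dots> \<le> norm b * C" by (intro mult_left_mono C) auto
    finally show ?thesis by (simp add: norm_mult mult_ac)
  qed
  then show ?case by blast
next
  case (lin f g c c')
  obtain C where C: "\<And>x. (1 + norm x) ^ k * norm (f x) \<le> C" using lin.IH(1) by blast
  obtain C' where C': "\<And>x. (1 + norm x) ^ k * norm (g x) \<le> C'" using lin.IH(2) by blast
  have "(1 + norm x) ^ k * norm (of_real c * f x + of_real c' * g x) \<le> \<bar>c\<bar> * C + \<bar>c'\<bar> * C'" for x
  proof -
    have "(1 + norm x) ^ k * norm (of_real c * f x + of_real c' * g x) \<le> (1 + norm x) ^ k * (\<bar>c\<bar> * norm (f x) + \<bar>c'\<bar> * norm (g x))"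
      by (intro mult_left_mono order_trans[OF norm_triangle_ineq]) (auto simp: norm_mult)
    also have "\<dots> = \<bar>c\<bar> * ((1 + norm x) ^ k * norm (f x)) + \<bar>c'\<bar> * ((1 + norm x) ^ k * norm (g x))"
      by (simp add: algebra_simps)
    also have "\<dots> \<le> \<bar>c\<bar> * C + \<bar>c'\<bar> * C'" by (intro add_mono mult_left_mono C C') auto
    finally show ?thesis .
  qed
  then show ?case by blast
qed

lemma gauss_poly_derivative:
  assumes "gauss_poly a v f"
  shows "\<exists>D. (\<forall>b. gauss_poly a v (\<lambda>x. D x b)) \<and> (\<forall>x. (f has_derivative D x) (at x))"
  using assms
proof induction
  case base
  let ?e = "\<lambda>x. complex_of_real (exp (- a * (norm x)\<^sup>2 + x \<bullet> v))"
  define D where "D x h = of_real (- 2 * a) * (of_real (x \<bullet> h) * ?e x) + of_real (v \<bullet> h) * ?e x" for x h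
  have "gauss_poly a v (\<lambda>x. D x h)" for h
    unfolding D_def by (intro gauss_poly.intros)
  moreover have "(?e has_derivative D x) (at x)" for x
  proof -
    have "((\<lambda>x. exp (- a * (x \<bullet> x) + x \<bullet> v)) has_derivative
       (\<lambda>h. exp (- a * (x \<bullet> x) + x \<bullet> v) * (- a * (x \<bullet> h + h \<bullet> x) + h \<bullet> v))) (at x)"
      by (auto intro!: derivative_eq_intros)
    from bounded_linear.has_derivative[OF bounded_linear_of_real this]
    show ?thesis
      unfolding D_def power2_norm_eq_inner
      by (rule has_derivative_eq_rhs) (auto simp: fun_eq_iff inner_commute algebra_simps)
  qed
  ultimately show ?case by blast
next
  case (mult f b)
  then obtain D where D: "\<And>h. gauss_poly a v (\<lambda>x. D x h)" "\<And>x. (f has_derivative D x) (at x)" by blast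
  define D' where "D' x h = of_real (h \<bullet> b) * f x + of_real 1 * (of_real (x \<bullet> b) * D x h)" for x h
  have "gauss_poly a v (\<lambda>x. D' x h)" for h
    unfolding D'_def by (intro gauss_poly.intros D mult.hyps)
  moreover have "((\<lambda>x. of_real (x \<bullet> b) * f x) has_derivative D' x) (at x)" for x
  proof -
    have "((\<lambda>x. complex_of_real (x \<bullet> b)) has_derivative (\<lambda>h. of_real (h \<bullet> b))) (at x)"
      by (rule bounded_linear.has_derivative[OF bounded_linear_of_real]) (auto intro!: derivative_eq_intros)
    from has_derivative_mult[OF this D(2)[of x]] show ?thesis
      unfolding D'_def by (rule has_derivative_eq_rhs) (auto simp: fun_eq_iff algebra_simps)
  qed
  ultimately show ?case by blast
next
  case (lin f g c c')
  then obtain D E where D: "\<And>h. gauss_poly a v (\<lambda>x. D x h)" "\<And>x. (f has_derivative D x) (at x)"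
    and E: "\<And>h. gauss_poly a v (\<lambda>x. E x h)" "\<And>x. (g has_derivative E x) (at x)" by blast
  define D' where "D' x h = of_real c * D x h + of_real c' * E x h" for x h
  have "gauss_poly a v (\<lambda>x. D' x h)" for h
    unfolding D'_def by (intro gauss_poly.intros D E)
  moreover have "((\<lambda>x. of_real c * f x + of_real c' * g x) has_derivative D' x) (at x)" for x
    unfolding D'_def by (intro has_derivative_add has_derivative_mult_right D E)
  ultimately show ?case by blast
qed

lemma schwartz_gauss_poly:
  assumes a: "a > 0" and "gauss_poly a v f"
  shows "schwartz f"
  using assms(2)
proof (coinduction arbitrary: f)
  case schwartz
  obtain D where D: "\<And>h. gauss_poly a v (\<lambda>x. D x h)" "\<And>x. (f has_derivative D x) (at x)"
    using gauss_poly_derivative[OF schwartz] by blast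
  have "frechet_derivative f (at x) = D x" for x
    using frechet_derivative_at[OF D(2)] by simp
  moreover have "bounded (range (\<lambda>x. (1 + norm x) ^ k *\<^sub>R f x))" for k
    using gauss_poly_bounded[OF a schwartz, of k] by (auto simp: bounded_iff abs_of_nonneg)
  moreover have "f differentiable (at x)" for x
    using D(2) by (auto simp: differentiable_def)
  ultimately show ?case
    using D(1) by auto
qed

lemma schwartz_gaussian: "a > 0 \<Longrightarrow> schwartz (\<lambda>x. of_real (exp (- a * (norm x)\<^sup>2 + x \<bullet> v)))"
  by (rule schwartz_gauss_poly[OF _ gauss_poly.base])

text \<open>A Gaussian is a Schwartz function, so integrability against it is part of the
  definition. This makes the heat-regularised functions of the statement absolutely convergent
  integrals.\<close>

lemma has_fourier_transform_gaussian_integrable: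
  assumes F: "has_fourier_transform f F" and a: "a > 0"
  shows "integrable lborel (\<lambda>\<xi>. of_real (exp (- a * (norm \<xi>)\<^sup>2)) * F \<xi>)"
  using F schwartz_gaussian[OF a, of 0] unfolding has_fourier_transform_def by (auto simp: mult.commute)

text \<open>Gaussians are enough test functions. The difference of the two transforms times a fixed
  Gaussian is an integrable \<open>k\<close>, and each value of its mollification is a pairing with
  a Gaussian of shifted centre, hence 0; along a subsequence the mollifications converge to
  \<open>k\<close> almost everywhere.\<close>

theorem has_fourier_transform_unique:
  fixes f :: "'a::euclidean_space \<Rightarrow> complex"
  assumes F: "has_fourier_transform f F" and G: "has_fourier_transform f G"
  shows "AE \<xi> in lborel. F \<xi> = G \<xi>"
proof -
  define k where "k x = (F x - G x) * of_real (exp (- 1 * (norm x)\<^sup>2))" for x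
  have k: "integrable lborel k"
    unfolding k_def using Bochner_Integration.integrable_diff[OF has_fourier_transform_gaussian_integrable[OF F, of 1] has_fourier_transform_gaussian_integrable[OF G, of 1]]
    by (simp add: algebra_simps)
  have "mollify a k y = 0" if a: "a > 0" for a y
  proof -
    define c where "c = sqrt (a / pi) ^ DIM('a) * exp (- a * (norm y)\<^sup>2)"
    \<comment> \<open>From a |y - x|^2 + |x|^2 = (a + 1) |x|^2 - 2 a (x \<bullet> y) + a |y|^2; the
      part that does not depend on x goes into \<open>c\<close>.\<close>
    define \<phi> where "\<phi> x = complex_of_real (exp (- (a + 1) * (norm x)\<^sup>2 + x \<bullet> ((2 * a) *\<^sub>R y)))" for x
    have s: "schwartz \<phi>" unfolding \<phi>_def[abs_def] by (rule schwartz_gaussian) (use a in simp)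
    have e: "gauss_kernel a (y - x) *\<^sub>R k x = c *\<^sub>R (F x * \<phi> x - G x * \<phi> x)" for x
    proof -
      have "(norm (y - x))\<^sup>2 = (norm y)\<^sup>2 + (norm x)\<^sup>2 - 2 * (x \<bullet> y)"
        unfolding power2_norm_eq_inner by (simp add: inner_diff_left inner_diff_right inner_commute)
      then have "exp (- a * (norm (y - x))\<^sup>2) * exp (- 1 * (norm x)\<^sup>2) = exp (- a * (norm y)\<^sup>2) * exp (- (a + 1) * (norm x)\<^sup>2 + x \<bullet> ((2 * a) *\<^sub>R y))"
        unfolding mult_exp_exp by (simp add: algebra_simps inner_commute) (simp flip: distrib_left)
      then have "gauss_kernel a (y - x) * exp (- 1 * (norm x)\<^sup>2) = c * exp (- (a + 1) * (norm x)\<^sup>2 + x \<bullet> ((2 * a) *\<^sub>R y))"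
        unfolding gauss_kernel_def c_def by simp
      then have "complex_of_real (gauss_kernel a (y - x)) * of_real (exp (- 1 * (norm x)\<^sup>2)) = of_real c * \<phi> x"
        unfolding \<phi>_def of_real_mult[symmetric] by simp
      then show ?thesis by (simp add: k_def scaleR_conv_of_real algebra_simps)
    qed
    have "mollify a k y = (\<integral>x. c *\<^sub>R (F x * \<phi> x - G x * \<phi> x) \<partial>lborel)"
      unfolding mollify_def e ..
    also have "\<dots> = c *\<^sub>R ((\<integral>x. F x * \<phi> x \<partial>lborel) - (\<integral>x. G x * \<phi> x \<partial>lborel))"
      using F G s unfolding has_fourier_transform_def by simp
    also have "(\<integral>x. F x * \<phi> x \<partial>lborel) = (\<integral>x. G x * \<phi> x \<partial>lborel)"
      using F G s unfolding has_fourier_transform_def by metis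
    finally show ?thesis by simp
  qed
  moreover obtain b :: "nat \<Rightarrow> real" where b: "\<And>n. b n > 0"
    "AE y in lborel. (\<lambda>n. mollify (1 / (4 * b n)) k y) \<longlonglongrightarrow> k y"
    using mollify_osc_AE_subseq[OF k] by blast
  ultimately have "AE y in lborel. k y = 0"
    by (auto simp: LIMSEQ_const_iff)
  then show ?thesis
    by eventually_elim (simp add: k_def)
qed

lemma has_fourier_transform_fourier:
  "has_fourier_transform f F \<Longrightarrow> has_fourier_transform f (fourier f)"
  unfolding fourier_def by (rule someI[of "has_fourier_transform f"])

lemma fourier_inverse_AE:
  fixes H :: "'a::euclidean_space \<Rightarrow> complex"
  assumes "integrable lborel H"
  shows "AE \<xi> in lborel. fourier (inverse_fourier_integral H) \<xi> = H \<xi>"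
    and "has_fourier_transform (inverse_fourier_integral H) (fourier (inverse_fourier_integral H))"
  using has_fourier_transform_inverse[OF assms] has_fourier_transform_fourier has_fourier_transform_unique by blast+

subsection \<open>Polar coordinates and hyperplane sections\<close>

text \<open>Exhausts the half-line by compact intervals, on which the rule for substitution applies.
  That these contain 0 does not matter, since a point is a null set.\<close>

lemma nn_integral_Ioi_conv_SUP:
  fixes f :: "real \<Rightarrow> ennreal"
  assumes [measurable]: "f \<in> borel_measurable borel" and lim: "incseq a" "\<And>x. \<exists>n. x \<le> a n"
  shows "(\<integral>\<^sup>+t. indicator {0<..} t * f t \<partial>lborel) = (SUP n. \<integral>\<^sup>+t. f t * indicator {0..a n} t \<partial>lborel)"
proof -
  have "(\<integral>\<^sup>+t. indicator {0<..} t * f t \<partial>lborel) = (\<integral>\<^sup>+t. (SUP n. f t * indicator {0..a n} t) \<partial>lborel)"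
  proof (rule nn_integral_cong_AE)
    show "AE t in lborel. indicator {0<..} t * f t = (SUP n. f t * indicator {0..a n} t)"
      using AE_lborel_singleton[of "0::real"]
    proof eventually_elim
      case (elim t)
      obtain n where n: "t \<le> a n" using lim(2) by blast
      show ?case
      proof (cases "t > 0")
        case True
        have "(SUP n. f t * indicator {0..a n} t) = f t"
        proof (rule antisym)
          show "(SUP n. f t * indicator {0..a n} t) \<le> f t"
            by (rule SUP_least) (auto split: split_indicator)
          show "f t \<le> (SUP n. f t * indicator {0..a n} t)"
            by (rule SUP_upper2[of n]) (use n True in auto)
        qed
        then show ?thesis using True by simp
      next
        case False
        then show ?thesis using elim by simp
      qed
    qed
  qed
  also have "\<dots> = (SUP n. \<integral>\<^sup>+t. f t * indicator {0..a n} t \<partial>lborel)"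
  proof (rule nn_integral_monotone_convergence_SUP)
    show "incseq (\<lambda>n t. f t * indicator {0..a n} t)"
      using lim(1) by (auto simp: incseq_def le_fun_def split: split_indicator intro: order_trans)
  qed measurable
  finally show ?thesis .
qed

text \<open>The substitution t = r^2 as an identity of measures, so that checking it on sets gives
  it for all nonnegative Borel functions.\<close>

lemma distr_square:
  "density lborel (\<lambda>t::real. indicator {0<..} t) = distr (density lborel (\<lambda>r. ennreal (2 * r) * indicator {0<..} r)) borel (\<lambda>r. r\<^sup>2)"
proof (rule measure_eqI)
  fix A :: "real set" assume "A \<in> sets (density lborel (\<lambda>t::real. indicator {0<..} t))"
  then have [measurable]: "A \<in> sets borel" by simp
  have sq: "\<exists>n. x \<le> (real n)\<^sup>2" for x :: real
  proof -
    obtain n where "x \<le> real n" using real_arch_simple by blast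
    also have "real n \<le> (real n)\<^sup>2" by (cases n) (auto simp: power2_eq_square)
    finally show ?thesis by blast
  qed
  have "emeasure (density lborel (\<lambda>t::real. indicator {0<..} t)) A = (\<integral>\<^sup>+t. indicator {0<..} t * indicator A t \<partial>lborel)"
    by (simp add: emeasure_density)
  also have "\<dots> = (SUP n. \<integral>\<^sup>+t. indicator A t * indicator {0..(real n)\<^sup>2} t \<partial>lborel)"
    by (rule nn_integral_Ioi_conv_SUP) (use sq in \<open>auto simp: incseq_def intro: power_mono\<close>)
  also have "\<dots> = (SUP n. \<integral>\<^sup>+r. (indicator A (r\<^sup>2) * ennreal (2 * r)) * indicator {0..real n} r \<partial>lborel)"
  proof (rule SUP_cong[OF refl])
    fix n :: nat
    have "(\<integral>\<^sup>+t. ennreal (indicat_real A t * indicator {(0::real)\<^sup>2..(real n)\<^sup>2} t) \<partial>lborel)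
        = (\<integral>\<^sup>+r. ennreal (indicat_real A (r\<^sup>2) * (2 * r) * indicator {0..real n} r) \<partial>lborel)"
      by (rule nn_integral_substitution[where f="indicat_real A" and a=0 and b="real n" and g="\<lambda>r. r\<^sup>2" and g'="\<lambda>r. 2 * r"])
         (auto intro!: derivative_eq_intros continuous_intros simp: set_borel_measurable_def)
    moreover have "indicator A t * indicator {0..(real n)\<^sup>2} t = ennreal (indicat_real A t * indicator {(0::real)\<^sup>2..(real n)\<^sup>2} t)" for t
      by (auto split: split_indicator)
    moreover have "(indicator A (r\<^sup>2) * ennreal (2 * r)) * indicator {0..real n} r = ennreal (indicat_real A (r\<^sup>2) * (2 * r) * indicator {0..real n} r)" for r
      by (auto split: split_indicator)
    ultimately show "(\<integral>\<^sup>+t. indicator A t * indicator {0..(real n)\<^sup>2} t \<partial>lborel) = (\<integral>\<^sup>+r. (indicator A (r\<^sup>2) * ennreal (2 * r)) * indicator {0..real n} r \<partial>lborel)"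
      by simp
  qed
  also have "\<dots> = (\<integral>\<^sup>+r. indicator {0<..} r * (indicator A (r\<^sup>2) * ennreal (2 * r)) \<partial>lborel)"
    by (rule nn_integral_Ioi_conv_SUP[symmetric]) (auto simp: incseq_def real_arch_simple)
  also have "\<dots> = emeasure (distr (density lborel (\<lambda>r. ennreal (2 * r) * indicator {0<..} r)) borel (\<lambda>r. r\<^sup>2)) A"
  proof -
    have "emeasure (distr (density lborel (\<lambda>r. ennreal (2 * r) * indicator {0<..} r)) borel (\<lambda>r. r\<^sup>2)) A
        = (\<integral>\<^sup>+t. indicator A t \<partial>distr (density lborel (\<lambda>r. ennreal (2 * r) * indicator {0<..} r)) borel (\<lambda>r. r\<^sup>2))"
      by simp
    also have "\<dots> = (\<integral>\<^sup>+r. indicator {0<..} r * (indicator A (r\<^sup>2) * ennreal (2 * r)) \<partial>lborel)"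
      by (simp add: nn_integral_distr nn_integral_density mult_ac del: nn_integral_indicator)
    finally show ?thesis by simp
  qed
  finally show "emeasure (density lborel (\<lambda>t::real. indicator {0<..} t)) A = emeasure (distr (density lborel (\<lambda>r. ennreal (2 * r) * indicator {0<..} r)) borel (\<lambda>r. r\<^sup>2)) A" .
qed simp

lemma nn_integral_square_subst:
  fixes f :: "real \<Rightarrow> ennreal"
  assumes [measurable]: "f \<in> borel_measurable borel"
  shows "(\<integral>\<^sup>+r. indicator {0<..} r * ennreal (2 * r) * f (r\<^sup>2) \<partial>lborel) = (\<integral>\<^sup>+t. indicator {0<..} t * f t \<partial>lborel)"
proof -
  have "(\<integral>\<^sup>+t. indicator {0<..} t * f t \<partial>lborel) = (\<integral>\<^sup>+t. f t \<partial>density lborel (\<lambda>t::real. indicator {0<..} t))"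
    by (subst nn_integral_density) auto
  also have "\<dots> = (\<integral>\<^sup>+r. indicator {0<..} r * ennreal (2 * r) * f (r\<^sup>2) \<partial>lborel)"
    unfolding distr_square by (simp add: nn_integral_distr nn_integral_density mult_ac)
  finally show ?thesis by simp
qed

text \<open>With t = r^2 this is Euler's integral for the Gamma function.\<close>

lemma nn_integral_powr_gaussian:
  fixes \<kappa> :: real
  assumes \<kappa>: "\<kappa> > - 1"
  shows "(\<integral>\<^sup>+r. indicator {0<..} r * ennreal (r powr \<kappa> * exp (- r\<^sup>2)) \<partial>lborel) = ennreal (Gamma ((\<kappa> + 1) / 2) / 2)"
proof -
  let ?s = "(\<kappa> + 1) / 2"
  have "(\<integral>\<^sup>+r. indicator {0<..} r * ennreal (r powr \<kappa> * exp (- r\<^sup>2)) \<partial>lborel)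
    = (\<integral>\<^sup>+r. indicator {0<..} r * ennreal (2 * r) * ennreal (1/2 * (r\<^sup>2) powr (?s - 1) / exp (r\<^sup>2)) \<partial>lborel)"
  proof (rule nn_integral_cong)
    fix r :: real
    have "2 * r * (1/2 * (r\<^sup>2) powr (?s - 1) / exp (r\<^sup>2)) = r powr \<kappa> * exp (- r\<^sup>2)" if "r > 0"
    proof -
      have "(r\<^sup>2) powr (?s - 1) = r powr (\<kappa> - 1)"
      proof -
        have "(r\<^sup>2) powr (?s - 1) = r powr (2 * (?s - 1))" using that powr_powr[of r 2 "?s - 1"] by simp
        also have "2 * (?s - 1) = \<kappa> - 1" by simp
        finally show ?thesis .
      qed
      moreover have "r * r powr (\<kappa> - 1) = r powr \<kappa>" using that by (simp add: powr_mult_base)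
      moreover have "2 * r * (1/2 * X / exp (r\<^sup>2)) = (r * X) * exp (- r\<^sup>2)" for X
        by (simp add: exp_minus field_simps)
      ultimately show ?thesis by (simp only:)
    qed
    then show "indicator {0<..} r * ennreal (r powr \<kappa> * exp (- r\<^sup>2)) = indicator {0<..} r * ennreal (2 * r) * ennreal (1/2 * (r\<^sup>2) powr (?s - 1) / exp (r\<^sup>2))"
      by (cases "r > 0") (simp_all only: ennreal_mult[symmetric] indicator_def, simp_all flip: ennreal_mult)
  qed
  also have "\<dots> = (\<integral>\<^sup>+t. indicator {0<..} t * ennreal (1/2 * t powr (?s - 1) / exp t) \<partial>lborel)"
    by (rule nn_integral_square_subst) measurable
  also have "\<dots> = (\<integral>\<^sup>+t. ennreal (1/2) * ennreal (indicator {0..} t * t powr (?s - 1) / exp t) \<partial>lborel)"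
    by (rule nn_integral_cong, subst ennreal_mult[symmetric]) (auto split: split_indicator simp: less_le)
  also have "\<dots> = ennreal (1/2) * ennreal (Gamma ?s)"
  proof -
    have "(\<integral>\<^sup>+t. ennreal (indicator {0..} t * t powr (?s - 1) / exp t) \<partial>lborel) = ennreal (Gamma ?s)"
      by (rule Gamma_conv_nn_integral_real[symmetric]) (use \<kappa> in simp)
    then show ?thesis by (subst nn_integral_cmult) simp_all
  qed
  also have "\<dots> = ennreal (Gamma ?s / 2)"
    using \<kappa> by (subst ennreal_mult[symmetric]) (auto intro!: less_imp_le[OF Gamma_real_pos])
  finally show ?thesis .
qed

text \<open>The image of this weight under \<open>sgn\<close> is the surface measure of the unit sphere.\<close>

definition sphere_weight :: "'a::euclidean_space \<Rightarrow> real" where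
  "sphere_weight y = real DIM('a) * indicator (cball 0 1) y"

lemma sets_borel_cball [measurable]: "cball (c::'a::euclidean_space) r \<in> sets borel"
  by simp

lemma borel_measurable_sphere_weight [measurable]: "sphere_weight \<in> borel_measurable borel"
  unfolding sphere_weight_def[abs_def] by measurable

lemma sphere_weight_nonneg [simp]: "sphere_weight y \<ge> 0"
  by (simp add: sphere_weight_def)

text \<open>Normalises polar coordinates. The weight restricts s to s \<ge> |z|, where d s^(-d-1)
  has the primitive - s^(-d).\<close>

lemma nn_integral_sphere_weight_scaled:
  fixes z :: "'a::euclidean_space"
  assumes z: "z \<noteq> 0"
  shows "(\<integral>\<^sup>+s. indicator {0<..} s * ennreal (inverse s ^ Suc DIM('a)) * ennreal (sphere_weight ((1 / s) *\<^sub>R z)) \<partial>lborel) = ennreal (inverse (norm z ^ DIM('a)))"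
proof -
  let ?d = "DIM('a)"
  have "(\<integral>\<^sup>+s. indicator {0<..} s * ennreal (inverse s ^ Suc ?d) * ennreal (sphere_weight ((1 / s) *\<^sub>R z)) \<partial>lborel)
     = (\<integral>\<^sup>+s. ennreal (real ?d * inverse s ^ Suc ?d) * indicator {norm z..} s \<partial>lborel)"
  proof (rule nn_integral_cong)
    fix s :: real
    have z0: "norm z > 0" using z by simp
    have "norm z / s \<le> 1 \<longleftrightarrow> norm z \<le> s" if "s > 0" using that by (simp add: divide_le_eq)
    moreover have "\<not> norm z \<le> s" if "\<not> s > 0" using that z0 by linarith
    ultimately show "indicator {0<..} s * ennreal (inverse s ^ Suc ?d) * ennreal (sphere_weight ((1 / s) *\<^sub>R z)) = ennreal (real ?d * inverse s ^ Suc ?d) * indicator {norm z..} s"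
      by (cases "s > 0"; cases "norm z \<le> s")
         (simp_all add: sphere_weight_def mult.commute indicator_def flip: ennreal_mult)
  qed
  also have "\<dots> = ennreal (0 - (- (inverse (norm z) ^ ?d)))"
  proof (rule nn_integral_FTC_atLeast[where F="\<lambda>s. - (inverse s ^ ?d)"])
    fix s assume "norm z \<le> s"
    then have s: "s > 0" using z by (smt (verit) zero_less_norm_iff)
    have "((\<lambda>s. - (inverse s ^ ?d)) has_real_derivative - (real ?d * inverse s ^ (?d - Suc 0) * (- (inverse s * inverse s)))) (at s)"
      using s by (auto intro!: derivative_eq_intros)
    moreover have "inverse s ^ Suc ?d = inverse s ^ (?d - Suc 0) * (inverse s * inverse s)"
      using DIM_positive[where 'a='a] by (metis One_nat_def Suc_pred mult.assoc mult.commute power_Suc)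
    ultimately show "((\<lambda>s. - (inverse s ^ ?d)) has_real_derivative real ?d * inverse s ^ Suc ?d) (at s)"
      by (simp add: mult.assoc del: power_Suc)
    show "0 \<le> real ?d * inverse s ^ Suc ?d" using s by simp
  next
    have "((\<lambda>s::real. - (inverse s ^ ?d)) \<longlongrightarrow> - (0 ^ ?d)) at_top"
      by (intro tendsto_intros tendsto_inverse_0_at_top filterlim_ident)
    then show "((\<lambda>s::real. - (inverse s ^ ?d)) \<longlongrightarrow> 0) at_top" by (simp add: zero_power)
  qed measurable
  finally show ?thesis by (simp add: power_inverse)
qed

text \<open>A ball serves as the space of directions, since only \<open>sgn y\<close> matters. The
  substitution r = |y| s turns \<open>r *\<^sub>R sgn y\<close> into \<open>s *\<^sub>R y\<close>;
  after exchanging the integrals, z = s y restores Lebesgue measure, and the integral over s that is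
  left equals |z|^(-d) by \<open>nn_integral_sphere_weight_scaled\<close>, cancelling the power of
  |z| that the substitutions produce.\<close>

lemma nn_integral_polar:
  fixes g :: "'a::euclidean_space \<Rightarrow> ennreal"
  assumes [measurable]: "g \<in> borel_measurable borel"
  shows "(\<integral>\<^sup>+x. g x \<partial>lborel) =
    (\<integral>\<^sup>+y. ennreal (sphere_weight y) * (\<integral>\<^sup>+r. indicator {0<..} r * ennreal (r ^ (DIM('a) - 1)) * g (r *\<^sub>R sgn y) \<partial>lborel) \<partial>lborel)"
proof -
  let ?d = "DIM('a)"
  have d: "?d = Suc (?d - 1)" using DIM_positive[where 'a='a] by simp
  have "(\<integral>\<^sup>+y. ennreal (sphere_weight y) * (\<integral>\<^sup>+r. indicator {0<..} r * ennreal (r ^ (?d - 1)) * g (r *\<^sub>R sgn y) \<partial>lborel) \<partial>lborel)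
     = (\<integral>\<^sup>+y. ennreal (sphere_weight y) * (ennreal (norm y ^ ?d) * (\<integral>\<^sup>+s. indicator {0<..} s * ennreal (s ^ (?d - 1)) * g (s *\<^sub>R y) \<partial>lborel)) \<partial>lborel)"
  proof (rule nn_integral_cong_AE)
    show "AE y in lborel. ennreal (sphere_weight y) * (\<integral>\<^sup>+r. indicator {0<..} r * ennreal (r ^ (?d - 1)) * g (r *\<^sub>R sgn y) \<partial>lborel)
      = ennreal (sphere_weight y) * (ennreal (norm y ^ ?d) * (\<integral>\<^sup>+s. indicator {0<..} s * ennreal (s ^ (?d - 1)) * g (s *\<^sub>R y) \<partial>lborel))"
      using AE_lborel_singleton[of "0::'a"]
    proof eventually_elim
      case (elim y)
      then have y: "norm y > 0" by simp
      have "(\<integral>\<^sup>+r. indicator {0<..} r * ennreal (r ^ (?d - 1)) * g (r *\<^sub>R sgn y) \<partial>lborel)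
         = ennreal (norm y) * (\<integral>\<^sup>+s. indicator {0<..} (norm y * s) * ennreal ((norm y * s) ^ (?d - 1)) * g ((norm y * s) *\<^sub>R sgn y) \<partial>lborel)"
        using y nn_integral_real_affine[of "\<lambda>r. indicator {0<..} r * ennreal (r ^ (?d - 1)) * g (r *\<^sub>R sgn y)" "norm y" 0] by simp
      also have "(\<integral>\<^sup>+s. indicator {0<..} (norm y * s) * ennreal ((norm y * s) ^ (?d - 1)) * g ((norm y * s) *\<^sub>R sgn y) \<partial>lborel)
        = (\<integral>\<^sup>+s. ennreal (norm y ^ (?d - 1)) * (indicator {0<..} s * ennreal (s ^ (?d - 1)) * g (s *\<^sub>R y)) \<partial>lborel)"
      proof (rule nn_integral_cong)
        fix s :: real
        have "(norm y * s) *\<^sub>R sgn y = s *\<^sub>R y" using y by (simp add: sgn_div_norm)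
        then show "indicator {0<..} (norm y * s) * ennreal ((norm y * s) ^ (?d - 1)) * g ((norm y * s) *\<^sub>R sgn y)
          = ennreal (norm y ^ (?d - 1)) * (indicator {0<..} s * ennreal (s ^ (?d - 1)) * g (s *\<^sub>R y))"
          using y by (auto simp: power_mult_distrib ennreal_mult zero_less_mult_iff mult.assoc split: split_indicator)
      qed
      also have "\<dots> = ennreal (norm y ^ (?d - 1)) * (\<integral>\<^sup>+s. indicator {0<..} s * ennreal (s ^ (?d - 1)) * g (s *\<^sub>R y) \<partial>lborel)"
        by (rule nn_integral_cmult) measurable
      also have "ennreal (norm y) * (ennreal (norm y ^ (?d - 1)) * (\<integral>\<^sup>+s. indicator {0<..} s * ennreal (s ^ (?d - 1)) * g (s *\<^sub>R y) \<partial>lborel))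
         = ennreal (norm y ^ ?d) * (\<integral>\<^sup>+s. indicator {0<..} s * ennreal (s ^ (?d - 1)) * g (s *\<^sub>R y) \<partial>lborel)"
      proof -
        have "norm y ^ ?d = norm y * norm y ^ (?d - 1)" by (metis d power_Suc)
        then show ?thesis by (simp add: ennreal_mult mult.assoc)
      qed
      finally show ?case by simp
    qed
  qed
  also have "\<dots> = (\<integral>\<^sup>+y. (\<integral>\<^sup>+s. indicator {0<..} s * ennreal (s ^ (?d - 1)) * (ennreal (sphere_weight y * norm y ^ ?d) * g (s *\<^sub>R y)) \<partial>lborel) \<partial>lborel)"
    by (simp add: nn_integral_cmult[symmetric] ennreal_mult mult_ac)
  also have "\<dots> = (\<integral>\<^sup>+s. (\<integral>\<^sup>+y. indicator {0<..} s * ennreal (s ^ (?d - 1)) * (ennreal (sphere_weight y * norm y ^ ?d) * g (s *\<^sub>R y)) \<partial>lborel) \<partial>lborel)"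
    by (subst lborel_pair.Fubini') simp_all
  also have "\<dots> = (\<integral>\<^sup>+s. (\<integral>\<^sup>+z. g z * ennreal (norm z ^ ?d) * (indicator {0<..} s * ennreal (inverse s ^ Suc ?d) * ennreal (sphere_weight ((1 / s) *\<^sub>R z))) \<partial>lborel) \<partial>lborel)"
  proof (rule nn_integral_cong)
    fix s :: real
    show "(\<integral>\<^sup>+y. indicator {0<..} s * ennreal (s ^ (?d - 1)) * (ennreal (sphere_weight y * norm y ^ ?d) * g (s *\<^sub>R y)) \<partial>lborel)
      = (\<integral>\<^sup>+z. g z * ennreal (norm z ^ ?d) * (indicator {0<..} s * ennreal (inverse s ^ Suc ?d) * ennreal (sphere_weight ((1 / s) *\<^sub>R z))) \<partial>lborel)"
    proof (cases "s > 0")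
      case True
      have "(\<integral>\<^sup>+y. indicator {0<..} s * ennreal (s ^ (?d - 1)) * (ennreal (sphere_weight y * norm y ^ ?d) * g (s *\<^sub>R y)) \<partial>lborel)
        = ennreal ((1 / s) ^ ?d) * (\<integral>\<^sup>+z. ennreal (s ^ (?d - 1)) * (ennreal (sphere_weight ((1 / s) *\<^sub>R z) * norm ((1 / s) *\<^sub>R z) ^ ?d) * g z) \<partial>lborel)"
        using True nn_integral_lborel_affine[of "\<lambda>y. indicator {0<..} s * ennreal (s ^ (?d - 1)) * (ennreal (sphere_weight y * norm y ^ ?d) * g (s *\<^sub>R y))" "1 / s" 0] by simp
      also have "\<dots> = (\<integral>\<^sup>+z. ennreal ((1 / s) ^ ?d) * (ennreal (s ^ (?d - 1)) * (ennreal (sphere_weight ((1 / s) *\<^sub>R z) * norm ((1 / s) *\<^sub>R z) ^ ?d) * g z)) \<partial>lborel)"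
        by (rule nn_integral_cmult[symmetric]) measurable
      also have "\<dots> = (\<integral>\<^sup>+z. g z * ennreal (norm z ^ ?d) * (indicator {0<..} s * ennreal (inverse s ^ Suc ?d) * ennreal (sphere_weight ((1 / s) *\<^sub>R z))) \<partial>lborel)"
      proof (rule nn_integral_cong)
        fix z :: 'a
        have "(1 / s) ^ ?d * s ^ (?d - 1) = inverse s"
        proof -
          have "(1 / s) ^ ?d = (1 / s) * (1 / s) ^ (?d - 1)" by (metis d power_Suc)
          then show ?thesis using True by (simp add: power_divide inverse_eq_divide)
        qed
        moreover have "norm ((1 / s) *\<^sub>R z) ^ ?d = inverse s ^ ?d * norm z ^ ?d"
          using True by (simp add: power_mult_distrib power_divide power_inverse field_simps)
        ultimately have "(1 / s) ^ ?d * (s ^ (?d - 1) * (sphere_weight ((1 / s) *\<^sub>R z) * norm ((1 / s) *\<^sub>R z) ^ ?d)) = norm z ^ ?d * (inverse s ^ Suc ?d * sphere_weight ((1 / s) *\<^sub>R z))"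
          by (simp add: mult_ac)
        then have "ennreal ((1 / s) ^ ?d * (s ^ (?d - 1) * (sphere_weight ((1 / s) *\<^sub>R z) * norm ((1 / s) *\<^sub>R z) ^ ?d))) = ennreal (norm z ^ ?d * (inverse s ^ Suc ?d * sphere_weight ((1 / s) *\<^sub>R z)))"
          by (rule arg_cong)
        then have "ennreal ((1 / s) ^ ?d) * (ennreal (s ^ (?d - 1)) * (ennreal (sphere_weight ((1 / s) *\<^sub>R z) * norm ((1 / s) *\<^sub>R z) ^ ?d))) = ennreal (norm z ^ ?d) * (ennreal (inverse s ^ Suc ?d) * ennreal (sphere_weight ((1 / s) *\<^sub>R z)))"
          using True by (simp add: ennreal_mult)
        then have "g z * (ennreal ((1 / s) ^ ?d) * (ennreal (s ^ (?d - 1)) * (ennreal (sphere_weight ((1 / s) *\<^sub>R z) * norm ((1 / s) *\<^sub>R z) ^ ?d)))) = g z * (ennreal (norm z ^ ?d) * (ennreal (inverse s ^ Suc ?d) * ennreal (sphere_weight ((1 / s) *\<^sub>R z))))"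
          by simp
        then show "ennreal ((1 / s) ^ ?d) * (ennreal (s ^ (?d - 1)) * (ennreal (sphere_weight ((1 / s) *\<^sub>R z) * norm ((1 / s) *\<^sub>R z) ^ ?d) * g z)) = g z * ennreal (norm z ^ ?d) * (indicator {0<..} s * ennreal (inverse s ^ Suc ?d) * ennreal (sphere_weight ((1 / s) *\<^sub>R z)))"
          using True by (simp only: mult_ac) simp
      qed
      finally show ?thesis .
    qed simp
  qed
  also have "\<dots> = (\<integral>\<^sup>+z. (\<integral>\<^sup>+s. g z * ennreal (norm z ^ ?d) * (indicator {0<..} s * ennreal (inverse s ^ Suc ?d) * ennreal (sphere_weight ((1 / s) *\<^sub>R z))) \<partial>lborel) \<partial>lborel)"
    by (subst lborel_pair.Fubini') simp_all
  also have "\<dots> = (\<integral>\<^sup>+z. g z \<partial>lborel)"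
  proof (rule nn_integral_cong_AE)
    show "AE z in lborel. (\<integral>\<^sup>+s. g z * ennreal (norm z ^ ?d) * (indicator {0<..} s * ennreal (inverse s ^ Suc ?d) * ennreal (sphere_weight ((1 / s) *\<^sub>R z))) \<partial>lborel) = g z"
      using AE_lborel_singleton[of "0::'a"]
    proof eventually_elim
      case (elim z)
      have "(\<integral>\<^sup>+s. g z * ennreal (norm z ^ ?d) * (indicator {0<..} s * ennreal (inverse s ^ Suc ?d) * ennreal (sphere_weight ((1 / s) *\<^sub>R z))) \<partial>lborel)
        = g z * ennreal (norm z ^ ?d) * ennreal (inverse (norm z ^ ?d))"
        by (subst nn_integral_cmult) (simp_all only: nn_integral_sphere_weight_scaled[OF elim], measurable)
      also have "\<dots> = g z" using elim by (simp add: mult.assoc flip: ennreal_mult)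
      finally show ?case .
    qed
  qed
  finally show ?thesis by simp
qed

text \<open>The surface area of the unit sphere, obtained as \<open>DIM('a)\<close> times the volume
  of the unit ball.\<close>

lemma nn_integral_sphere_weight: "(\<integral>\<^sup>+(y::'a::euclidean_space). ennreal (sphere_weight y) \<partial>lborel) = ennreal (2 * pi powr (real DIM('a) / 2) / Gamma (real DIM('a) / 2))"
proof -
  let ?d = "real DIM('a)"
  have d: "?d / 2 > 0" using DIM_positive[where 'a='a] by simp
  have "(\<integral>\<^sup>+(y::'a). ennreal (sphere_weight y) \<partial>lborel) = (\<integral>\<^sup>+(y::'a). ennreal ?d * indicator (cball 0 1) y \<partial>lborel)"
    by (rule nn_integral_cong) (auto simp: sphere_weight_def split: split_indicator)
  also have "\<dots> = ennreal ?d * ennreal (unit_ball_vol ?d)"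
    by (subst nn_integral_cmult) (auto simp: emeasure_cball)
  also have "\<dots> = ennreal (?d * unit_ball_vol ?d)" by (simp add: ennreal_mult)
  also have "?d * unit_ball_vol ?d = 2 * pi powr (?d / 2) / Gamma (?d / 2)"
  proof -
    have "?d / 2 \<notin> \<int>\<^sub>\<le>\<^sub>0" using d by (metis nonpos_Ints_nonpos not_le)
    then have G: "Gamma (?d / 2 + 1) = ?d / 2 * Gamma (?d / 2)" by (rule Gamma_plus1)
    have "?d * (P / (?d / 2 * G)) = 2 * P / G" if "G > 0" for P G :: real
      using that d by (simp add: field_simps)
    from this[OF Gamma_real_pos[OF d]] show ?thesis
      unfolding unit_ball_vol_def G .
  qed
  finally show ?thesis .
qed

definition slab :: "real \<Rightarrow> real" where "slab = indicator {0..1}"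

lemma borel_measurable_slab [measurable]: "slab \<in> borel_measurable borel"
  unfolding slab_def by measurable

lemma slab_nonneg [simp]: "slab s \<ge> 0" by (simp add: slab_def)

lemma nn_integral_slab: "(\<integral>\<^sup>+s. ennreal (slab (t - s)) \<partial>lborel) = 1"
proof -
  have "(\<integral>\<^sup>+s. ennreal (slab (t - s)) \<partial>lborel) = (\<integral>\<^sup>+s. ennreal (slab s) \<partial>lborel)"
    using nn_integral_real_affine[of "\<lambda>s. ennreal (slab s)" "-1" t] by simp
  also have "\<dots> = (\<integral>\<^sup>+s. indicator {0..1::real} s \<partial>lborel)"
    by (simp add: slab_def ennreal_indicator)
  also have "\<dots> = 1" by simp
  finally show ?thesis .
qed

text \<open>The integral over the hyperplane \<open>{z. z \<bullet> n = s}\<close> is written as an integral over the whole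
  space of the orthogonal projection, weighted by a probability density in the direction of \<open>n\<close>.
  This avoids coordinates on the hyperplane.\<close>

lemma nn_integral_hyperplane:
  fixes g :: "'a::euclidean_space \<Rightarrow> ennreal"
  assumes [measurable]: "g \<in> borel_measurable borel" and n: "norm n = 1"
  shows "(\<integral>\<^sup>+s. (\<integral>\<^sup>+x. ennreal (slab (x \<bullet> n)) * g (x + (s - x \<bullet> n) *\<^sub>R n) \<partial>lborel) \<partial>lborel) = (\<integral>\<^sup>+x. g x \<partial>lborel)"
proof -
  have nn: "n \<bullet> n = 1" using n by (simp add: norm_eq_1)
  have "(\<integral>\<^sup>+s. (\<integral>\<^sup>+x. ennreal (slab (x \<bullet> n)) * g (x + (s - x \<bullet> n) *\<^sub>R n) \<partial>lborel) \<partial>lborel)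
     = (\<integral>\<^sup>+x. (\<integral>\<^sup>+s. ennreal (slab (x \<bullet> n)) * g (x + (s - x \<bullet> n) *\<^sub>R n) \<partial>lborel) \<partial>lborel)"
    by (subst lborel_pair.Fubini') simp_all
  also have "\<dots> = (\<integral>\<^sup>+x. (\<integral>\<^sup>+s. ennreal (slab (x \<bullet> n)) * g (x + s *\<^sub>R n) \<partial>lborel) \<partial>lborel)"
  proof (rule nn_integral_cong)
    fix x
    show "(\<integral>\<^sup>+s. ennreal (slab (x \<bullet> n)) * g (x + (s - x \<bullet> n) *\<^sub>R n) \<partial>lborel) = (\<integral>\<^sup>+s. ennreal (slab (x \<bullet> n)) * g (x + s *\<^sub>R n) \<partial>lborel)"
      using nn_integral_real_affine[of "\<lambda>s. ennreal (slab (x \<bullet> n)) * g (x + s *\<^sub>R n)" 1 "- (x \<bullet> n)"] by simp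
  qed
  also have "\<dots> = (\<integral>\<^sup>+s. (\<integral>\<^sup>+x. ennreal (slab (x \<bullet> n)) * g (x + s *\<^sub>R n) \<partial>lborel) \<partial>lborel)"
    by (subst lborel_pair.Fubini') simp_all
  also have "\<dots> = (\<integral>\<^sup>+s. (\<integral>\<^sup>+x. ennreal (slab (x \<bullet> n - s)) * g x \<partial>lborel) \<partial>lborel)"
  proof (rule nn_integral_cong)
    fix s
    show "(\<integral>\<^sup>+x. ennreal (slab (x \<bullet> n)) * g (x + s *\<^sub>R n) \<partial>lborel) = (\<integral>\<^sup>+x. ennreal (slab (x \<bullet> n - s)) * g x \<partial>lborel)"
      using nn_integral_lborel_translate[of "\<lambda>x. ennreal (slab (x \<bullet> n - s)) * g x" "s *\<^sub>R n"] nn by (simp add: inner_add_left)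
  qed
  also have "\<dots> = (\<integral>\<^sup>+x. (\<integral>\<^sup>+s. g x * ennreal (slab (x \<bullet> n - s)) \<partial>lborel) \<partial>lborel)"
    by (subst lborel_pair.Fubini') (simp_all add: mult.commute)
  also have "\<dots> = (\<integral>\<^sup>+x. g x \<partial>lborel)"
    by (simp add: nn_integral_cmult nn_integral_slab)
  finally show ?thesis .
qed

lemma norm_hyperplane_decomp:
  fixes n x :: "'a::euclidean_space"
  assumes n: "norm n = 1"
  shows "(norm (x + (s - x \<bullet> n) *\<^sub>R n))\<^sup>2 = s\<^sup>2 + (norm (x - (x \<bullet> n) *\<^sub>R n))\<^sup>2"
    and "(x + (s - x \<bullet> n) *\<^sub>R n) \<bullet> n = s"
proof -
  have nn: "n \<bullet> n = 1" using n by (simp add: norm_eq_1)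
  then show "(x + (s - x \<bullet> n) *\<^sub>R n) \<bullet> n = s" by (simp add: inner_add_left)
  show "(norm (x + (s - x \<bullet> n) *\<^sub>R n))\<^sup>2 = s\<^sup>2 + (norm (x - (x \<bullet> n) *\<^sub>R n))\<^sup>2"
    unfolding power2_norm_eq_inner
    by (simp add: inner_add_left inner_add_right inner_diff_left inner_diff_right nn inner_commute[of n x] power2_eq_square algebra_simps)
qed

text \<open>By Pythagoras the Gaussian integral over the whole space factors into the one along
  \<open>n\<close> and the one sought; \<open>sqrt pi\<close> is divided out.\<close>

lemma nn_integral_hyperplane_gaussian:
  fixes n :: "'a::euclidean_space"
  assumes n: "norm n = 1"
  shows "(\<integral>\<^sup>+x. ennreal (slab (x \<bullet> n)) * ennreal (exp (- (norm (x - (x \<bullet> n) *\<^sub>R n))\<^sup>2)) \<partial>lborel) = ennreal (sqrt pi ^ (DIM('a) - 1))"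
    (is "?T = _")
proof -
  have d: "DIM('a) = Suc (DIM('a) - 1)" using DIM_positive[where 'a='a] by simp
  have "ennreal (sqrt pi ^ DIM('a)) = (\<integral>\<^sup>+(x::'a). ennreal (exp (- 1 * (norm x)\<^sup>2)) \<partial>lborel)"
    using nn_integral_gaussian[of 1, where 'a='a] by simp
  also have "\<dots> = (\<integral>\<^sup>+s. (\<integral>\<^sup>+x. ennreal (slab (x \<bullet> n)) * ennreal (exp (- 1 * (norm (x + (s - x \<bullet> n) *\<^sub>R n))\<^sup>2)) \<partial>lborel) \<partial>lborel)"
    by (rule nn_integral_hyperplane[symmetric]) (use n in auto)
  also have "\<dots> = (\<integral>\<^sup>+s. (\<integral>\<^sup>+x. ennreal (exp (- s\<^sup>2)) * (ennreal (slab (x \<bullet> n)) * ennreal (exp (- (norm (x - (x \<bullet> n) *\<^sub>R n))\<^sup>2))) \<partial>lborel) \<partial>lborel)"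
    by (intro nn_integral_cong) (simp add: norm_hyperplane_decomp[OF n] exp_diff exp_minus divide_inverse mult_ac flip: ennreal_mult exp_minus)
  also have "\<dots> = (\<integral>\<^sup>+s. ennreal (exp (- s\<^sup>2)) \<partial>lborel) * ?T"
    by (simp add: nn_integral_cmult nn_integral_multc)
  also have "(\<integral>\<^sup>+(s::real). ennreal (exp (- s\<^sup>2)) \<partial>lborel) = ennreal (sqrt pi)"
    using nn_integral_gaussian[of 1, where 'a=real] by simp
  finally have eq: "ennreal (sqrt pi) * ?T = ennreal (sqrt pi ^ DIM('a))" by simp
  have "?T = ennreal (inverse (sqrt pi)) * (ennreal (sqrt pi) * ?T)"
    by (simp add: mult.assoc[symmetric] flip: ennreal_mult)
  also have "\<dots> = ennreal (inverse (sqrt pi) * sqrt pi ^ DIM('a))"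
    unfolding eq by (simp add: ennreal_mult)
  also have "inverse (sqrt pi) * sqrt pi ^ DIM('a) = sqrt pi ^ (DIM('a) - 1)"
  proof -
    have "sqrt pi ^ DIM('a) = sqrt pi * sqrt pi ^ (DIM('a) - 1)" by (metis d power_Suc)
    then show ?thesis by simp
  qed
  finally show ?thesis .
qed

text \<open>The power of the positive part. In polar coordinates the radius belonging to a direction
  n is r = q \<bullet> n, so the positivity of r is made part of the function.\<close>

definition pospow :: "real \<Rightarrow> real \<Rightarrow> real" where
  "pospow \<kappa> u = indicator {0<..} u * u powr \<kappa>"

lemma borel_measurable_pospow [measurable]: "pospow \<kappa> \<in> borel_measurable borel"
  unfolding pospow_def[abs_def] by measurable

lemma pospow_nonneg [simp]: "pospow \<kappa> u \<ge> 0"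
  by (simp add: pospow_def)

lemma pospow_mult: "r > 0 \<Longrightarrow> pospow \<kappa> (r * u) = r powr \<kappa> * pospow \<kappa> u"
  by (auto simp: pospow_def powr_mult zero_less_mult_iff split: split_indicator)

text \<open>The integral of \<open>pospow \<kappa> (q \<bullet> n)\<close> over the unit sphere of
  directions n, for a unit vector q; see \<open>nn_integral_sphere_pospow\<close>.\<close>

definition sphere_const :: "real \<Rightarrow> nat \<Rightarrow> real" where
  "sphere_const \<kappa> d = sqrt pi ^ (d - 1) * Gamma ((\<kappa> + 1) / 2) / Gamma ((\<kappa> + real d) / 2)"

lemma sphere_const_nonneg:
  assumes "\<kappa> > - 1" and "d > 0"
  shows "sphere_const \<kappa> d \<ge> 0"
proof -
  have "Gamma ((\<kappa> + real d) / 2) > 0" "Gamma ((\<kappa> + 1) / 2) > 0"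
    using assms by (auto intro!: Gamma_real_pos)
  then show ?thesis by (simp add: sphere_const_def)
qed

lemma nn_integral_pospow_gaussian:
  assumes "\<kappa> > - 1" and "c > 0"
  shows "(\<integral>\<^sup>+s. ennreal (pospow \<kappa> (c * s) * exp (- s\<^sup>2)) \<partial>lborel) = ennreal (c powr \<kappa> * (Gamma ((\<kappa> + 1) / 2) / 2))"
proof -
  have "(\<integral>\<^sup>+s. ennreal (pospow \<kappa> (c * s) * exp (- s\<^sup>2)) \<partial>lborel)
     = (\<integral>\<^sup>+s. ennreal (c powr \<kappa>) * (indicator {0<..} s * ennreal (s powr \<kappa> * exp (- s\<^sup>2))) \<partial>lborel)"
    by (rule nn_integral_cong, subst pospow_mult[OF assms(2)]) (auto simp: pospow_def split: split_indicator simp flip: ennreal_mult)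
  also have "\<dots> = ennreal (c powr \<kappa>) * ennreal (Gamma ((\<kappa> + 1) / 2) / 2)"
    using assms by (subst nn_integral_cmult) (auto simp: nn_integral_powr_gaussian)
  also have "\<dots> = ennreal (c powr \<kappa> * (Gamma ((\<kappa> + 1) / 2) / 2))"
    using assms by (intro ennreal_mult[symmetric] divide_nonneg_pos less_imp_le[OF Gamma_real_pos]) auto
  finally show ?thesis .
qed

text \<open>One Gaussian integral is computed twice. Polar coordinates give the integral over the
  sphere times \<open>A\<close>, a radial Gamma integral; slicing orthogonally to \<open>q\<close>
  gives \<open>B\<close>, an integral along \<open>q\<close>, times the Gaussian integral of a
  hyperplane. The quotient is the constant.\<close>

lemma nn_integral_sphere_pospow:
  fixes q :: "'a::euclidean_space"
  assumes \<kappa>: "\<kappa> > - 1" and q: "q \<noteq> 0"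
  shows "(\<integral>\<^sup>+y. ennreal (sphere_weight y) * ennreal (pospow \<kappa> (q \<bullet> sgn y)) \<partial>lborel) = ennreal (norm q powr \<kappa> * sphere_const \<kappa> DIM('a))"
    (is "?S = _")
proof -
  let ?d = "DIM('a)"
  have d: "real ?d \<ge> 1" using DIM_positive[where 'a='a] by linarith
  define A where "A = Gamma ((\<kappa> + real ?d) / 2) / 2"
  have A: "A > 0" unfolding A_def using \<kappa> d by (intro divide_pos_pos Gamma_real_pos) linarith+
  define B where "B = norm q powr \<kappa> * (Gamma ((\<kappa> + 1) / 2) / 2)"
  have B: "B \<ge> 0" unfolding B_def using \<kappa> by (intro mult_nonneg_nonneg divide_nonneg_pos less_imp_le[OF Gamma_real_pos]) auto
  define g where "g x = ennreal (pospow \<kappa> (q \<bullet> x) * exp (- (norm x)\<^sup>2))" for x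
  have [measurable]: "g \<in> borel_measurable borel" unfolding g_def[abs_def] by measurable
  have "(\<integral>\<^sup>+x. g x \<partial>lborel) = (\<integral>\<^sup>+y. ennreal (sphere_weight y) * (\<integral>\<^sup>+r. indicator {0<..} r * ennreal (r ^ (?d - 1)) * g (r *\<^sub>R sgn y) \<partial>lborel) \<partial>lborel)"
    by (rule nn_integral_polar) measurable
  also have "\<dots> = (\<integral>\<^sup>+y. ennreal (sphere_weight y) * ennreal (pospow \<kappa> (q \<bullet> sgn y)) * ennreal A \<partial>lborel)"
  proof (rule nn_integral_cong_AE)
    show "AE y in lborel. ennreal (sphere_weight y) * (\<integral>\<^sup>+r. indicator {0<..} r * ennreal (r ^ (?d - 1)) * g (r *\<^sub>R sgn y) \<partial>lborel)
       = ennreal (sphere_weight y) * ennreal (pospow \<kappa> (q \<bullet> sgn y)) * ennreal A"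
      using AE_lborel_singleton[of "0::'a"]
    proof eventually_elim
      case (elim y)
      have "(\<integral>\<^sup>+r. indicator {0<..} r * ennreal (r ^ (?d - 1)) * g (r *\<^sub>R sgn y) \<partial>lborel)
         = (\<integral>\<^sup>+r. ennreal (pospow \<kappa> (q \<bullet> sgn y)) * (indicator {0<..} r * ennreal (r powr (\<kappa> + real ?d - 1) * exp (- r\<^sup>2))) \<partial>lborel)"
      proof (rule nn_integral_cong)
        fix r :: real
        show "indicator {0<..} r * ennreal (r ^ (?d - 1)) * g (r *\<^sub>R sgn y) = ennreal (pospow \<kappa> (q \<bullet> sgn y)) * (indicator {0<..} r * ennreal (r powr (\<kappa> + real ?d - 1) * exp (- r\<^sup>2)))"
        proof (cases "r > 0")
          case True
          have "r ^ (?d - 1) = r powr (real ?d - 1)"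
            using True d by (subst powr_realpow[symmetric]) (auto simp: of_nat_diff)
          then have "r ^ (?d - 1) * r powr \<kappa> = r powr (\<kappa> + real ?d - 1)"
            by (simp add: powr_add[symmetric] algebra_simps)
          then have "r ^ (?d - 1) * (pospow \<kappa> (q \<bullet> (r *\<^sub>R sgn y)) * exp (- (norm (r *\<^sub>R sgn y))\<^sup>2)) = pospow \<kappa> (q \<bullet> sgn y) * (r powr (\<kappa> + real ?d - 1) * exp (- r\<^sup>2))"
            using True elim by (simp add: pospow_mult norm_sgn mult_ac)
          then show ?thesis using True by (simp add: g_def flip: ennreal_mult)
        qed simp
      qed
      also have "\<dots> = ennreal (pospow \<kappa> (q \<bullet> sgn y)) * ennreal A"
      proof -
        have "\<kappa> + real ?d - 1 > - 1" using \<kappa> d by linarith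
        from nn_integral_powr_gaussian[OF this] show ?thesis
          by (subst nn_integral_cmult) (auto simp: A_def)
      qed
      finally show ?case by (simp add: mult.assoc)
    qed
  qed
  also have "\<dots> = ?S * ennreal A"
    by (rule nn_integral_multc) measurable
  finally have 1: "(\<integral>\<^sup>+x. g x \<partial>lborel) = ?S * ennreal A" .
  have n: "norm (sgn q) = 1" using q by (simp add: norm_sgn)
  have qs: "q = norm q *\<^sub>R sgn q" using q by (simp add: sgn_div_norm)
  have "(\<integral>\<^sup>+x. g x \<partial>lborel) = (\<integral>\<^sup>+s. (\<integral>\<^sup>+x. ennreal (slab (x \<bullet> sgn q)) * g (x + (s - x \<bullet> sgn q) *\<^sub>R sgn q) \<partial>lborel) \<partial>lborel)"
    by (rule nn_integral_hyperplane[symmetric]) (use n in auto)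
  also have "\<dots> = (\<integral>\<^sup>+s. (\<integral>\<^sup>+x. ennreal (pospow \<kappa> (norm q * s) * exp (- s\<^sup>2)) * (ennreal (slab (x \<bullet> sgn q)) * ennreal (exp (- (norm (x - (x \<bullet> sgn q) *\<^sub>R sgn q))\<^sup>2))) \<partial>lborel) \<partial>lborel)"
  proof (intro nn_integral_cong)
    fix s :: real and x :: 'a
    have "q \<bullet> (x + (s - x \<bullet> sgn q) *\<^sub>R sgn q) = norm q * ((x + (s - x \<bullet> sgn q) *\<^sub>R sgn q) \<bullet> sgn q)"
      by (subst (1) qs) (simp add: inner_commute)
    also have "\<dots> = norm q * s" by (simp only: norm_hyperplane_decomp[OF n])
    finally have "g (x + (s - x \<bullet> sgn q) *\<^sub>R sgn q) = ennreal (pospow \<kappa> (norm q * s) * exp (- (s\<^sup>2 + (norm (x - (x \<bullet> sgn q) *\<^sub>R sgn q))\<^sup>2)))"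
      unfolding g_def norm_hyperplane_decomp(1)[OF n] by simp
    also have "\<dots> = ennreal (pospow \<kappa> (norm q * s) * exp (- s\<^sup>2)) * ennreal (exp (- (norm (x - (x \<bullet> sgn q) *\<^sub>R sgn q))\<^sup>2))"
      by (subst ennreal_mult[symmetric]) (auto simp: mult_exp_exp mult.assoc)
    finally show "ennreal (slab (x \<bullet> sgn q)) * g (x + (s - x \<bullet> sgn q) *\<^sub>R sgn q) = ennreal (pospow \<kappa> (norm q * s) * exp (- s\<^sup>2)) * (ennreal (slab (x \<bullet> sgn q)) * ennreal (exp (- (norm (x - (x \<bullet> sgn q) *\<^sub>R sgn q))\<^sup>2)))"
      by (simp only: mult_ac)
  qed
  also have "\<dots> = (\<integral>\<^sup>+s. ennreal (pospow \<kappa> (norm q * s) * exp (- s\<^sup>2)) \<partial>lborel) * ennreal (sqrt pi ^ (?d - 1))"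
    by (subst nn_integral_multc[symmetric], measurable, intro nn_integral_cong, subst nn_integral_cmult, measurable)
       (simp only: nn_integral_hyperplane_gaussian[OF n])
  also have "(\<integral>\<^sup>+s. ennreal (pospow \<kappa> (norm q * s) * exp (- s\<^sup>2)) \<partial>lborel) = ennreal B"
    unfolding B_def by (rule nn_integral_pospow_gaussian) (use \<kappa> q in auto)
  finally have "?S * ennreal A = ennreal B * ennreal (sqrt pi ^ (?d - 1))"
    using 1 by simp
  then have "?S * ennreal A * ennreal (inverse A) = ennreal (B * sqrt pi ^ (?d - 1) * inverse A)"
    using A B by (simp add: ennreal_mult)
  also have "?S * ennreal A * ennreal (inverse A) = ?S"
    using A by (simp add: mult.assoc flip: ennreal_mult)
  also have "B * sqrt pi ^ (?d - 1) * inverse A = norm q powr \<kappa> * sphere_const \<kappa> ?d"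
    by (simp add: A_def B_def sphere_const_def field_simps)
  finally show ?thesis .
qed

text \<open>In polar coordinates \<open>\<xi> = r *\<^sub>R n\<close> the integrals over \<open>r\<close> and over the hyperplanes orthogonal to \<open>n\<close>
  combine to the integral of \<open>pospow \<kappa> (q \<bullet> n) * f q\<close> over all \<open>q\<close>.\<close>

lemma nn_integral_hyperplanes_radial:
  fixes f :: "'a::euclidean_space \<Rightarrow> ennreal"
  assumes [measurable]: "f \<in> borel_measurable borel" and \<kappa>: "\<kappa> > - 1"
  shows "(\<integral>\<^sup>+\<xi>. ennreal (norm \<xi> powr (\<kappa> - real DIM('a) + 1)) *
      (\<integral>\<^sup>+x. ennreal (slab (x \<bullet> sgn \<xi>)) * f (\<xi> + (x - (x \<bullet> sgn \<xi>) *\<^sub>R sgn \<xi>)) \<partial>lborel) \<partial>lborel)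
    = ennreal (sphere_const \<kappa> DIM('a)) * (\<integral>\<^sup>+q. ennreal (norm q powr \<kappa>) * f q \<partial>lborel)"
proof -
  let ?d = "DIM('a)"
  have d: "real ?d \<ge> 1" using DIM_positive[where 'a='a] by linarith
  define h where "h \<xi> = ennreal (norm \<xi> powr (\<kappa> - real ?d + 1)) *
      (\<integral>\<^sup>+x. ennreal (slab (x \<bullet> sgn \<xi>)) * f (\<xi> + (x - (x \<bullet> sgn \<xi>) *\<^sub>R sgn \<xi>)) \<partial>lborel)" for \<xi>
  have [measurable]: "h \<in> borel_measurable borel" unfolding h_def[abs_def] by measurable
  have "(\<integral>\<^sup>+\<xi>. h \<xi> \<partial>lborel) = (\<integral>\<^sup>+y. ennreal (sphere_weight y) * (\<integral>\<^sup>+r. indicator {0<..} r * ennreal (r ^ (?d - 1)) * h (r *\<^sub>R sgn y) \<partial>lborel) \<partial>lborel)"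
    by (rule nn_integral_polar) measurable
  also have "\<dots> = (\<integral>\<^sup>+y. (\<integral>\<^sup>+q. ennreal (sphere_weight y) * (ennreal (pospow \<kappa> (q \<bullet> sgn y)) * f q) \<partial>lborel) \<partial>lborel)"
  proof (rule nn_integral_cong_AE)
    show "AE y in lborel. ennreal (sphere_weight y) * (\<integral>\<^sup>+r. indicator {0<..} r * ennreal (r ^ (?d - 1)) * h (r *\<^sub>R sgn y) \<partial>lborel)
      = (\<integral>\<^sup>+q. ennreal (sphere_weight y) * (ennreal (pospow \<kappa> (q \<bullet> sgn y)) * f q) \<partial>lborel)"
      using AE_lborel_singleton[of "0::'a"]
    proof eventually_elim
      case (elim y)
      define n where "n = sgn y"
      have n: "norm n = 1" using elim by (simp add: n_def norm_sgn)
      have "(\<integral>\<^sup>+r. indicator {0<..} r * ennreal (r ^ (?d - 1)) * h (r *\<^sub>R n) \<partial>lborel)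
         = (\<integral>\<^sup>+r. (\<integral>\<^sup>+x. ennreal (slab (x \<bullet> n)) * (ennreal (pospow \<kappa> ((x + (r - x \<bullet> n) *\<^sub>R n) \<bullet> n)) * f (x + (r - x \<bullet> n) *\<^sub>R n)) \<partial>lborel) \<partial>lborel)"
      proof (rule nn_integral_cong)
        fix r :: real
        show "indicator {0<..} r * ennreal (r ^ (?d - 1)) * h (r *\<^sub>R n)
           = (\<integral>\<^sup>+x. ennreal (slab (x \<bullet> n)) * (ennreal (pospow \<kappa> ((x + (r - x \<bullet> n) *\<^sub>R n) \<bullet> n)) * f (x + (r - x \<bullet> n) *\<^sub>R n)) \<partial>lborel)"
        proof (cases "r > 0")
          case True
          have sg: "sgn (r *\<^sub>R n) = n" using True n by (simp add: sgn_div_norm)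
          have nr: "norm (r *\<^sub>R n) = r" using True n by simp
          \<comment> \<open>The exponent d - 1 of the Jacobian of polar coordinates and the exponent
            \<kappa> - d + 1 of the weight add up to \<kappa>.\<close>
          have rr: "r ^ (?d - 1) * r powr (\<kappa> - real ?d + 1) = pospow \<kappa> r"
          proof -
            have "r ^ (?d - 1) = r powr (real ?d - 1)"
              using True d by (subst powr_realpow[symmetric]) (auto simp: of_nat_diff)
            then show ?thesis using True by (simp add: pospow_def powr_add[symmetric])
          qed
          have "indicator {0<..} r * ennreal (r ^ (?d - 1)) * h (r *\<^sub>R n)
            = ennreal (r ^ (?d - 1) * r powr (\<kappa> - real ?d + 1)) * (\<integral>\<^sup>+x. ennreal (slab (x \<bullet> n)) * f (r *\<^sub>R n + (x - (x \<bullet> n) *\<^sub>R n)) \<partial>lborel)"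
            unfolding h_def sg nr using True by (simp add: ennreal_mult mult.assoc)
          also have "\<dots> = (\<integral>\<^sup>+x. ennreal (pospow \<kappa> r) * (ennreal (slab (x \<bullet> n)) * f (r *\<^sub>R n + (x - (x \<bullet> n) *\<^sub>R n))) \<partial>lborel)"
            unfolding rr by (rule nn_integral_cmult[symmetric]) measurable
          also have "\<dots> = (\<integral>\<^sup>+x. ennreal (slab (x \<bullet> n)) * (ennreal (pospow \<kappa> ((x + (r - x \<bullet> n) *\<^sub>R n) \<bullet> n)) * f (x + (r - x \<bullet> n) *\<^sub>R n)) \<partial>lborel)"
          proof (rule nn_integral_cong)
            fix x
            have e: "r *\<^sub>R n + (x - (x \<bullet> n) *\<^sub>R n) = x + (r - x \<bullet> n) *\<^sub>R n" by (simp add: scaleR_diff_left)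
            show "ennreal (pospow \<kappa> r) * (ennreal (slab (x \<bullet> n)) * f (r *\<^sub>R n + (x - (x \<bullet> n) *\<^sub>R n))) = ennreal (slab (x \<bullet> n)) * (ennreal (pospow \<kappa> ((x + (r - x \<bullet> n) *\<^sub>R n) \<bullet> n)) * f (x + (r - x \<bullet> n) *\<^sub>R n))"
              unfolding norm_hyperplane_decomp(2)[OF n] e by (rule mult.left_commute)
          qed
          finally show ?thesis .
        next
          case False
          then show ?thesis unfolding norm_hyperplane_decomp(2)[OF n] by (simp add: pospow_def)
        qed
      qed
      also have "\<dots> = (\<integral>\<^sup>+q. ennreal (pospow \<kappa> (q \<bullet> n)) * f q \<partial>lborel)"
        by (rule nn_integral_hyperplane[where g="\<lambda>q. ennreal (pospow \<kappa> (q \<bullet> n)) * f q"]) (use n in auto)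
      finally show ?case
        by (simp add: n_def nn_integral_cmult)
    qed
  qed
  \<comment> \<open>With \<open>q\<close> fixed only the directions remain, and their integral is
    the one of \<open>nn_integral_sphere_pospow\<close>.\<close>
  also have "\<dots> = (\<integral>\<^sup>+q. (\<integral>\<^sup>+y. ennreal (sphere_weight y) * (ennreal (pospow \<kappa> (q \<bullet> sgn y)) * f q) \<partial>lborel) \<partial>lborel)"
    by (subst lborel_pair.Fubini') simp_all
  also have "\<dots> = (\<integral>\<^sup>+q. ennreal (sphere_const \<kappa> ?d) * (ennreal (norm q powr \<kappa>) * f q) \<partial>lborel)"
  proof (rule nn_integral_cong_AE)
    show "AE q in lborel. (\<integral>\<^sup>+y. ennreal (sphere_weight y) * (ennreal (pospow \<kappa> (q \<bullet> sgn y)) * f q) \<partial>lborel) = ennreal (sphere_const \<kappa> ?d) * (ennreal (norm q powr \<kappa>) * f q)"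
      using AE_lborel_singleton[of "0::'a"]
    proof eventually_elim
      case (elim q)
      have "(\<integral>\<^sup>+y. ennreal (sphere_weight y) * (ennreal (pospow \<kappa> (q \<bullet> sgn y)) * f q) \<partial>lborel)
         = (\<integral>\<^sup>+y. (ennreal (sphere_weight y) * ennreal (pospow \<kappa> (q \<bullet> sgn y))) * f q \<partial>lborel)"
        by (simp add: mult.assoc)
      also have "\<dots> = ennreal (norm q powr \<kappa> * sphere_const \<kappa> ?d) * f q"
        by (subst nn_integral_multc) (simp_all add: nn_integral_sphere_pospow[OF \<kappa> elim])
      finally show ?case by (simp only: ennreal_mult'[OF sphere_const_nonneg[OF \<kappa> DIM_positive]] mult_ac)
    qed
  qed
  also have "\<dots> = ennreal (sphere_const \<kappa> ?d) * (\<integral>\<^sup>+q. ennreal (norm q powr \<kappa>) * f q \<partial>lborel)"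
    by (rule nn_integral_cmult) measurable
  finally show ?thesis unfolding h_def .
qed

subsection \<open>Disintegrations and oscillatory integrals\<close>

text \<open>Lebesgue measure on the domain of \<open>\<pi>\<close> is fibred over the values of \<open>\<pi>\<close>: \<open>\<Phi> (y, -)\<close> parametrises
  the fibre over \<open>y\<close>, with density \<open>\<delta>\<close>.\<close>

locale disintegration =
  fixes \<delta> :: "'y::euclidean_space \<times> 'x::euclidean_space \<Rightarrow> real"
    and \<Phi> :: "'y \<times> 'x \<Rightarrow> 'z::euclidean_space"
    and \<pi> :: "'z \<Rightarrow> 'y"
  assumes \<delta>_measurable [measurable]: "\<delta> \<in> borel_measurable (borel \<Otimes>\<^sub>M borel)"
    and \<Phi>_measurable [measurable]: "\<Phi> \<in> (borel \<Otimes>\<^sub>M borel) \<rightarrow>\<^sub>M borel"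
    and \<pi>_measurable [measurable]: "\<pi> \<in> borel \<rightarrow>\<^sub>M borel"
    and \<delta>_nonneg: "\<And>p. \<delta> p \<ge> 0"
    and \<pi>_\<Phi>: "\<And>y x. \<delta> (y, x) \<noteq> 0 \<Longrightarrow> \<pi> (\<Phi> (y, x)) = y"
    and nn_integral_fibres: "\<And>\<Psi>. \<Psi> \<in> borel_measurable borel \<Longrightarrow>
      (\<integral>\<^sup>+z. \<Psi> z \<partial>lborel) = (\<integral>\<^sup>+y. (\<integral>\<^sup>+x. ennreal (\<delta> (y, x)) * \<Psi> (\<Phi> (y, x)) \<partial>lborel) \<partial>lborel)"
begin

text \<open>The assumption \<open>nn_integral_fibres\<close> concerns nonnegative integrands. As an
  identity of measures it carries over to integrability and to integrals of complex
  functions.\<close>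

lemma lborel_eq_distr: "lborel = distr (density (lborel \<Otimes>\<^sub>M lborel) (\<lambda>p. ennreal (\<delta> p))) borel \<Phi>"
proof (rule measure_eqI)
  fix A :: "'z set" assume "A \<in> sets lborel"
  then have [measurable]: "A \<in> sets borel" by simp
  have "emeasure lborel A = (\<integral>\<^sup>+z. indicator A z \<partial>lborel)" by simp
  also have "\<dots> = (\<integral>\<^sup>+y. (\<integral>\<^sup>+x. ennreal (\<delta> (y, x)) * indicator A (\<Phi> (y, x)) \<partial>lborel) \<partial>lborel)"
    by (rule nn_integral_fibres) measurable
  also have "\<dots> = (\<integral>\<^sup>+p. ennreal (\<delta> p) * indicator A (\<Phi> p) \<partial>(lborel \<Otimes>\<^sub>M lborel))"
    by (rule lborel.nn_integral_fst[where f="\<lambda>p. ennreal (\<delta> p) * indicator A (\<Phi> p)"]) simp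
  also have "\<dots> = (\<integral>\<^sup>+z. indicator A z \<partial>distr (density (lborel \<Otimes>\<^sub>M lborel) (\<lambda>p. ennreal (\<delta> p))) borel \<Phi>)"
    by (simp add: nn_integral_distr nn_integral_density del: nn_integral_indicator)
  finally show "emeasure lborel A = emeasure (distr (density (lborel \<Otimes>\<^sub>M lborel) (\<lambda>p. ennreal (\<delta> p))) borel \<Phi>) A" by simp
qed simp

definition fibre_integral :: "('z \<Rightarrow> complex) \<Rightarrow> 'y \<Rightarrow> complex" where
  "fibre_integral f y = (\<integral>x. \<delta> (y, x) *\<^sub>R f (\<Phi> (y, x)) \<partial>lborel)"

lemma integrable_fibre_pair:
  assumes f: "integrable lborel f"
  shows "integrable (lborel \<Otimes>\<^sub>M lborel) (\<lambda>p. \<delta> p *\<^sub>R (f (\<Phi> p) :: complex))"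
proof -
  have [measurable]: "f \<in> borel_measurable borel" using borel_measurable_integrable[OF f] by simp
  have "integrable (distr (density (lborel \<Otimes>\<^sub>M lborel) (\<lambda>p. ennreal (\<delta> p))) borel \<Phi>) f"
    using f by (subst (asm) lborel_eq_distr)
  then have "integrable (density (lborel \<Otimes>\<^sub>M lborel) (\<lambda>p. ennreal (\<delta> p))) (\<lambda>p. f (\<Phi> p))"
    by (subst (asm) integrable_distr_eq) auto
  then show ?thesis
    by (subst (asm) integrable_density) (auto simp: \<delta>_nonneg)
qed

lemma borel_measurable_fibre_integral [measurable]:
  assumes [measurable]: "f \<in> borel_measurable borel"
  shows "fibre_integral f \<in> borel_measurable borel"
  unfolding fibre_integral_def[abs_def] by measurable

lemma integrable_fibre_integral:
  assumes f: "integrable lborel f"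
  shows "integrable lborel (fibre_integral f)"
  unfolding fibre_integral_def[abs_def]
  using lborel_pair.integrable_fst'[OF integrable_fibre_pair[OF f]] .

lemma integral_eq_fibre_integral:
  assumes f: "integrable lborel f"
  shows "(\<integral>z. f z \<partial>lborel) = (\<integral>y. fibre_integral f y \<partial>lborel)"
proof -
  have [measurable]: "f \<in> borel_measurable borel" using borel_measurable_integrable[OF f] by simp
  have "(\<integral>z. f z \<partial>lborel) = (\<integral>p. \<delta> p *\<^sub>R f (\<Phi> p) \<partial>(lborel \<Otimes>\<^sub>M lborel))"
    by (subst lborel_eq_distr) (simp add: integral_distr integral_density \<delta>_nonneg)
  also have "\<dots> = (\<integral>y. fibre_integral f y \<partial>lborel)"
    unfolding fibre_integral_def by (rule lborel_pair.integral_fst'[symmetric, OF integrable_fibre_pair[OF f]])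
  finally show ?thesis .
qed

text \<open>The phase depends on \<open>\<pi> z\<close> only and is therefore constant on each
  fibre.\<close>

lemma osc_integral_fibre:
  assumes f: "integrable lborel f"
  shows "(\<integral>z. f z * cis (p \<bullet> \<pi> z) \<partial>lborel) = osc_integral (fibre_integral f) p"
proof -
  have "(\<integral>z. f z * cis (p \<bullet> \<pi> z) \<partial>lborel) = (\<integral>y. fibre_integral (\<lambda>z. f z * cis (p \<bullet> \<pi> z)) y \<partial>lborel)"
    by (intro integral_eq_fibre_integral integrable_mult_cis f) simp
  also have "\<dots> = osc_integral (fibre_integral f) p"
    unfolding osc_integral_def
  proof (rule Bochner_Integration.integral_cong[OF refl])
    fix y
    \<comment> \<open>Where the density vanishes, \<open>\<Phi>\<close> need not land in the fibre,
      so \<open>\<pi>_\<Phi>\<close> is available only for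
      \<open>\<delta> (y, x) \<noteq> 0\<close>.\<close>
    have "\<delta> (y, x) *\<^sub>R (f (\<Phi> (y, x)) * cis (p \<bullet> \<pi> (\<Phi> (y, x)))) = \<delta> (y, x) *\<^sub>R f (\<Phi> (y, x)) * cis (p \<bullet> y)" for x
      using \<pi>_\<Phi>[of y x] by (cases "\<delta> (y, x) = 0") auto
    then show "fibre_integral (\<lambda>z. f z * cis (p \<bullet> \<pi> z)) y = fibre_integral f y * cis (p \<bullet> y)"
      unfolding fibre_integral_def integral_mult_left_zero[symmetric]
      by (rule Bochner_Integration.integral_cong[OF refl])
  qed
  finally show ?thesis .
qed

end

section \<open>Fibrations of the pairs of frequencies over the output frequency\<close>

lemma nn_integral_lborel_pair:
  fixes f :: "'a::euclidean_space \<times> 'b::euclidean_space \<Rightarrow> ennreal"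
  assumes "f \<in> borel_measurable borel"
  shows "(\<integral>\<^sup>+z. f z \<partial>lborel) = (\<integral>\<^sup>+x. (\<integral>\<^sup>+y. f (x, y) \<partial>lborel) \<partial>lborel)"
    and "(\<integral>\<^sup>+z. f z \<partial>lborel) = (\<integral>\<^sup>+y. (\<integral>\<^sup>+x. f (x, y) \<partial>lborel) \<partial>lborel)"
proof -
  have m: "f \<in> borel_measurable (lborel \<Otimes>\<^sub>M lborel)" using assms by (simp add: lborel_prod)
  show "(\<integral>\<^sup>+z. f z \<partial>lborel) = (\<integral>\<^sup>+x. (\<integral>\<^sup>+y. f (x, y) \<partial>lborel) \<partial>lborel)"
    using lborel.nn_integral_fst[OF m] by (simp add: lborel_prod)
  show "(\<integral>\<^sup>+z. f z \<partial>lborel) = (\<integral>\<^sup>+y. (\<integral>\<^sup>+x. f (x, y) \<partial>lborel) \<partial>lborel)"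
    using lborel_pair.nn_integral_snd[OF m] by (simp add: lborel_prod)
qed

text \<open>At a fixed time the frequencies of \<open>u * cnj v\<close> are the differences \<zeta>
  - \<eta>; this fibration serves the spatial multiplier in
  \<open>frac_laplacian_eq\<close>.\<close>

lemma disintegration_shear:
  "disintegration (\<lambda>_. 1) (\<lambda>(\<xi>, \<eta>). (\<xi> + \<eta>, \<eta>)) (\<lambda>(\<zeta>, \<eta>). \<zeta> - \<eta> :: 'a::euclidean_space)"
proof
  fix \<Psi> :: "'a \<times> 'a \<Rightarrow> ennreal" assume \<Psi> [measurable]: "\<Psi> \<in> borel_measurable borel"
  have [measurable]: "\<Psi> \<in> borel_measurable (borel \<Otimes>\<^sub>M borel)" using \<Psi> by (simp add: borel_prod)
  have "(\<integral>\<^sup>+z. \<Psi> z \<partial>lborel) = (\<integral>\<^sup>+\<eta>. (\<integral>\<^sup>+\<zeta>. \<Psi> (\<zeta>, \<eta>) \<partial>lborel) \<partial>lborel)"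
    by (rule nn_integral_lborel_pair(2)[OF \<Psi>])
  also have "\<dots> = (\<integral>\<^sup>+\<eta>. (\<integral>\<^sup>+\<xi>. \<Psi> (\<xi> + \<eta>, \<eta>) \<partial>lborel) \<partial>lborel)"
    by (intro nn_integral_cong nn_integral_lborel_translate[symmetric]) simp
  also have "\<dots> = (\<integral>\<^sup>+\<xi>. (\<integral>\<^sup>+\<eta>. \<Psi> (\<xi> + \<eta>, \<eta>) \<partial>lborel) \<partial>lborel)"
    by (subst lborel_pair.Fubini') simp_all
  finally show "(\<integral>\<^sup>+z. \<Psi> z \<partial>lborel) = (\<integral>\<^sup>+\<xi>. (\<integral>\<^sup>+\<eta>. ennreal 1 * \<Psi> (case (\<xi>, \<eta>) of (\<xi>, \<eta>) \<Rightarrow> (\<xi> + \<eta>, \<eta>)) \<partial>lborel) \<partial>lborel)"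
    by simp
qed (auto simp: borel_prod[symmetric])

text \<open>The space-time frequency of \<open>u * cnj v\<close> produced by the frequencies \<open>\<zeta>\<close> of \<open>u\<close> and \<open>\<eta>\<close> of \<open>v\<close> is
  \<open>hyp_proj (\<zeta>, \<eta>)\<close>. The fibre over \<open>(\<tau>, \<xi>)\<close> is parametrised by \<open>\<eta>\<close>, which runs through the hyperplane
  \<open>{\<eta>. 2 * (\<xi> \<bullet> \<eta>) = - \<tau> - \<bar>\<xi>\<bar>\<^sup>2}\<close>. For \<open>\<xi> = 0\<close> the density vanishes, since \<open>x / 0 = 0\<close>.\<close>

definition hyp_point :: "real \<times> 'a::euclidean_space \<Rightarrow> 'a \<Rightarrow> 'a" where
  "hyp_point y x = x + (- (fst y + (norm (snd y))\<^sup>2) / (2 * norm (snd y)) - x \<bullet> sgn (snd y)) *\<^sub>R sgn (snd y)"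

definition hyp_param :: "(real \<times> 'a::euclidean_space) \<times> 'a \<Rightarrow> 'a \<times> 'a" where
  "hyp_param p = (snd (fst p) + hyp_point (fst p) (snd p), hyp_point (fst p) (snd p))"

definition hyp_density :: "(real \<times> 'a::euclidean_space) \<times> 'a \<Rightarrow> real" where
  "hyp_density p = slab (snd p \<bullet> sgn (snd (fst p))) / (2 * norm (snd (fst p)))"

definition hyp_proj :: "'a::euclidean_space \<times> 'a \<Rightarrow> real \<times> 'a" where
  "hyp_proj z = ((norm (snd z))\<^sup>2 - (norm (fst z))\<^sup>2, fst z - snd z)"

lemma measurable_fst_snd_borel [measurable]:
  "(fst :: 'a::euclidean_space \<times> 'b::euclidean_space \<Rightarrow> 'a) \<in> borel_measurable borel"
  "(snd :: 'a::euclidean_space \<times> 'b::euclidean_space \<Rightarrow> 'b) \<in> borel_measurable borel"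
  by (simp_all add: borel_prod[symmetric])

lemma hyp_proj_param:
  assumes \<xi>: "\<xi> \<noteq> 0"
  shows "hyp_proj (hyp_param ((\<tau>, \<xi>), x)) = (\<tau>, \<xi>)"
proof -
  define s where "s = - (\<tau> + (norm \<xi>)\<^sup>2) / (2 * norm \<xi>)"
  define \<eta> where "\<eta> = hyp_point (\<tau>, \<xi>) x"
  have "\<eta> \<bullet> sgn \<xi> = s"
    unfolding \<eta>_def hyp_point_def s_def fst_conv snd_conv
    by (rule norm_hyperplane_decomp(2)) (use \<xi> in \<open>simp add: norm_sgn\<close>)
  then have "\<xi> \<bullet> \<eta> = norm \<xi> * s"
    using \<xi> by (simp add: sgn_div_norm inner_commute field_simps)
  then have "2 * (\<xi> \<bullet> \<eta>) = - (\<tau> + (norm \<xi>)\<^sup>2)" using \<xi> by (simp add: s_def)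
  moreover have "(norm (\<xi> + \<eta>))\<^sup>2 = (norm \<xi>)\<^sup>2 + 2 * (\<xi> \<bullet> \<eta>) + (norm \<eta>)\<^sup>2"
    unfolding power2_norm_eq_inner by (simp add: inner_add_left inner_add_right inner_commute)
  ultimately show ?thesis
    by (simp add: hyp_proj_def hyp_param_def flip: \<eta>_def)
qed

text \<open>For fixed \<xi> the space of \<eta> is cut into the hyperplanes \<eta> \<bullet> sgn
  \<xi> = s by \<open>nn_integral_hyperplane\<close>, and s is an affine function of \<tau> with
  slope - 1 / (2 |\<xi>|), which gives the denominator in \<open>hyp_density\<close>. The
  exceptional \<xi> = 0 is a null set.\<close>

lemma disintegration_hyp:
  "disintegration hyp_density hyp_param (hyp_proj :: 'a::euclidean_space \<times> 'a \<Rightarrow> real \<times> 'a)"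
proof
  show 1 [measurable]: "hyp_density \<in> borel_measurable (borel \<Otimes>\<^sub>M (borel :: 'a measure))"
    unfolding hyp_density_def[abs_def] by measurable
  show 2 [measurable]: "hyp_param \<in> (borel \<Otimes>\<^sub>M (borel :: 'a measure)) \<rightarrow>\<^sub>M borel"
    unfolding hyp_param_def[abs_def] hyp_point_def[abs_def] borel_prod[symmetric, where 'a='a and 'b='a] by measurable
  show "(hyp_proj :: 'a \<times> 'a \<Rightarrow> real \<times> 'a) \<in> borel \<rightarrow>\<^sub>M borel"
    unfolding hyp_proj_def[abs_def] borel_prod[symmetric] by measurable
  show "hyp_density p \<ge> 0" for p :: "(real \<times> 'a) \<times> 'a"
    by (simp add: hyp_density_def)
  show "hyp_proj (hyp_param (y, x)) = y" if "hyp_density (y, x) \<noteq> 0" for y and x :: 'a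
    using that hyp_proj_param[of "snd y" "fst y" x] by (auto simp: hyp_density_def)
  fix \<Psi> :: "'a \<times> 'a \<Rightarrow> ennreal" assume \<Psi> [measurable]: "\<Psi> \<in> borel_measurable borel"
  have [measurable]: "\<Psi> \<in> borel_measurable (borel \<Otimes>\<^sub>M borel)" using \<Psi> by (simp add: borel_prod)
  interpret shear: disintegration "\<lambda>_. 1" "\<lambda>(\<xi>, \<eta>). (\<xi> + \<eta>, \<eta>)" "\<lambda>(\<zeta>, \<eta>). \<zeta> - \<eta> :: 'a"
    by (rule disintegration_shear)
  have "(\<integral>\<^sup>+z. \<Psi> z \<partial>lborel) = (\<integral>\<^sup>+\<xi>. (\<integral>\<^sup>+\<eta>. \<Psi> (\<xi> + \<eta>, \<eta>) \<partial>lborel) \<partial>lborel)"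
    using shear.nn_integral_fibres[OF \<Psi>] by simp
  also have "\<dots> = (\<integral>\<^sup>+\<xi>. (\<integral>\<^sup>+\<tau>. (\<integral>\<^sup>+x. ennreal (hyp_density ((\<tau>, \<xi>), x)) * \<Psi> (hyp_param ((\<tau>, \<xi>), x)) \<partial>lborel) \<partial>lborel) \<partial>lborel)"
  proof (rule nn_integral_cong_AE)
    show "AE \<xi> in lborel. (\<integral>\<^sup>+\<eta>. \<Psi> (\<xi> + \<eta>, \<eta>) \<partial>lborel) = (\<integral>\<^sup>+\<tau>. (\<integral>\<^sup>+x. ennreal (hyp_density ((\<tau>, \<xi>), x)) * \<Psi> (hyp_param ((\<tau>, \<xi>), x)) \<partial>lborel) \<partial>lborel)"
      using AE_lborel_singleton[of "0::'a"]
    proof eventually_elim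
      case (elim \<xi>)
      define g where "g \<eta> = \<Psi> (\<xi> + \<eta>, \<eta>)" for \<eta>
      have [measurable]: "g \<in> borel_measurable borel" unfolding g_def[abs_def] by measurable
      define n where "n = sgn \<xi>"
      have n: "norm n = 1" using elim by (simp add: n_def norm_sgn)
      define h where "h s = (\<integral>\<^sup>+x. ennreal (slab (x \<bullet> n)) * g (x + (s - x \<bullet> n) *\<^sub>R n) \<partial>lborel)" for s
      have [measurable]: "h \<in> borel_measurable borel" unfolding h_def[abs_def] by measurable
      define c where "c = 1 / (2 * norm \<xi>)"
      have c: "c > 0" using elim by (simp add: c_def)
      have "(\<integral>\<^sup>+\<eta>. g \<eta> \<partial>lborel) = (\<integral>\<^sup>+s. h s \<partial>lborel)"
        unfolding h_def by (rule nn_integral_hyperplane[symmetric]) (use n in auto)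
      also have "\<dots> = ennreal c * (\<integral>\<^sup>+\<tau>. h (- norm \<xi> / 2 + (- c) * \<tau>) \<partial>lborel)"
        using nn_integral_real_affine[of h "- c" "- norm \<xi> / 2"] c by simp
      also have "\<dots> = (\<integral>\<^sup>+\<tau>. ennreal c * h (- norm \<xi> / 2 + (- c) * \<tau>) \<partial>lborel)"
        by (rule nn_integral_cmult[symmetric]) measurable
      also have "\<dots> = (\<integral>\<^sup>+\<tau>. (\<integral>\<^sup>+x. ennreal (hyp_density ((\<tau>, \<xi>), x)) * \<Psi> (hyp_param ((\<tau>, \<xi>), x)) \<partial>lborel) \<partial>lborel)"
      proof (rule nn_integral_cong)
        fix \<tau> :: real
        define s where "s = - norm \<xi> / 2 + (- c) * \<tau>"
        have s: "s = - (\<tau> + (norm \<xi>)\<^sup>2) / (2 * norm \<xi>)"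
          using elim by (simp add: s_def c_def field_simps power2_eq_square)
        have "ennreal c * h s = (\<integral>\<^sup>+x. ennreal c * (ennreal (slab (x \<bullet> n)) * g (x + (s - x \<bullet> n) *\<^sub>R n)) \<partial>lborel)"
          unfolding h_def by (rule nn_integral_cmult[symmetric]) measurable
        also have "\<dots> = (\<integral>\<^sup>+x. ennreal (hyp_density ((\<tau>, \<xi>), x)) * \<Psi> (hyp_param ((\<tau>, \<xi>), x)) \<partial>lborel)"
        proof (rule nn_integral_cong)
          fix x
          have "ennreal (hyp_density ((\<tau>, \<xi>), x)) = ennreal c * ennreal (slab (x \<bullet> n))"
            using c by (simp add: hyp_density_def n_def c_def flip: ennreal_mult)
          moreover have "\<Psi> (hyp_param ((\<tau>, \<xi>), x)) = g (x + (s - x \<bullet> n) *\<^sub>R n)"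
            by (simp add: g_def hyp_param_def hyp_point_def n_def s)
          ultimately show "ennreal c * (ennreal (slab (x \<bullet> n)) * g (x + (s - x \<bullet> n) *\<^sub>R n)) = ennreal (hyp_density ((\<tau>, \<xi>), x)) * \<Psi> (hyp_param ((\<tau>, \<xi>), x))"
            by (simp add: mult.assoc)
        qed
        finally show "ennreal c * h (- norm \<xi> / 2 + (- c) * \<tau>) = (\<integral>\<^sup>+x. ennreal (hyp_density ((\<tau>, \<xi>), x)) * \<Psi> (hyp_param ((\<tau>, \<xi>), x)) \<partial>lborel)"
          unfolding s_def .
      qed
      finally show ?case by (simp add: g_def)
    qed
  qed
  also have "\<dots> = (\<integral>\<^sup>+y. (\<integral>\<^sup>+x. ennreal (hyp_density (y, x)) * \<Psi> (hyp_param (y, x)) \<partial>lborel) \<partial>lborel)"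
  proof (rule nn_integral_lborel_pair(2)[symmetric])
    have "(\<lambda>p. ennreal (hyp_density p) * \<Psi> (hyp_param p)) \<in> borel_measurable (borel \<Otimes>\<^sub>M lborel)"
      by simp
    from sigma_finite_measure.borel_measurable_nn_integral_fst[OF sigma_finite_lborel this]
    show "(\<lambda>y. \<integral>\<^sup>+x. ennreal (hyp_density (y, x)) * \<Psi> (hyp_param (y, x)) \<partial>lborel) \<in> borel_measurable borel" .
  qed
  finally show "(\<integral>\<^sup>+z. \<Psi> z \<partial>lborel) = (\<integral>\<^sup>+y. (\<integral>\<^sup>+x. ennreal (hyp_density (y, x)) * \<Psi> (hyp_param (y, x)) \<partial>lborel) \<partial>lborel)" .
qed

text \<open>Likewise \<open>sph_proj\<close> gives the space-time frequency of \<open>u * v\<close>. The fibre over \<open>(\<tau>, \<xi>)\<close> is the set of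
  pairs with \<open>\<zeta> + \<eta> = \<xi>\<close> and \<open>\<zeta> - \<eta>\<close> on the sphere of radius \<open>sqrt (- 2 * \<tau> - \<bar>\<xi>\<bar>\<^sup>2)\<close>; it is empty
  if this root is not positive.\<close>

definition sph_radius :: "real \<times> 'a::euclidean_space \<Rightarrow> real" where
  "sph_radius y = sqrt (- 2 * fst y - (norm (snd y))\<^sup>2)"

definition sph_param :: "(real \<times> 'a::euclidean_space) \<times> 'a \<Rightarrow> 'a \<times> 'a" where
  "sph_param p = ((1/2) *\<^sub>R (snd (fst p) + sph_radius (fst p) *\<^sub>R sgn (snd p)),
                  (1/2) *\<^sub>R (snd (fst p) - sph_radius (fst p) *\<^sub>R sgn (snd p)))"

text \<open>The Jacobian of the fibration apart from the sphere: passing from \<eta> to q = \<zeta>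
  - \<eta> gives 2^(-d), and r^(d-1) dr = r^(d-2) d(r^2) / 2, where d(r^2) = 2 d\<tau> in absolute
  value.\<close>

definition sph_factor :: "real \<times> 'a::euclidean_space \<Rightarrow> real" where
  "sph_factor y = indicator {0<..} (sph_radius y) * ((1/2) ^ DIM('a) * sph_radius y ^ (DIM('a) - 2))"

text \<open>Since \<open>sgn 0 = 0\<close> is not on the unit sphere, the point 0 is excluded; the
  fibre condition then holds wherever the density is not zero.\<close>

definition sph_density :: "(real \<times> 'a::euclidean_space) \<times> 'a \<Rightarrow> real" where
  "sph_density p = sph_factor (fst p) * (indicator (- {0}) (snd p) * sphere_weight (snd p))"

definition sph_proj :: "'a::euclidean_space \<times> 'a \<Rightarrow> real \<times> 'a" where
  "sph_proj z = (- ((norm (fst z))\<^sup>2 + (norm (snd z))\<^sup>2), fst z + snd z)"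

lemma borel_measurable_sph_radius [measurable]: "(sph_radius :: real \<times> 'a::euclidean_space \<Rightarrow> real) \<in> borel_measurable borel"
  unfolding sph_radius_def[abs_def] by measurable

lemma borel_measurable_sph_factor [measurable]: "(sph_factor :: real \<times> 'a::euclidean_space \<Rightarrow> real) \<in> borel_measurable borel"
  unfolding sph_factor_def[abs_def] by measurable

lemma sph_factor_nonneg [simp]: "sph_factor y \<ge> 0"
  by (auto simp: sph_factor_def split: split_indicator)

lemma sph_proj_param:
  assumes y: "sph_radius y > 0" and x: "x \<noteq> 0"
  shows "sph_proj (sph_param (y, x)) = y"
    and "norm (fst (sph_param (y, x)) - snd (sph_param (y, x))) = sph_radius y"
proof -
  define \<omega> where "\<omega> = sph_radius y *\<^sub>R sgn x"
  have \<omega>: "norm \<omega> = sph_radius y" using x y by (simp add: \<omega>_def norm_sgn)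
  have "norm (fst (sph_param (y, x)) - snd (sph_param (y, x))) = norm \<omega>"
    unfolding sph_param_def \<omega>_def by (simp flip: scaleR_diff_right)
  with \<omega> show "norm (fst (sph_param (y, x)) - snd (sph_param (y, x))) = sph_radius y" by simp
  have "(norm (snd y + \<omega>))\<^sup>2 + (norm (snd y - \<omega>))\<^sup>2 = 2 * (norm (snd y))\<^sup>2 + 2 * (norm \<omega>)\<^sup>2"
    unfolding power2_norm_eq_inner
    by (simp add: inner_add_left inner_add_right inner_diff_left inner_diff_right)
  moreover have h: "(norm ((1/2) *\<^sub>R v))\<^sup>2 = (norm v)\<^sup>2 / 4" for v :: 'a
    by (simp add: power_divide)
  ultimately have "(norm ((1/2) *\<^sub>R (snd y + \<omega>)))\<^sup>2 + (norm ((1/2) *\<^sub>R (snd y - \<omega>)))\<^sup>2 = ((norm (snd y))\<^sup>2 + (norm \<omega>)\<^sup>2) / 2"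
    unfolding h by simp
  also have "\<dots> = - fst y"
    using y unfolding \<omega> sph_radius_def by simp
  finally show "sph_proj (sph_param (y, x)) = y"
    unfolding sph_proj_def sph_param_def fst_conv snd_conv \<omega>_def[symmetric]
    by (simp add: prod_eq_iff flip: scaleR_add_right)
qed

text \<open>For fixed \<xi> put q = \<zeta> - \<eta>, so that \<eta> = (\<xi> - q) / 2, and use
  polar coordinates for q. The square t of the radius becomes the new variable, and t = - 2 \<tau> -
  |\<xi>|^2 trades it for \<tau>; the density is supported where t is positive.\<close>

lemma disintegration_sph:
  assumes d: "DIM('a::euclidean_space) \<ge> 2"
  shows "disintegration sph_density sph_param (sph_proj :: 'a \<times> 'a \<Rightarrow> real \<times> 'a)"
proof
  show 1 [measurable]: "sph_density \<in> borel_measurable (borel \<Otimes>\<^sub>M (borel :: 'a measure))"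
    unfolding sph_density_def[abs_def] by measurable
  show 2 [measurable]: "sph_param \<in> (borel \<Otimes>\<^sub>M (borel :: 'a measure)) \<rightarrow>\<^sub>M borel"
    unfolding sph_param_def[abs_def] borel_prod[symmetric, where 'a='a and 'b='a] by measurable
  show "(sph_proj :: 'a \<times> 'a \<Rightarrow> real \<times> 'a) \<in> borel \<rightarrow>\<^sub>M borel"
    unfolding sph_proj_def[abs_def] borel_prod[symmetric] by measurable
  show "sph_density p \<ge> 0" for p :: "(real \<times> 'a) \<times> 'a"
    by (simp add: sph_density_def)
  show "sph_proj (sph_param (y, x)) = y" if "sph_density (y, x) \<noteq> 0" for y and x :: 'a
    using that by (intro sph_proj_param) (auto simp: sph_density_def sph_factor_def split: split_indicator_asm)
  fix \<Psi> :: "'a \<times> 'a \<Rightarrow> ennreal" assume \<Psi> [measurable]: "\<Psi> \<in> borel_measurable borel"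
  have [measurable]: "\<Psi> \<in> borel_measurable (borel \<Otimes>\<^sub>M borel)" using \<Psi> by (simp add: borel_prod)
  have "(\<integral>\<^sup>+z. \<Psi> z \<partial>lborel) = (\<integral>\<^sup>+\<eta>. (\<integral>\<^sup>+\<zeta>. \<Psi> (\<zeta>, \<eta>) \<partial>lborel) \<partial>lborel)"
    by (rule nn_integral_lborel_pair(2)[OF \<Psi>])
  also have "\<dots> = (\<integral>\<^sup>+\<eta>. (\<integral>\<^sup>+\<xi>. \<Psi> (\<xi> + (- \<eta>), \<eta>) \<partial>lborel) \<partial>lborel)"
    by (intro nn_integral_cong nn_integral_lborel_translate[symmetric]) simp
  also have "\<dots> = (\<integral>\<^sup>+\<xi>. (\<integral>\<^sup>+\<eta>. \<Psi> (\<xi> + (- \<eta>), \<eta>) \<partial>lborel) \<partial>lborel)"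
    by (subst lborel_pair.Fubini') simp_all
  also have "\<dots> = (\<integral>\<^sup>+\<xi>. (\<integral>\<^sup>+\<tau>. (\<integral>\<^sup>+x. ennreal (sph_density ((\<tau>, \<xi>), x)) * \<Psi> (sph_param ((\<tau>, \<xi>), x)) \<partial>lborel) \<partial>lborel) \<partial>lborel)"
  proof (rule nn_integral_cong)
    fix \<xi> :: 'a
    let ?d = "DIM('a)"
    define c where "c = (1/2::real) ^ ?d"
    have c: "c > 0" by (simp add: c_def)
    define g where "g q = \<Psi> ((1/2) *\<^sub>R (\<xi> + q), (1/2) *\<^sub>R (\<xi> - q))" for q
    have [measurable]: "g \<in> borel_measurable borel" unfolding g_def[abs_def] by measurable
    define G where "G r = (\<integral>\<^sup>+x. ennreal (sphere_weight x) * g (r *\<^sub>R sgn x) \<partial>lborel)" for r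
    have [measurable]: "G \<in> borel_measurable borel" unfolding G_def[abs_def] by measurable
    have "(\<integral>\<^sup>+\<eta>. \<Psi> (\<xi> + (- \<eta>), \<eta>) \<partial>lborel) = ennreal c * (\<integral>\<^sup>+q. g q \<partial>lborel)"
    proof -
      have h: "\<xi> - ((1/2) *\<^sub>R \<xi> + (- (1/2)) *\<^sub>R q) = (1/2) *\<^sub>R (\<xi> + q)" for q
      proof -
        have "\<xi> = (1/2) *\<^sub>R \<xi> + (1/2) *\<^sub>R \<xi>" by (simp flip: scaleR_add_left)
        then show ?thesis by (simp add: scaleR_add_right algebra_simps)
      qed
      have "(\<integral>\<^sup>+\<eta>. \<Psi> (\<xi> + (- \<eta>), \<eta>) \<partial>lborel) = ennreal (\<bar>- (1/2)\<bar> ^ ?d) * (\<integral>\<^sup>+q. \<Psi> (\<xi> + (- ((1/2) *\<^sub>R \<xi> + (- (1/2)) *\<^sub>R q)), (1/2) *\<^sub>R \<xi> + (- (1/2)) *\<^sub>R q) \<partial>lborel)"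
        by (rule nn_integral_lborel_affine[where f="\<lambda>\<eta>. \<Psi> (\<xi> + (- \<eta>), \<eta>)"]) auto
      also have "\<dots> = ennreal c * (\<integral>\<^sup>+q. g q \<partial>lborel)"
        unfolding g_def c_def by (simp only: add_uminus_conv_diff h) (simp add: scaleR_diff_right)
      finally show ?thesis .
    qed
    also have "(\<integral>\<^sup>+q. g q \<partial>lborel) = (\<integral>\<^sup>+x. (\<integral>\<^sup>+r. ennreal (sphere_weight x) * (indicator {0<..} r * ennreal (r ^ (?d - 1)) * g (r *\<^sub>R sgn x)) \<partial>lborel) \<partial>lborel)"
      by (subst nn_integral_polar) (simp_all add: nn_integral_cmult)
    also have "\<dots> = (\<integral>\<^sup>+r. (\<integral>\<^sup>+x. ennreal (sphere_weight x) * (indicator {0<..} r * ennreal (r ^ (?d - 1)) * g (r *\<^sub>R sgn x)) \<partial>lborel) \<partial>lborel)"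
      by (subst lborel_pair.Fubini') simp_all
    also have "\<dots> = (\<integral>\<^sup>+r. indicator {0<..} r * ennreal (2 * r) * (ennreal (1/2 * sqrt (r\<^sup>2) ^ (?d - 2)) * G (sqrt (r\<^sup>2))) \<partial>lborel)"
    proof (rule nn_integral_cong)
      fix r :: real
      have "(\<integral>\<^sup>+x. ennreal (sphere_weight x) * (indicator {0<..} r * ennreal (r ^ (?d - 1)) * g (r *\<^sub>R sgn x)) \<partial>lborel)
        = (\<integral>\<^sup>+x. indicator {0<..} r * ennreal (r ^ (?d - 1)) * (ennreal (sphere_weight x) * g (r *\<^sub>R sgn x)) \<partial>lborel)"
        by (simp add: mult_ac)
      also have "\<dots> = indicator {0<..} r * ennreal (r ^ (?d - 1)) * G r"
        unfolding G_def by (rule nn_integral_cmult) measurable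
      also have "\<dots> = indicator {0<..} r * ennreal (2 * r) * (ennreal (1/2 * sqrt (r\<^sup>2) ^ (?d - 2)) * G (sqrt (r\<^sup>2)))"
      proof (cases "r > 0")
        case True
        \<comment> \<open>Here \<open>DIM('a) \<ge> 2\<close> makes the truncated subtraction
          \<open>?d - 2\<close> exact.\<close>
        have "r ^ (?d - 1) = r ^ Suc (?d - 2)" using d by (intro arg_cong[where f="\<lambda>k. r ^ k"]) linarith
        then have "ennreal (r ^ (?d - 1)) = ennreal (2 * r) * ennreal (1/2 * r ^ (?d - 2))"
          using True by (subst ennreal_mult[symmetric]) auto
        then show ?thesis using True by (simp add: mult.assoc)
      qed simp
      finally show "(\<integral>\<^sup>+x. ennreal (sphere_weight x) * (indicator {0<..} r * ennreal (r ^ (?d - 1)) * g (r *\<^sub>R sgn x)) \<partial>lborel)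
         = indicator {0<..} r * ennreal (2 * r) * (ennreal (1/2 * sqrt (r\<^sup>2) ^ (?d - 2)) * G (sqrt (r\<^sup>2)))" .
    qed
    also have "\<dots> = (\<integral>\<^sup>+t. indicator {0<..} t * (ennreal (1/2 * sqrt t ^ (?d - 2)) * G (sqrt t)) \<partial>lborel)"
      by (rule nn_integral_square_subst[where f="\<lambda>t. ennreal (1/2 * sqrt t ^ (?d - 2)) * G (sqrt t)"]) measurable
    also have "\<dots> = ennreal 2 * (\<integral>\<^sup>+\<tau>. indicator {0<..} (- (norm \<xi>)\<^sup>2 + (- 2) * \<tau>) * (ennreal (1/2 * sqrt (- (norm \<xi>)\<^sup>2 + (- 2) * \<tau>) ^ (?d - 2)) * G (sqrt (- (norm \<xi>)\<^sup>2 + (- 2) * \<tau>))) \<partial>lborel)"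
      using nn_integral_real_affine[of "\<lambda>t. indicator {0<..} t * (ennreal (1/2 * sqrt t ^ (?d - 2)) * G (sqrt t))" "- 2" "- (norm \<xi>)\<^sup>2"] by simp
    also have "ennreal c * \<dots> = (\<integral>\<^sup>+\<tau>. ennreal (2 * c) * (indicator {0<..} (- (norm \<xi>)\<^sup>2 + (- 2) * \<tau>) * (ennreal (1/2 * sqrt (- (norm \<xi>)\<^sup>2 + (- 2) * \<tau>) ^ (?d - 2)) * G (sqrt (- (norm \<xi>)\<^sup>2 + (- 2) * \<tau>)))) \<partial>lborel)"
      using c by (subst nn_integral_cmult) (simp_all add: ennreal_mult mult_ac)
    also have "\<dots> = (\<integral>\<^sup>+\<tau>. (\<integral>\<^sup>+x. ennreal (sph_density ((\<tau>, \<xi>), x)) * \<Psi> (sph_param ((\<tau>, \<xi>), x)) \<partial>lborel) \<partial>lborel)"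
    proof (rule nn_integral_cong)
      fix \<tau> :: real
      define r where "r = sph_radius (\<tau>, \<xi>)"
      have r: "sqrt (- (norm \<xi>)\<^sup>2 + (- 2) * \<tau>) = r" by (simp add: r_def sph_radius_def)
      have i: "indicator {0<..} (- (norm \<xi>)\<^sup>2 + (- 2) * \<tau>) = (indicator {0<..} r :: ennreal)"
        unfolding r[symmetric] by (simp add: indicator_def)
      have f: "ennreal (2 * c) * (indicator {0<..} r * ennreal (1/2 * r ^ (?d - 2))) = ennreal (sph_factor (\<tau>, \<xi>))"
        using c by (auto simp: sph_factor_def c_def r_def simp flip: ennreal_mult split: split_indicator)
      have "ennreal (2 * c) * (indicator {0<..} (- (norm \<xi>)\<^sup>2 + (- 2) * \<tau>) * (ennreal (1/2 * sqrt (- (norm \<xi>)\<^sup>2 + (- 2) * \<tau>) ^ (?d - 2)) * G (sqrt (- (norm \<xi>)\<^sup>2 + (- 2) * \<tau>))))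
        = ennreal (sph_factor (\<tau>, \<xi>)) * G r"
        unfolding r i f[symmetric] by (simp only: mult.assoc)
      also have "\<dots> = (\<integral>\<^sup>+x. ennreal (sph_factor (\<tau>, \<xi>)) * (ennreal (sphere_weight x) * g (r *\<^sub>R sgn x)) \<partial>lborel)"
        unfolding G_def by (rule nn_integral_cmult[symmetric]) measurable
      also have "\<dots> = (\<integral>\<^sup>+x. ennreal (sph_density ((\<tau>, \<xi>), x)) * \<Psi> (sph_param ((\<tau>, \<xi>), x)) \<partial>lborel)"
      proof (rule nn_integral_cong_AE)
        show "AE x in lborel. ennreal (sph_factor (\<tau>, \<xi>)) * (ennreal (sphere_weight x) * g (r *\<^sub>R sgn x)) = ennreal (sph_density ((\<tau>, \<xi>), x)) * \<Psi> (sph_param ((\<tau>, \<xi>), x))"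
          using AE_lborel_singleton[of "0::'a"]
        proof eventually_elim
          case (elim x)
          then show ?case
            by (simp add: sph_density_def sph_param_def g_def r_def ennreal_mult mult.assoc)
        qed
      qed
      finally show "ennreal (2 * c) * (indicator {0<..} (- (norm \<xi>)\<^sup>2 + (- 2) * \<tau>) * (ennreal (1/2 * sqrt (- (norm \<xi>)\<^sup>2 + (- 2) * \<tau>) ^ (?d - 2)) * G (sqrt (- (norm \<xi>)\<^sup>2 + (- 2) * \<tau>))))
        = (\<integral>\<^sup>+x. ennreal (sph_density ((\<tau>, \<xi>), x)) * \<Psi> (sph_param ((\<tau>, \<xi>), x)) \<partial>lborel)" .
    qed
    finally show "(\<integral>\<^sup>+\<eta>. \<Psi> (\<xi> + (- \<eta>), \<eta>) \<partial>lborel) = (\<integral>\<^sup>+\<tau>. (\<integral>\<^sup>+x. ennreal (sph_density ((\<tau>, \<xi>), x)) * \<Psi> (sph_param ((\<tau>, \<xi>), x)) \<partial>lborel) \<partial>lborel)" .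
  qed
  also have "\<dots> = (\<integral>\<^sup>+y. (\<integral>\<^sup>+x. ennreal (sph_density (y, x)) * \<Psi> (sph_param (y, x)) \<partial>lborel) \<partial>lborel)"
  proof (rule nn_integral_lborel_pair(2)[symmetric])
    have "(\<lambda>p. ennreal (sph_density p) * \<Psi> (sph_param p)) \<in> borel_measurable (borel \<Otimes>\<^sub>M lborel)"
      by simp
    from sigma_finite_measure.borel_measurable_nn_integral_fst[OF sigma_finite_lborel this]
    show "(\<lambda>y. \<integral>\<^sup>+x. ennreal (sph_density (y, x)) * \<Psi> (sph_param (y, x)) \<partial>lborel) \<in> borel_measurable borel" .
  qed
  finally show "(\<integral>\<^sup>+z. \<Psi> z \<partial>lborel) = (\<integral>\<^sup>+y. (\<integral>\<^sup>+x. ennreal (sph_density (y, x)) * \<Psi> (sph_param (y, x)) \<partial>lborel) \<partial>lborel)" .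
qed

subsection \<open>Monotonicity on the fibres\<close>

lemma Re_mult_cnj_le: "Re (z * cnj w) \<le> ((cmod z)\<^sup>2 + (cmod w)\<^sup>2) / 2"
proof -
  have "Re (z * cnj w) \<le> cmod z * cmod w"
    using complex_Re_le_cmod[of "z * cnj w"] by (simp add: norm_mult)
  also have "\<dots> \<le> ((cmod z)\<^sup>2 + (cmod w)\<^sup>2) / 2"
    using sum_squares_bound[of "cmod z" "cmod w"] by simp
  finally show ?thesis .
qed

lemma nn_integral_mult_self:
  fixes u :: "'a::euclidean_space \<Rightarrow> ennreal"
  assumes [measurable]: "u \<in> borel_measurable borel"
  shows "(\<integral>\<^sup>+x. u x \<partial>lborel) * (\<integral>\<^sup>+x. u x \<partial>lborel) = (\<integral>\<^sup>+x. (\<integral>\<^sup>+x'. u x * u x' \<partial>lborel) \<partial>lborel)"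
  by (simp add: nn_integral_cmult nn_integral_multc)

text \<open>The product of the integrals is a double integral, bounded by the mean of two symmetric
  terms. There is no division by a norm, so vanishing or infinite factors need no separate
  treatment.\<close>

lemma Cauchy_Schwarz_weighted:
  fixes f :: "'a::euclidean_space \<Rightarrow> complex" and w :: "'a \<Rightarrow> real"
  assumes [measurable]: "f \<in> borel_measurable borel" "w \<in> borel_measurable borel" and w: "\<And>x. w x \<ge> 0"
  shows "ennreal ((cmod (\<integral>x. w x *\<^sub>R f x \<partial>lborel))\<^sup>2) \<le> (\<integral>\<^sup>+x. ennreal (w x) \<partial>lborel) * (\<integral>\<^sup>+x. ennreal (w x) * ennreal ((cmod (f x))\<^sup>2) \<partial>lborel)"
proof -
  let ?u = "\<lambda>x. ennreal (norm (w x *\<^sub>R f x))"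
  let ?W = "\<integral>\<^sup>+x. ennreal (w x) \<partial>lborel" and ?F = "\<integral>\<^sup>+x. ennreal (w x) * ennreal ((cmod (f x))\<^sup>2) \<partial>lborel"
  have "ennreal ((cmod (\<integral>x. w x *\<^sub>R f x \<partial>lborel))\<^sup>2) = ennreal (cmod (\<integral>x. w x *\<^sub>R f x \<partial>lborel)) * ennreal (cmod (\<integral>x. w x *\<^sub>R f x \<partial>lborel))"
    by (simp add: power2_eq_square ennreal_mult)
  also have "\<dots> \<le> (\<integral>\<^sup>+x. ?u x \<partial>lborel) * (\<integral>\<^sup>+x. ?u x \<partial>lborel)"
    by (intro mult_mono norm_integral_le_nn_integral) auto
  also have "\<dots> = (\<integral>\<^sup>+x. (\<integral>\<^sup>+x'. ?u x * ?u x' \<partial>lborel) \<partial>lborel)"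
    by (rule nn_integral_mult_self) measurable
  also have "\<dots> \<le> (\<integral>\<^sup>+x. (\<integral>\<^sup>+x'. ennreal (1/2) * (ennreal (w x) * (ennreal (w x') * ennreal ((cmod (f x'))\<^sup>2)))
        + ennreal (1/2) * (ennreal (w x') * (ennreal (w x) * ennreal ((cmod (f x))\<^sup>2))) \<partial>lborel) \<partial>lborel)"
  proof (intro nn_integral_mono)
    fix x x'
    have "cmod (f x) * cmod (f x') \<le> ((cmod (f x))\<^sup>2 + (cmod (f x'))\<^sup>2) / 2"
      using sum_squares_bound[of "cmod (f x)" "cmod (f x')"] by simp
    then have "w x * w x' * (cmod (f x) * cmod (f x')) \<le> w x * w x' * (((cmod (f x))\<^sup>2 + (cmod (f x'))\<^sup>2) / 2)"
      using w by (intro mult_left_mono mult_nonneg_nonneg) auto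
    then have "ennreal (norm (w x *\<^sub>R f x) * norm (w x' *\<^sub>R f x')) \<le> ennreal (1/2 * (w x * (w x' * (cmod (f x'))\<^sup>2)) + 1/2 * (w x' * (w x * (cmod (f x))\<^sup>2)))"
      using w[of x] w[of x'] by (intro ennreal_leI) (simp add: field_simps)
    then show "?u x * ?u x' \<le> ennreal (1/2) * (ennreal (w x) * (ennreal (w x') * ennreal ((cmod (f x'))\<^sup>2)))
        + ennreal (1/2) * (ennreal (w x') * (ennreal (w x) * ennreal ((cmod (f x))\<^sup>2)))"
      using w[of x] w[of x'] by (simp only: ennreal_mult[symmetric] ennreal_plus[symmetric] norm_ge_zero mult_nonneg_nonneg zero_le_power2 zero_le_divide_1_iff zero_le_numeral)
  qed
  also have "\<dots> = ennreal (1/2) * (?W * ?F) + ennreal (1/2) * (?W * ?F)"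
    by (simp add: nn_integral_add nn_integral_cmult nn_integral_multc)
  also have "\<dots> = ?W * ?F"
  proof -
    have "ennreal (1/2) + ennreal (1/2) = ennreal (1/2 + 1/2)" by (rule ennreal_plus[symmetric]) auto
    also have "\<dots> = 1" by simp
    finally have "ennreal (1/2) + ennreal (1/2) = 1" .
    then show ?thesis unfolding distrib_right[symmetric] by simp
  qed
  finally show ?thesis .
qed

text \<open>After squaring, \<open>K\<close> is the double integral of \<open>A (x, x') * cnj (A (x', x))\<close> with
  \<open>A (x, x') = a x * b x'\<close>, so that \<open>J - \<bar>K\<bar>\<^sup>2\<close> is half the integral of \<open>\<bar>A (x, x') - A (x', x)\<bar>\<^sup>2\<close>
  against an exponential weight which is symmetric in \<open>x\<close> and \<open>x'\<close> and decreases with \<open>\<rho>\<close>.\<close>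

lemma swap_defect_antimono:
  fixes a b :: "'x::euclidean_space \<Rightarrow> complex" and t :: "'x \<Rightarrow> real"
  assumes [measurable]: "a \<in> borel_measurable borel" "b \<in> borel_measurable borel" "t \<in> borel_measurable borel"
    and t: "\<And>x. t x \<ge> 0" and c: "c \<ge> 0" and \<rho>: "\<rho>1 \<le> \<rho>2"
  defines "K \<equiv> \<lambda>\<rho>. \<integral>x. exp (- \<rho> * (c + 2 * t x)) *\<^sub>R (a x * cnj (b x)) \<partial>lborel"
    and "J \<equiv> \<lambda>\<rho>. \<integral>\<^sup>+x. (\<integral>\<^sup>+x'. ennreal (exp (- 2 * \<rho> * (c + t x + t x')) * ((cmod (a x))\<^sup>2 * (cmod (b x'))\<^sup>2)) \<partial>lborel) \<partial>lborel"
  shows "J \<rho>2 + ennreal ((cmod (K \<rho>1))\<^sup>2) \<le> J \<rho>1 + ennreal ((cmod (K \<rho>2))\<^sup>2)"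
proof (cases "J \<rho>1 = \<infinity>")
  case True
  then show ?thesis by simp
next
  case False
  define e where "e \<rho> p = exp (- 2 * \<rho> * (c + t (fst p) + t (snd p)))" for \<rho> and p :: "'x \<times> 'x"
  define A where "A p = a (fst p) * b (snd p)" for p
  define A' where "A' p = a (snd p) * b (fst p)" for p
  define g where "g \<rho> p = e \<rho> p * (cmod (A p))\<^sup>2" for \<rho> p
  define f where "f \<rho> x = exp (- \<rho> * (c + 2 * t x)) *\<^sub>R (a x * cnj (b x))" for \<rho> x
  define h where "h \<rho> p = f \<rho> (fst p) * cnj (f \<rho> (snd p))" for \<rho> and p :: "'x \<times> 'x"
  have [measurable]: "f \<rho> \<in> borel_measurable borel" for \<rho> unfolding f_def[abs_def] by measurable
  have [measurable]: "g \<rho> \<in> borel_measurable (lborel \<Otimes>\<^sub>M lborel)" for \<rho>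
    unfolding g_def[abs_def] e_def A_def by measurable
  have e_mono: "e \<rho>2 p \<le> e \<rho>1 p" for p
    unfolding e_def using \<rho> t[of "fst p"] t[of "snd p"] c by (simp add: mult_right_mono)
  have e_pos: "e \<rho> p > 0" for \<rho> p by (simp add: e_def)
  \<comment> \<open>The exponents \<rho> (c + 2 t x) and \<rho> (c + 2 t x') add up to 2 \<rho> (c +
    t x + t x'), the exponent in \<open>J\<close>.\<close>
  have hA: "h \<rho> p = e \<rho> p *\<^sub>R (A p * cnj (A' p))" for \<rho> p
    unfolding h_def f_def A_def A'_def e_def
    by (simp add: algebra_simps scaleR_conv_of_real flip: exp_add of_real_mult)
  have J: "J \<rho> = (\<integral>\<^sup>+p. ennreal (g \<rho> p) \<partial>(lborel \<Otimes>\<^sub>M lborel))" for \<rho>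
    unfolding J_def
    by (subst lborel.nn_integral_fst[symmetric]) (auto simp: g_def e_def A_def norm_mult power_mult_distrib)
  have ig: "integrable (lborel \<Otimes>\<^sub>M lborel) (g \<rho>)" if "\<rho> = \<rho>1 \<or> \<rho> = \<rho>2" for \<rho>
  proof -
    have i1: "integrable (lborel \<Otimes>\<^sub>M lborel) (g \<rho>1)"
    proof (rule integrableI_nonneg)
      show "AE p in lborel \<Otimes>\<^sub>M lborel. 0 \<le> g \<rho>1 p" by (simp add: g_def less_imp_le[OF e_pos])
      show "(\<integral>\<^sup>+p. ennreal (g \<rho>1 p) \<partial>(lborel \<Otimes>\<^sub>M lborel)) < \<infinity>"
        using False unfolding J by (simp add: top.not_eq_extremum)
    qed simp
    have "integrable (lborel \<Otimes>\<^sub>M lborel) (g \<rho>2)"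
      by (rule Bochner_Integration.integrable_bound[OF i1])
         (auto simp: g_def abs_mult less_imp_le[OF e_pos] intro!: mult_right_mono e_mono)
    with i1 that show ?thesis by auto
  qed
  have Jr: "J \<rho> = ennreal (\<integral>p. g \<rho> p \<partial>(lborel \<Otimes>\<^sub>M lborel))" if "\<rho> = \<rho>1 \<or> \<rho> = \<rho>2" for \<rho>
    unfolding J by (rule nn_integral_eq_integral[OF ig[OF that]]) (simp add: g_def less_imp_le[OF e_pos])
  have swap: "e \<rho> (snd p, fst p) = e \<rho> p" "A (snd p, fst p) = A' p" for \<rho> p
    by (simp_all add: e_def A_def A'_def algebra_simps)
  define g' where "g' \<rho> p = g \<rho> (snd p, fst p)" for \<rho> p
  have g': "g' \<rho> p = e \<rho> p * (cmod (A' p))\<^sup>2" for \<rho> p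
    by (simp add: g'_def g_def swap)
  have ig': "integrable (lborel \<Otimes>\<^sub>M lborel) (g' \<rho>)" if "\<rho> = \<rho>1 \<or> \<rho> = \<rho>2" for \<rho>
    using lborel_pair.integrable_product_swap[OF ig[OF that]] by (simp add: g'_def[abs_def] split_beta')
  have eg': "(\<integral>p. g' \<rho> p \<partial>(lborel \<Otimes>\<^sub>M lborel)) = (\<integral>p. g \<rho> p \<partial>(lborel \<Otimes>\<^sub>M lborel))" for \<rho>
    using lborel_pair.integral_product_swap[of "g \<rho>"] by (simp add: g'_def[abs_def] split_beta')
  \<comment> \<open>The integral of \<open>cmod (f \<rho> x)\<close> is shown to be finite through
    its square, which is the double integral of \<open>cmod (h \<rho> p)\<close> and is at most the
    finite integral of \<open>g \<rho> p + g' \<rho> p\<close>.\<close>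
  have intf: "integrable lborel (f \<rho>)" if "\<rho> = \<rho>1 \<or> \<rho> = \<rho>2" for \<rho>
  proof -
    have "(\<integral>\<^sup>+x. ennreal (cmod (f \<rho> x)) \<partial>lborel) * (\<integral>\<^sup>+x. ennreal (cmod (f \<rho> x)) \<partial>lborel)
       = (\<integral>\<^sup>+x. (\<integral>\<^sup>+x'. ennreal (cmod (f \<rho> x)) * ennreal (cmod (f \<rho> x')) \<partial>lborel) \<partial>lborel)"
      by (rule nn_integral_mult_self) measurable
    also have "\<dots> = (\<integral>\<^sup>+p. ennreal (cmod (h \<rho> p)) \<partial>(lborel \<Otimes>\<^sub>M lborel))"
      by (subst lborel.nn_integral_fst[symmetric]) (auto simp: h_def norm_mult ennreal_mult)
    also have "\<dots> \<le> (\<integral>\<^sup>+p. ennreal (g \<rho> p + g' \<rho> p) \<partial>(lborel \<Otimes>\<^sub>M lborel))"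
    proof (intro nn_integral_mono ennreal_leI)
      fix p
      have "cmod (A p) * cmod (A' p) \<le> (cmod (A p))\<^sup>2 + (cmod (A' p))\<^sup>2"
        using sum_squares_bound[of "cmod (A p)" "cmod (A' p)"] mult_nonneg_nonneg[OF norm_ge_zero[of "A p"] norm_ge_zero[of "A' p"]]
        unfolding mult.assoc by linarith
      from mult_left_mono[OF this less_imp_le[OF e_pos]] show "cmod (h \<rho> p) \<le> g \<rho> p + g' \<rho> p"
        by (simp add: hA norm_mult g_def g' abs_of_pos e_pos distrib_left)
    qed
    also have "\<dots> = ennreal (\<integral>p. g \<rho> p + g' \<rho> p \<partial>(lborel \<Otimes>\<^sub>M lborel))"
    proof (rule nn_integral_eq_integral)
      show "integrable (lborel \<Otimes>\<^sub>M lborel) (\<lambda>p. g \<rho> p + g' \<rho> p)" using ig[OF that] ig'[OF that] by simp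
      show "AE p in lborel \<Otimes>\<^sub>M lborel. 0 \<le> g \<rho> p + g' \<rho> p" by (simp add: g_def g' less_imp_le[OF e_pos])
    qed
    also have "\<dots> < \<infinity>" by simp
    finally have sq: "(\<integral>\<^sup>+x. ennreal (cmod (f \<rho> x)) \<partial>lborel) * (\<integral>\<^sup>+x. ennreal (cmod (f \<rho> x)) \<partial>lborel) < \<infinity>" .
    have "X < \<infinity>" if "X * X < \<infinity>" for X :: ennreal
      using that by (cases "X = top") (simp_all add: ennreal_top_mult top.not_eq_extremum)
    from this[OF sq] show ?thesis by (simp add: integrable_iff_bounded)
  qed
  have ih: "integrable (lborel \<Otimes>\<^sub>M lborel) (h \<rho>)" if "\<rho> = \<rho>1 \<or> \<rho> = \<rho>2" for \<rho>
  proof (rule lborel_pair.Fubini_integrable)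
    show "integrable lborel (\<lambda>x. \<integral>y. norm (h \<rho> (x, y)) \<partial>lborel)"
      using intf[OF that] by (simp add: h_def norm_mult)
    show "AE x in lborel. integrable lborel (\<lambda>y. h \<rho> (x, y))"
      using intf[OF that] by (simp add: h_def)
    show "h \<rho> \<in> borel_measurable (lborel \<Otimes>\<^sub>M lborel)"
      unfolding h_def[abs_def] by measurable
  qed
  have K: "(cmod (K \<rho>))\<^sup>2 = (\<integral>p. Re (h \<rho> p) \<partial>(lborel \<Otimes>\<^sub>M lborel))" if "\<rho> = \<rho>1 \<or> \<rho> = \<rho>2" for \<rho>
  proof -
    have "(\<integral>p. h \<rho> p \<partial>(lborel \<Otimes>\<^sub>M lborel)) = (\<integral>x. (\<integral>y. h \<rho> (x, y) \<partial>lborel) \<partial>lborel)"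
      by (rule lborel_pair.integral_fst'[symmetric, OF ih[OF that]])
    also have "\<dots> = K \<rho> * cnj (K \<rho>)"
    proof -
      have "K \<rho> = integral\<^sup>L lborel (f \<rho>)" by (simp only: K_def f_def[abs_def])
      then show ?thesis by (simp add: h_def)
    qed
    also have "\<dots> = complex_of_real ((cmod (K \<rho>))\<^sup>2)"
      by (simp add: complex_norm_square del: of_real_power)
    finally have "Re (\<integral>p. h \<rho> p \<partial>(lborel \<Otimes>\<^sub>M lborel)) = (cmod (K \<rho>))\<^sup>2" by simp
    then show ?thesis using ih[OF that] by simp
  qed
  \<comment> \<open>The factor \<open>e \<rho>1 p - e \<rho>2 p\<close> is nonnegative, and the real
    part of \<open>A p * cnj (A' p)\<close> is at most the mean of the squares; exchanging the
    variables shows that the two halves of this mean have the same integral.\<close>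
  have "(\<integral>p. Re (h \<rho>1 p) - Re (h \<rho>2 p) \<partial>(lborel \<Otimes>\<^sub>M lborel))
     \<le> (\<integral>p. ((g \<rho>1 p - g \<rho>2 p) + (g' \<rho>1 p - g' \<rho>2 p)) / 2 \<partial>(lborel \<Otimes>\<^sub>M lborel))"
  proof (rule integral_mono)
    show "integrable (lborel \<Otimes>\<^sub>M lborel) (\<lambda>p. Re (h \<rho>1 p) - Re (h \<rho>2 p))" using ih by simp
    show "integrable (lborel \<Otimes>\<^sub>M lborel) (\<lambda>p. ((g \<rho>1 p - g \<rho>2 p) + (g' \<rho>1 p - g' \<rho>2 p)) / 2)" using ig ig' by simp
    fix p
    have "(e \<rho>1 p - e \<rho>2 p) * Re (A p * cnj (A' p)) \<le> (e \<rho>1 p - e \<rho>2 p) * (((cmod (A p))\<^sup>2 + (cmod (A' p))\<^sup>2) / 2)"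
      using e_mono[of p] by (intro mult_left_mono Re_mult_cnj_le) auto
    then show "Re (h \<rho>1 p) - Re (h \<rho>2 p) \<le> ((g \<rho>1 p - g \<rho>2 p) + (g' \<rho>1 p - g' \<rho>2 p)) / 2"
      unfolding hA g_def g' by (simp only: scaleR_complex.sel(1)) (simp add: algebra_simps add_divide_distrib diff_divide_distrib)
  qed
  also have "\<dots> = (\<integral>p. g \<rho>1 p \<partial>(lborel \<Otimes>\<^sub>M lborel)) - (\<integral>p. g \<rho>2 p \<partial>(lborel \<Otimes>\<^sub>M lborel))"
    using ig ig' by (simp add: eg')
  finally have "(\<integral>p. g \<rho>2 p \<partial>(lborel \<Otimes>\<^sub>M lborel)) + (cmod (K \<rho>1))\<^sup>2 \<le> (\<integral>p. g \<rho>1 p \<partial>(lborel \<Otimes>\<^sub>M lborel)) + (cmod (K \<rho>2))\<^sup>2"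
    using ih by (simp add: K)
  moreover have "(\<integral>p. g \<rho> p \<partial>(lborel \<Otimes>\<^sub>M lborel)) \<ge> 0" for \<rho>
    by (simp add: g_def integral_nonneg_AE less_imp_le[OF e_pos])
  ultimately show ?thesis
    by (simp add: Jr ennreal_leI flip: ennreal_plus)
qed

section \<open>Weighted data and their energies on the fibres\<close>

definition damp :: "real \<Rightarrow> ('a::euclidean_space \<Rightarrow> complex) \<Rightarrow> 'a \<Rightarrow> complex" where
  "damp \<rho> F \<zeta> = of_real (exp (- \<rho> * (norm \<zeta>)\<^sup>2)) * F \<zeta>"

lemma borel_measurable_damp [measurable]:
  assumes [measurable]: "F \<in> borel_measurable borel"
  shows "damp \<rho> F \<in> borel_measurable borel"
  unfolding damp_def[abs_def] by measurable

lemma cmod_damp: "cmod (damp \<rho> F \<zeta>) = exp (- \<rho> * (norm \<zeta>)\<^sup>2) * cmod (F \<zeta>)"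
  by (simp add: damp_def norm_mult)

lemma cmod_damp_sq: "(cmod (damp \<rho> F \<zeta>))\<^sup>2 = exp (- 2 * \<rho> * (norm \<zeta>)\<^sup>2) * (cmod (F \<zeta>))\<^sup>2"
  by (simp add: cmod_damp power_mult_distrib exp_double[symmetric] mult.assoc)

definition hyp_data :: "real \<Rightarrow> real \<Rightarrow> ('a::euclidean_space \<Rightarrow> complex) \<Rightarrow> ('a \<Rightarrow> complex) \<Rightarrow> 'a \<times> 'a \<Rightarrow> complex" where
  "hyp_data \<sigma> \<rho> F G z = of_real (norm (fst z - snd z) powr (2 * \<sigma>)) * (damp \<rho> F (fst z) * cnj (damp \<rho> G (snd z)))"

text \<open>On a fibre the multiplier of \<open>frac_D\<close> is (|\<zeta> - \<eta>|^2 /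
  2)^\<beta>; the weight keeps the power of |\<zeta> - \<eta>| and leaves the constant 2^(-\<beta>)
  to \<open>frac_D_eq\<close>.\<close>

definition sph_data :: "real \<Rightarrow> real \<Rightarrow> ('a::euclidean_space \<Rightarrow> complex) \<Rightarrow> ('a \<Rightarrow> complex) \<Rightarrow> 'a \<times> 'a \<Rightarrow> complex" where
  "sph_data \<beta> \<rho> F G z = of_real (norm (fst z - snd z) powr (2 * \<beta>)) * (damp \<rho> F (fst z) * damp \<rho> G (snd z))"

lemma borel_measurable_data [measurable]:
  assumes [measurable]: "F \<in> borel_measurable borel" "G \<in> borel_measurable borel"
  shows "hyp_data \<sigma> \<rho> F G \<in> borel_measurable borel" "sph_data \<sigma> \<rho> F G \<in> borel_measurable borel"
  unfolding hyp_data_def[abs_def] sph_data_def[abs_def] by measurable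

text \<open>With \<open>\<kappa> = 4 * s + real DIM('a) - 2\<close> this is
  \<open>I_functional\<close> of the heat-regularised data (\<open>I_functional_heat\<close>),
  written with transforms that do not change with \<rho>.\<close>

definition pair_energy :: "real \<Rightarrow> real \<Rightarrow> ('a::euclidean_space \<Rightarrow> complex) \<Rightarrow> ('a \<Rightarrow> complex) \<Rightarrow> ennreal" where
  "pair_energy \<kappa> \<rho> F G = (\<integral>\<^sup>+z. ennreal ((cmod (damp \<rho> F (fst z)))\<^sup>2 * (cmod (damp \<rho> G (snd z)))\<^sup>2 * norm (fst z - snd z) powr \<kappa>) \<partial>lborel)"

text \<open>The two integrals run independently over the hyperplane of the fibre: \<open>x\<close>
  gives a frequency \<zeta> and \<open>x'\<close> a frequency \<eta>, opposite corners of a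
  rectangle. The multiplier and the constant of the density enter squared, as in the square of the
  fibre integral.\<close>

definition hyp_energy :: "real \<Rightarrow> real \<Rightarrow> ('a::euclidean_space \<Rightarrow> complex) \<Rightarrow> ('a \<Rightarrow> complex) \<Rightarrow> real \<times> 'a \<Rightarrow> ennreal" where
  "hyp_energy \<sigma> \<rho> F G y = ennreal ((norm (snd y) powr (2 * \<sigma>) / (2 * norm (snd y)))\<^sup>2) *
     (\<integral>\<^sup>+x. (\<integral>\<^sup>+x'. ennreal (slab (x \<bullet> sgn (snd y)) * (cmod (damp \<rho> F (snd y + hyp_point y x)))\<^sup>2 *
         (slab (x' \<bullet> sgn (snd y)) * (cmod (damp \<rho> G (hyp_point y x')))\<^sup>2)) \<partial>lborel) \<partial>lborel)"

lemma slab_sq: "(slab s)\<^sup>2 = slab s" "slab s * slab s = slab s"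
  by (auto simp: slab_def split: split_indicator)

lemma borel_measurable_hyp_point [measurable]:
  "hyp_point y \<in> borel_measurable (borel :: 'a::euclidean_space measure)"
  "(\<lambda>p. hyp_point (fst p) (snd p)) \<in> borel_measurable (borel \<Otimes>\<^sub>M (borel :: 'a measure))"
  unfolding hyp_point_def[abs_def] by measurable

text \<open>On a fibre, |\<zeta>|^2 and |\<eta>|^2 each consist of a constant, determined by the
  component along \<xi>, and of the same transversal part \<open>t x\<close>. This is the form
  treated by \<open>swap_defect_antimono\<close>; for \<xi> = 0 all terms vanish.\<close>

lemma hyp_energy_antimono:
  fixes F G :: "'a::euclidean_space \<Rightarrow> complex"
  assumes [measurable]: "F \<in> borel_measurable borel" "G \<in> borel_measurable borel" and \<rho>: "\<rho>1 \<le> \<rho>2"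
  shows "hyp_energy \<sigma> \<rho>2 F G y + ennreal ((cmod (disintegration.fibre_integral hyp_density hyp_param (hyp_data \<sigma> \<rho>1 F G) y))\<^sup>2)
      \<le> hyp_energy \<sigma> \<rho>1 F G y + ennreal ((cmod (disintegration.fibre_integral hyp_density hyp_param (hyp_data \<sigma> \<rho>2 F G) y))\<^sup>2)"
proof -
  interpret hyp: disintegration hyp_density hyp_param "hyp_proj :: 'a \<times> 'a \<Rightarrow> real \<times> 'a"
    by (rule disintegration_hyp)
  define \<xi> where "\<xi> = snd y"
  define q where "q = norm \<xi> powr (2 * \<sigma>) / (2 * norm \<xi>)"
  show ?thesis
  proof (cases "\<xi> = 0")
    case True
    have "hyp.fibre_integral (hyp_data \<sigma> \<rho> F G) y = 0" for \<rho>
      using True by (simp add: hyp.fibre_integral_def hyp_density_def \<xi>_def)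
    moreover have "hyp_energy \<sigma> \<rho> F G y = 0" for \<rho>
      using True by (simp add: hyp_energy_def \<xi>_def)
    ultimately show ?thesis by simp
  next
    case False
    define n where "n = sgn \<xi>"
    have n: "norm n = 1" using False by (simp add: n_def norm_sgn)
    have \<xi>n: "\<xi> = norm \<xi> *\<^sub>R n" using False by (simp add: n_def sgn_div_norm)
    have q: "q > 0" using False by (simp add: q_def)
    define s where "s = - (fst y + (norm \<xi>)\<^sup>2) / (2 * norm \<xi>)"
    define t where "t x = (norm (x - (x \<bullet> n) *\<^sub>R n))\<^sup>2" for x
    \<comment> \<open>The sum of the two longitudinal parts: \<eta> has the component
      \<open>s\<close> along \<open>n\<close>, and \<zeta> = \<xi> + \<eta> has
      \<open>s + norm \<xi>\<close>.\<close>
    define c where "c = (s + norm \<xi>)\<^sup>2 + s\<^sup>2"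
    have hp: "hyp_point y x = x + (s - x \<bullet> n) *\<^sub>R n" for x
      by (simp add: hyp_point_def s_def n_def \<xi>_def)
    have hp': "\<xi> + hyp_point y x = x + ((s + norm \<xi>) - x \<bullet> n) *\<^sub>R n" for x
      unfolding hp by (subst (1) \<xi>n) (simp add: algebra_simps)
    have E1: "(norm (hyp_point y x))\<^sup>2 = s\<^sup>2 + t x" for x
      unfolding hp t_def by (rule norm_hyperplane_decomp(1)[OF n])
    have E2: "(norm (\<xi> + hyp_point y x))\<^sup>2 = (s + norm \<xi>)\<^sup>2 + t x" for x
      unfolding hp' t_def by (rule norm_hyperplane_decomp(1)[OF n])
    define a where "a x = slab (x \<bullet> n) *\<^sub>R F (\<xi> + hyp_point y x)" for x
    define b where "b x = slab (x \<bullet> n) *\<^sub>R G (hyp_point y x)" for x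
    have [measurable]: "a \<in> borel_measurable borel" "b \<in> borel_measurable borel" "t \<in> borel_measurable borel"
      unfolding a_def[abs_def] b_def[abs_def] t_def[abs_def] by measurable
    define K where "K \<rho> = (\<integral>x. exp (- \<rho> * (c + 2 * t x)) *\<^sub>R (a x * cnj (b x)) \<partial>lborel)" for \<rho>
    define J where "J \<rho> = (\<integral>\<^sup>+x. (\<integral>\<^sup>+x'. ennreal (exp (- 2 * \<rho> * (c + t x + t x')) * ((cmod (a x))\<^sup>2 * (cmod (b x'))\<^sup>2)) \<partial>lborel) \<partial>lborel)" for \<rho>
    have fK: "hyp.fibre_integral (hyp_data \<sigma> \<rho> F G) y = q *\<^sub>R K \<rho>" for \<rho>
      unfolding hyp.fibre_integral_def K_def integral_scaleR_right[symmetric]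
    proof (rule Bochner_Integration.integral_cong[OF refl])
      fix x
      have e: "exp (- \<rho> * (norm (\<xi> + hyp_point y x))\<^sup>2) * exp (- \<rho> * (norm (hyp_point y x))\<^sup>2) = exp (- \<rho> * (c + 2 * t x))"
        unfolding E1 E2 c_def mult_exp_exp by (simp add: algebra_simps)
      have p: "hyp_param (y, x) = (\<xi> + hyp_point y x, hyp_point y x)" by (simp add: hyp_param_def \<xi>_def)
      have "hyp_density (y, x) *\<^sub>R hyp_data \<sigma> \<rho> F G (hyp_param (y, x))
         = of_real (slab (x \<bullet> n) / (2 * norm \<xi>)) * (of_real (norm \<xi> powr (2 * \<sigma>)) * (of_real (exp (- \<rho> * (norm (\<xi> + hyp_point y x))\<^sup>2)) * F (\<xi> + hyp_point y x) * (of_real (exp (- \<rho> * (norm (hyp_point y x))\<^sup>2)) * cnj (G (hyp_point y x)))))"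
        by (simp add: p hyp_data_def hyp_density_def damp_def scaleR_conv_of_real n_def \<xi>_def)
      also have "\<dots> = of_real (slab (x \<bullet> n)) * of_real q * (of_real (exp (- \<rho> * (norm (\<xi> + hyp_point y x))\<^sup>2)) * of_real (exp (- \<rho> * (norm (hyp_point y x))\<^sup>2))) * (F (\<xi> + hyp_point y x) * cnj (G (hyp_point y x)))"
        unfolding q_def by simp
      \<comment> \<open>\<open>slab\<close> is an indicator and equals its square, so
        \<open>a\<close> and \<open>b\<close> can have one copy each.\<close>
      also have "\<dots> = of_real (slab (x \<bullet> n) * slab (x \<bullet> n)) * of_real q * of_real (exp (- \<rho> * (c + 2 * t x))) * (F (\<xi> + hyp_point y x) * cnj (G (hyp_point y x)))"
        unfolding of_real_mult[symmetric] e slab_sq ..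
      also have "\<dots> = q *\<^sub>R exp (- \<rho> * (c + 2 * t x)) *\<^sub>R (a x * cnj (b x))"
        by (simp add: a_def b_def scaleR_conv_of_real)
      finally show "hyp_density (y, x) *\<^sub>R hyp_data \<sigma> \<rho> F G (hyp_param (y, x)) = q *\<^sub>R exp (- \<rho> * (c + 2 * t x)) *\<^sub>R (a x * cnj (b x))" .
    qed
    have eJ: "hyp_energy \<sigma> \<rho> F G y = ennreal (q\<^sup>2) * J \<rho>" for \<rho>
    proof -
      have "slab (x \<bullet> n) * (cmod (damp \<rho> F (\<xi> + hyp_point y x)))\<^sup>2 * (slab (x' \<bullet> n) * (cmod (damp \<rho> G (hyp_point y x')))\<^sup>2)
         = exp (- 2 * \<rho> * (c + t x + t x')) * ((cmod (a x))\<^sup>2 * (cmod (b x'))\<^sup>2)" for x x'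
      proof -
        have e: "exp (- 2 * \<rho> * (norm (\<xi> + hyp_point y x))\<^sup>2) * exp (- 2 * \<rho> * (norm (hyp_point y x'))\<^sup>2) = exp (- 2 * \<rho> * (c + t x + t x'))"
          unfolding E1 E2 c_def mult_exp_exp by (simp add: algebra_simps)
        show ?thesis
          unfolding cmod_damp_sq e[symmetric] a_def b_def by (simp add: power_mult_distrib slab_sq abs_of_nonneg mult_ac)
      qed
      then show ?thesis
        unfolding hyp_energy_def J_def by (simp add: q_def \<xi>_def n_def)
    qed
    have "J \<rho>2 + ennreal ((cmod (K \<rho>1))\<^sup>2) \<le> J \<rho>1 + ennreal ((cmod (K \<rho>2))\<^sup>2)"
      unfolding J_def K_def by (rule swap_defect_antimono) (use \<rho> in \<open>auto simp: t_def c_def\<close>)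
    from mult_left_mono[OF this, of "ennreal (q\<^sup>2)"] show ?thesis
      unfolding fK eJ using q by (simp add: distrib_left power_mult_distrib ennreal_mult)
  qed
qed

lemma nn_integral_shear:
  fixes \<Psi> :: "'a::euclidean_space \<times> 'a \<Rightarrow> ennreal"
  assumes [measurable]: "\<Psi> \<in> borel_measurable borel"
  shows "(\<integral>\<^sup>+z. \<Psi> z \<partial>lborel) = (\<integral>\<^sup>+\<eta>. (\<integral>\<^sup>+\<xi>. \<Psi> (\<xi> + \<eta>, \<eta>) \<partial>lborel) \<partial>lborel)"
proof -
  have "(\<integral>\<^sup>+z. \<Psi> z \<partial>lborel) = (\<integral>\<^sup>+\<eta>. (\<integral>\<^sup>+\<zeta>. \<Psi> (\<zeta>, \<eta>) \<partial>lborel) \<partial>lborel)"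
    by (rule nn_integral_lborel_pair(2)) measurable
  also have "\<dots> = (\<integral>\<^sup>+\<eta>. (\<integral>\<^sup>+\<xi>. \<Psi> (\<xi> + \<eta>, \<eta>) \<partial>lborel) \<partial>lborel)"
    by (intro nn_integral_cong nn_integral_lborel_translate[symmetric]) (simp add: borel_prod[symmetric])
  finally show ?thesis .
qed

text \<open>One corner \<eta> of the rectangle is fixed. The opposite one is \<eta> + q, where the
  diagonal q is \<xi> plus a vector orthogonal to \<xi>, and
  \<open>nn_integral_hyperplanes_radial\<close> collects all \<xi> that belong to the same q. Of the
  two factors 1 / (2 |\<xi>|) in the energy, one is the density of the fibration and the other stays
  in the weight \<open>w\<close>, whence the half.\<close>

lemma nn_integral_hyp_energy:
  fixes F G :: "'a::euclidean_space \<Rightarrow> complex"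
  assumes [measurable]: "F \<in> borel_measurable borel" "G \<in> borel_measurable borel"
    and \<kappa>: "\<kappa> = 4 * \<sigma> + real DIM('a) - 2" "\<kappa> > - 1"
  shows "(\<integral>\<^sup>+y. hyp_energy \<sigma> \<rho> F G y \<partial>lborel) = ennreal (sphere_const \<kappa> DIM('a) / 2) * pair_energy \<kappa> \<rho> F G"
proof -
  interpret hyp: disintegration hyp_density hyp_param "hyp_proj :: 'a \<times> 'a \<Rightarrow> real \<times> 'a"
    by (rule disintegration_hyp)
  define u where "u \<zeta> = ennreal ((cmod (damp \<rho> F \<zeta>))\<^sup>2)" for \<zeta>
  define v where "v \<zeta> = ennreal ((cmod (damp \<rho> G \<zeta>))\<^sup>2)" for \<zeta>
  have [measurable]: "u \<in> borel_measurable borel" "v \<in> borel_measurable borel"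
    unfolding u_def[abs_def] v_def[abs_def] by measurable
  define P where "P \<xi> \<eta> = (\<integral>\<^sup>+x. ennreal (slab (x \<bullet> sgn \<xi>)) * u (\<eta> + (\<xi> + (x - (x \<bullet> sgn \<xi>) *\<^sub>R sgn \<xi>))) \<partial>lborel)" for \<xi> \<eta>
  have [measurable]: "(\<lambda>p. P (fst p) (snd p)) \<in> borel_measurable (borel \<Otimes>\<^sub>M borel)"
    unfolding P_def[abs_def] by measurable
  define w where "w \<xi> = (norm \<xi> powr (2 * \<sigma>))\<^sup>2 / (2 * norm \<xi>)" for \<xi> :: 'a
  have w0: "w \<xi> \<ge> 0" for \<xi> by (simp add: w_def)
  have [measurable]: "w \<in> borel_measurable borel" unfolding w_def[abs_def] by measurable
  define \<Psi> where "\<Psi> z = ennreal (w (fst z - snd z)) * (v (snd z) * P (fst z - snd z) (snd z))" for z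
  have \<Psi>m [measurable]: "\<Psi> \<in> borel_measurable borel"
  proof -
    have "(\<lambda>z. P (fst z - snd z) (snd z)) \<in> borel_measurable (borel \<Otimes>\<^sub>M borel)"
      using measurable_compose[where f="\<lambda>z::'a \<times> 'a. (fst z - snd z, snd z)" and N="borel \<Otimes>\<^sub>M borel" and g="\<lambda>p. P (fst p) (snd p)" and L=borel and M="borel \<Otimes>\<^sub>M borel"] by simp
    then show ?thesis unfolding \<Psi>_def[abs_def] borel_prod[symmetric] by measurable
  qed
  have "hyp_energy \<sigma> \<rho> F G y = (\<integral>\<^sup>+x'. ennreal (hyp_density (y, x')) * \<Psi> (hyp_param (y, x')) \<partial>lborel)" for y :: "real \<times> 'a"
  proof -
    define \<xi> where "\<xi> = snd y"
    show ?thesis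
    proof (cases "\<xi> = 0")
      case True
      then show ?thesis by (simp add: hyp_energy_def hyp_density_def \<xi>_def)
    next
      case False
      define n where "n = sgn \<xi>"
      have n: "n \<bullet> n = 1" using False by (simp add: n_def norm_sgn norm_eq_1[symmetric])
      \<comment> \<open>\<open>P \<xi> \<eta>\<close> integrates over the hyperplane through \<xi> +
        \<eta> orthogonal to \<xi>. It depends only on the component of \<eta> along \<xi>, so the
        orthogonal displacement \<open>t\<close> is removed by a translation.\<close>
      have Pe: "P \<xi> (hyp_point y x') = (\<integral>\<^sup>+x. ennreal (slab (x \<bullet> n)) * u (\<xi> + hyp_point y x) \<partial>lborel)" for x'
      proof -
        define s where "s = - (fst y + (norm \<xi>)\<^sup>2) / (2 * norm \<xi>)"
        have hp: "hyp_point y x = x + (s - x \<bullet> n) *\<^sub>R n" for x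
          by (simp add: hyp_point_def s_def n_def \<xi>_def)
        define t where "t = x' - (x' \<bullet> n) *\<^sub>R n"
        have tn: "t \<bullet> n = 0" by (simp add: t_def inner_diff_left n)
        have tr: "hyp_point y x' + (\<xi> + (x - (x \<bullet> n) *\<^sub>R n)) = \<xi> + hyp_point y (x + t)" for x
          unfolding hp by (simp add: inner_add_left tn) (simp add: t_def algebra_simps)
        have "P \<xi> (hyp_point y x') = (\<integral>\<^sup>+x. ennreal (slab ((x + t) \<bullet> n)) * u (\<xi> + hyp_point y (x + t)) \<partial>lborel)"
          unfolding P_def n_def[symmetric] tr by (simp add: inner_add_left tn)
        also have "\<dots> = (\<integral>\<^sup>+x. ennreal (slab (x \<bullet> n)) * u (\<xi> + hyp_point y x) \<partial>lborel)"
          by (rule nn_integral_lborel_translate[where f="\<lambda>x. ennreal (slab (x \<bullet> n)) * u (\<xi> + hyp_point y x)"]) measurable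
        finally show ?thesis .
      qed
      define q where "q = norm \<xi> powr (2 * \<sigma>) / (2 * norm \<xi>)"
      have "(\<integral>\<^sup>+x. (\<integral>\<^sup>+x'. ennreal (slab (x \<bullet> sgn (snd y)) * (cmod (damp \<rho> F (snd y + hyp_point y x)))\<^sup>2 *
         (slab (x' \<bullet> sgn (snd y)) * (cmod (damp \<rho> G (hyp_point y x')))\<^sup>2)) \<partial>lborel) \<partial>lborel)
         = (\<integral>\<^sup>+x. (\<integral>\<^sup>+x'. (ennreal (slab (x' \<bullet> n)) * v (hyp_point y x')) * (ennreal (slab (x \<bullet> n)) * u (\<xi> + hyp_point y x)) \<partial>lborel) \<partial>lborel)"
        unfolding u_def v_def n_def \<xi>_def by (intro nn_integral_cong) (simp add: ennreal_mult mult_ac)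
      also have "\<dots> = (\<integral>\<^sup>+x'. (\<integral>\<^sup>+x. (ennreal (slab (x' \<bullet> n)) * v (hyp_point y x')) * (ennreal (slab (x \<bullet> n)) * u (\<xi> + hyp_point y x)) \<partial>lborel) \<partial>lborel)"
        by (subst lborel_pair.Fubini') simp_all
      also have "\<dots> = (\<integral>\<^sup>+x'. (ennreal (slab (x' \<bullet> n)) * v (hyp_point y x')) * P \<xi> (hyp_point y x') \<partial>lborel)"
        unfolding Pe by (intro nn_integral_cong nn_integral_cmult) measurable
      finally have "hyp_energy \<sigma> \<rho> F G y = ennreal (q\<^sup>2) * (\<integral>\<^sup>+x'. (ennreal (slab (x' \<bullet> n)) * v (hyp_point y x')) * P \<xi> (hyp_point y x') \<partial>lborel)"
        unfolding hyp_energy_def by (simp add: q_def \<xi>_def)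
      also have "\<dots> = (\<integral>\<^sup>+x'. ennreal (q\<^sup>2) * ((ennreal (slab (x' \<bullet> n)) * v (hyp_point y x')) * P \<xi> (hyp_point y x')) \<partial>lborel)"
        unfolding Pe by (rule nn_integral_cmult[symmetric]) measurable
      also have "\<dots> = (\<integral>\<^sup>+x'. ennreal (hyp_density (y, x')) * \<Psi> (hyp_param (y, x')) \<partial>lborel)"
      proof (rule nn_integral_cong)
        fix x'
        have "q\<^sup>2 * slab (x' \<bullet> n) = hyp_density (y, x') * w \<xi>"
          unfolding q_def hyp_density_def w_def by (simp add: n_def \<xi>_def power2_eq_square)
        then have "ennreal (q\<^sup>2) * ennreal (slab (x' \<bullet> n)) = ennreal (hyp_density (y, x')) * ennreal (w \<xi>)"
          by (simp add: hyp.\<delta>_nonneg w0 flip: ennreal_mult)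
        moreover have "\<Psi> (hyp_param (y, x')) = ennreal (w \<xi>) * (v (hyp_point y x') * P \<xi> (hyp_point y x'))"
          by (simp add: \<Psi>_def hyp_param_def \<xi>_def)
        ultimately show "ennreal (q\<^sup>2) * ((ennreal (slab (x' \<bullet> n)) * v (hyp_point y x')) * P \<xi> (hyp_point y x')) = ennreal (hyp_density (y, x')) * \<Psi> (hyp_param (y, x'))"
          by (simp only: mult.assoc[symmetric])
      qed
      finally show ?thesis .
    qed
  qed
  then have "(\<integral>\<^sup>+y. hyp_energy \<sigma> \<rho> F G y \<partial>lborel) = (\<integral>\<^sup>+z. \<Psi> z \<partial>lborel)"
    by (simp add: hyp.nn_integral_fibres[OF \<Psi>m])
  also have "\<dots> = (\<integral>\<^sup>+\<eta>. (\<integral>\<^sup>+\<xi>. \<Psi> (\<xi> + \<eta>, \<eta>) \<partial>lborel) \<partial>lborel)"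
    by (rule nn_integral_shear[OF \<Psi>m])
  also have "\<dots> = (\<integral>\<^sup>+\<eta>. (\<integral>\<^sup>+\<xi>. ennreal (sphere_const \<kappa> DIM('a) / 2) * ennreal ((cmod (damp \<rho> F (\<xi> + \<eta>)))\<^sup>2 * (cmod (damp \<rho> G \<eta>))\<^sup>2 * norm \<xi> powr \<kappa>) \<partial>lborel) \<partial>lborel)"
  proof (rule nn_integral_cong)
    fix \<eta> :: 'a
    have [measurable]: "(\<lambda>\<xi>. P \<xi> \<eta>) \<in> borel_measurable borel" unfolding P_def[abs_def] by measurable
    have c: "sphere_const \<kappa> DIM('a) \<ge> 0" by (rule sphere_const_nonneg[OF \<kappa>(2) DIM_positive])
    \<comment> \<open>The exponent \<kappa> - d + 1 = 4 \<sigma> - 1 is the one in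
      \<open>nn_integral_hyperplanes_radial\<close>; at \<xi> = 0 both sides are 0 by the
      conventions for \<open>powr\<close> and division.\<close>
    have w: "w \<xi> = 1/2 * norm \<xi> powr (\<kappa> - real DIM('a) + 1)" for \<xi>
    proof (cases "\<xi> = 0")
      case False
      have "(norm \<xi> powr (2 * \<sigma>))\<^sup>2 = norm \<xi> powr (4 * \<sigma>)"
        by (simp add: power2_eq_square flip: powr_add)
      moreover have "norm \<xi> powr (\<kappa> - real DIM('a) + 1) = norm \<xi> powr (4 * \<sigma>) / norm \<xi>"
      proof -
        have "\<kappa> - real DIM('a) + 1 = 4 * \<sigma> - 1" using \<kappa>(1) by simp
        show ?thesis unfolding \<open>\<kappa> - real DIM('a) + 1 = 4 * \<sigma> - 1\<close> using False by (simp add: powr_diff)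
      qed
      ultimately show ?thesis by (simp add: w_def)
    qed (simp add: w_def)
    have "(\<integral>\<^sup>+\<xi>. \<Psi> (\<xi> + \<eta>, \<eta>) \<partial>lborel) = (\<integral>\<^sup>+\<xi>. (ennreal (1/2) * v \<eta>) * (ennreal (norm \<xi> powr (\<kappa> - real DIM('a) + 1)) * P \<xi> \<eta>) \<partial>lborel)"
      by (rule nn_integral_cong) (simp add: \<Psi>_def w ennreal_mult'' mult_ac del: times_divide_eq_left times_divide_eq_right)
    also have "\<dots> = (ennreal (1/2) * v \<eta>) * (\<integral>\<^sup>+\<xi>. ennreal (norm \<xi> powr (\<kappa> - real DIM('a) + 1)) * P \<xi> \<eta> \<partial>lborel)"
      by (rule nn_integral_cmult) simp
    also have "(\<integral>\<^sup>+\<xi>. ennreal (norm \<xi> powr (\<kappa> - real DIM('a) + 1)) * P \<xi> \<eta> \<partial>lborel)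
       = ennreal (sphere_const \<kappa> DIM('a)) * (\<integral>\<^sup>+q. ennreal (norm q powr \<kappa>) * u (\<eta> + q) \<partial>lborel)"
      unfolding P_def by (rule nn_integral_hyperplanes_radial[where f="\<lambda>q. u (\<eta> + q)", OF _ \<kappa>(2)]) measurable
    also have "(ennreal (1/2) * v \<eta>) * (ennreal (sphere_const \<kappa> DIM('a)) * (\<integral>\<^sup>+q. ennreal (norm q powr \<kappa>) * u (\<eta> + q) \<partial>lborel))
       = (ennreal (1/2) * v \<eta> * ennreal (sphere_const \<kappa> DIM('a))) * (\<integral>\<^sup>+q. ennreal (norm q powr \<kappa>) * u (\<eta> + q) \<partial>lborel)"
      by (simp only: mult.assoc)
    also have "\<dots> = (\<integral>\<^sup>+q. (ennreal (1/2) * v \<eta> * ennreal (sphere_const \<kappa> DIM('a))) * (ennreal (norm q powr \<kappa>) * u (\<eta> + q)) \<partial>lborel)"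
      by (rule nn_integral_cmult[symmetric]) measurable
    also have "\<dots> = (\<integral>\<^sup>+\<xi>. ennreal (sphere_const \<kappa> DIM('a) / 2) * ennreal ((cmod (damp \<rho> F (\<xi> + \<eta>)))\<^sup>2 * (cmod (damp \<rho> G \<eta>))\<^sup>2 * norm \<xi> powr \<kappa>) \<partial>lborel)"
    proof (rule nn_integral_cong)
      fix \<xi> :: 'a
      have e: "ennreal (1/2) * ennreal (sphere_const \<kappa> DIM('a)) = ennreal (sphere_const \<kappa> DIM('a) / 2)"
        using c by (subst ennreal_mult[symmetric]) auto
      show "(ennreal (1/2) * v \<eta> * ennreal (sphere_const \<kappa> DIM('a))) * (ennreal (norm \<xi> powr \<kappa>) * u (\<eta> + \<xi>))
        = ennreal (sphere_const \<kappa> DIM('a) / 2) * ennreal ((cmod (damp \<rho> F (\<xi> + \<eta>)))\<^sup>2 * (cmod (damp \<rho> G \<eta>))\<^sup>2 * norm \<xi> powr \<kappa>)"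
        unfolding e[symmetric] u_def v_def by (simp add: ennreal_mult add.commute[of \<eta>] mult_ac)
    qed
    finally show "(\<integral>\<^sup>+\<xi>. \<Psi> (\<xi> + \<eta>, \<eta>) \<partial>lborel) = (\<integral>\<^sup>+\<xi>. ennreal (sphere_const \<kappa> DIM('a) / 2) * ennreal ((cmod (damp \<rho> F (\<xi> + \<eta>)))\<^sup>2 * (cmod (damp \<rho> G \<eta>))\<^sup>2 * norm \<xi> powr \<kappa>) \<partial>lborel)" .
  qed
  also have "\<dots> = ennreal (sphere_const \<kappa> DIM('a) / 2) * (\<integral>\<^sup>+\<eta>. (\<integral>\<^sup>+\<xi>. ennreal ((cmod (damp \<rho> F (\<xi> + \<eta>)))\<^sup>2 * (cmod (damp \<rho> G \<eta>))\<^sup>2 * norm \<xi> powr \<kappa>) \<partial>lborel) \<partial>lborel)"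
    by (simp add: nn_integral_cmult)
  also have "(\<integral>\<^sup>+\<eta>. (\<integral>\<^sup>+\<xi>. ennreal ((cmod (damp \<rho> F (\<xi> + \<eta>)))\<^sup>2 * (cmod (damp \<rho> G \<eta>))\<^sup>2 * norm \<xi> powr \<kappa>) \<partial>lborel) \<partial>lborel) = pair_energy \<kappa> \<rho> F G"
    unfolding pair_energy_def by (subst nn_integral_shear) simp_all
  finally show ?thesis .
qed

definition sphere_area :: "nat \<Rightarrow> real" where
  "sphere_area d = 2 * pi powr (real d / 2) / Gamma (real d / 2)"

lemma sphere_area_pos: "d > 0 \<Longrightarrow> sphere_area d > 0"
  unfolding sphere_area_def by (intro divide_pos_pos mult_pos_pos Gamma_real_pos) auto

text \<open>The right-hand side of the Cauchy--Schwarz inequality on the fibre; the factor in front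
  is the total mass of the fibre by \<open>nn_integral_sph_density\<close>.\<close>

definition sph_energy :: "real \<Rightarrow> real \<Rightarrow> ('a::euclidean_space \<Rightarrow> complex) \<Rightarrow> ('a \<Rightarrow> complex) \<Rightarrow> real \<times> 'a \<Rightarrow> ennreal" where
  "sph_energy \<beta> \<rho> F G y = ennreal (sphere_area DIM('a) * sph_factor y) *
     (\<integral>\<^sup>+x. ennreal (sph_density (y, x)) * ennreal ((cmod (sph_data \<beta> \<rho> F G (sph_param (y, x))))\<^sup>2) \<partial>lborel)"

context
  fixes F G :: "'a::euclidean_space \<Rightarrow> complex" and \<beta> :: real
  assumes d: "DIM('a) \<ge> 2"
    and [measurable]: "F \<in> borel_measurable borel" and [measurable]: "G \<in> borel_measurable borel"
begin

interpretation sph: disintegration sph_density sph_param "sph_proj :: 'a \<times> 'a \<Rightarrow> real \<times> 'a"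
  by (rule disintegration_sph[OF d])

lemma nn_integral_sph_density:
  fixes y :: "real \<times> 'a"
  shows "(\<integral>\<^sup>+x. ennreal (sph_density (y, x)) \<partial>lborel) = ennreal (sphere_area DIM('a) * sph_factor y)"
proof -
  have "(\<integral>\<^sup>+x. ennreal (sph_density (y, x)) \<partial>lborel) = (\<integral>\<^sup>+(x::'a). ennreal (sph_factor y) * ennreal (sphere_weight x) \<partial>lborel)"
  proof (rule nn_integral_cong_AE)
    show "AE x in lborel. ennreal (sph_density (y, x)) = ennreal (sph_factor y) * ennreal (sphere_weight x)"
      using AE_lborel_singleton[of "0::'a"] by eventually_elim (simp add: sph_density_def ennreal_mult)
  qed
  also have "\<dots> = ennreal (sph_factor y) * ennreal (sphere_area DIM('a))"
    using nn_integral_sphere_weight[where 'a='a] by (simp add: nn_integral_cmult sphere_area_def)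
  finally show ?thesis using sphere_area_pos[of "DIM('a)"] by (simp add: ennreal_mult mult.commute)
qed

lemma sph_fibre_le_energy:
  "ennreal ((cmod (sph.fibre_integral (sph_data \<beta> \<rho> F G) y))\<^sup>2) \<le> sph_energy \<beta> \<rho> F G y"
  unfolding sph.fibre_integral_def sph_energy_def nn_integral_sph_density[symmetric]
  by (rule Cauchy_Schwarz_weighted) (simp_all add: sph.\<delta>_nonneg)

lemma sph_data_scale:
  assumes "sph_density (y, x) \<noteq> 0"
  shows "sph_data \<beta> \<rho>2 F G (sph_param (y, x)) = exp ((\<rho>2 - \<rho>1) * fst y) *\<^sub>R sph_data \<beta> \<rho>1 F G (sph_param (y, x))"
proof -
  define z where "z = sph_param (y, x)"
  have "sph_proj z = y" unfolding z_def using sph.\<pi>_\<Phi>[OF assms] .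
  then have y: "fst y = - ((norm (fst z))\<^sup>2 + (norm (snd z))\<^sup>2)" by (auto simp: sph_proj_def)
  have "exp (- \<rho>2 * (norm (fst z))\<^sup>2) * exp (- \<rho>2 * (norm (snd z))\<^sup>2) = exp ((\<rho>2 - \<rho>1) * fst y) * (exp (- \<rho>1 * (norm (fst z))\<^sup>2) * exp (- \<rho>1 * (norm (snd z))\<^sup>2))"
    unfolding y mult_exp_exp by (simp add: algebra_simps)
  then have "complex_of_real (exp (- \<rho>2 * (norm (fst z))\<^sup>2)) * of_real (exp (- \<rho>2 * (norm (snd z))\<^sup>2)) = of_real (exp ((\<rho>2 - \<rho>1) * fst y)) * (of_real (exp (- \<rho>1 * (norm (fst z))\<^sup>2)) * of_real (exp (- \<rho>1 * (norm (snd z))\<^sup>2)))"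
    unfolding of_real_mult[symmetric] by simp
  then have "complex_of_real (norm (fst z - snd z) powr (2 * \<beta>)) * (F (fst z) * G (snd z)) * (complex_of_real (exp (- \<rho>2 * (norm (fst z))\<^sup>2)) * of_real (exp (- \<rho>2 * (norm (snd z))\<^sup>2))) = complex_of_real (norm (fst z - snd z) powr (2 * \<beta>)) * (F (fst z) * G (snd z)) * (of_real (exp ((\<rho>2 - \<rho>1) * fst y)) * (of_real (exp (- \<rho>1 * (norm (fst z))\<^sup>2)) * of_real (exp (- \<rho>1 * (norm (snd z))\<^sup>2))))"
    by (rule arg_cong)
  then show ?thesis
    unfolding sph_data_def damp_def z_def[symmetric] scaleR_conv_of_real by (simp only: mult_ac)
qed

lemma sph_energy_antimono:
  assumes \<rho>: "\<rho>1 \<le> \<rho>2"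
  shows "sph_energy \<beta> \<rho>2 F G y + ennreal ((cmod (sph.fibre_integral (sph_data \<beta> \<rho>1 F G) y))\<^sup>2)
      \<le> sph_energy \<beta> \<rho>1 F G y + ennreal ((cmod (sph.fibre_integral (sph_data \<beta> \<rho>2 F G) y))\<^sup>2)"
proof -
  \<comment> \<open>Where the radius is not positive the fibre is empty and \<tau> may be positive;
    the value 0 keeps \<open>m\<close> at most 1 there.\<close>
  define m where "m = (if sph_radius y > 0 then exp ((\<rho>2 - \<rho>1) * fst y) else 0)"
  have m: "0 \<le> m" "m \<le> 1"
  proof -
    have "fst y \<le> 0" if "sph_radius y > 0"
      using that zero_le_power2[of "norm (snd y)"] unfolding sph_radius_def real_sqrt_gt_0_iff by linarith
    then show "0 \<le> m" "m \<le> 1" using \<rho> by (auto simp: m_def mult_nonneg_nonpos)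
  qed
  have sc: "sph_density (y, x) *\<^sub>R sph_data \<beta> \<rho>2 F G (sph_param (y, x)) = m *\<^sub>R (sph_density (y, x) *\<^sub>R sph_data \<beta> \<rho>1 F G (sph_param (y, x)))" for x
  proof (cases "sph_density (y, x) = 0")
    case False
    then have "sph_radius y > 0" by (auto simp: sph_density_def sph_factor_def split: split_indicator_asm)
    then show ?thesis using sph_data_scale[OF False, of \<rho>2 \<rho>1] by (simp add: m_def)
  qed simp
  have 1: "sph.fibre_integral (sph_data \<beta> \<rho>2 F G) y = m *\<^sub>R sph.fibre_integral (sph_data \<beta> \<rho>1 F G) y"
    unfolding sph.fibre_integral_def sc by (rule integral_scaleR_right)
  have 2: "sph_energy \<beta> \<rho>2 F G y = ennreal (m\<^sup>2) * sph_energy \<beta> \<rho>1 F G y"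
  proof -
    have "ennreal (sph_density (y, x)) * ennreal ((cmod (sph_data \<beta> \<rho>2 F G (sph_param (y, x))))\<^sup>2)
      = ennreal (m\<^sup>2) * (ennreal (sph_density (y, x)) * ennreal ((cmod (sph_data \<beta> \<rho>1 F G (sph_param (y, x))))\<^sup>2))" for x
    proof (cases "sph_density (y, x) = 0")
      case False
      then have "sph_data \<beta> \<rho>2 F G (sph_param (y, x)) = m *\<^sub>R sph_data \<beta> \<rho>1 F G (sph_param (y, x))"
        using sc[of x] by (metis scaleR_left_imp_eq scaleR_left_commute)
      then show ?thesis using m by (simp add: power_mult_distrib ennreal_mult mult_ac)
    qed simp
    then have "sph_energy \<beta> \<rho>2 F G y = ennreal (sphere_area DIM('a) * sph_factor y) *
       (\<integral>\<^sup>+x. ennreal (m\<^sup>2) * (ennreal (sph_density (y, x)) * ennreal ((cmod (sph_data \<beta> \<rho>1 F G (sph_param (y, x))))\<^sup>2)) \<partial>lborel)"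
      unfolding sph_energy_def by simp
    also have "\<dots> = ennreal (m\<^sup>2) * sph_energy \<beta> \<rho>1 F G y"
      unfolding sph_energy_def by (subst nn_integral_cmult) (simp_all add: mult_ac)
    finally show ?thesis .
  qed
  define K where "K = cmod (sph.fibre_integral (sph_data \<beta> \<rho>1 F G) y)"
  have K0: "K \<ge> 0" by (simp add: K_def)
  have le: "ennreal (K\<^sup>2) \<le> sph_energy \<beta> \<rho>1 F G y" unfolding K_def by (rule sph_fibre_le_energy)
  show ?thesis
  proof (cases "sph_energy \<beta> \<rho>1 F G y")
    case (real J)
    have JK: "K\<^sup>2 \<le> J" using le real by simp
    \<comment> \<open>What has to be shown amounts to (1 - m^2) (J - K^2) \<ge> 0.\<close>
    have "m\<^sup>2 \<le> 1" using m by (simp add: power_le_one)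
    then have "(1 - m\<^sup>2) * K\<^sup>2 \<le> (1 - m\<^sup>2) * J" using JK by (intro mult_left_mono) auto
    then have "m\<^sup>2 * J + K\<^sup>2 \<le> J + m\<^sup>2 * K\<^sup>2" by (simp add: algebra_simps)
    then have "ennreal (m\<^sup>2 * J + K\<^sup>2) \<le> ennreal (J + m\<^sup>2 * K\<^sup>2)" by (rule ennreal_leI)
    then show ?thesis
      unfolding 1 2 using real m by (simp add: K_def[symmetric] power_mult_distrib ennreal_mult)
  next
    case top
    then show ?thesis by simp
  qed
qed

text \<open>The mass of a fibre is a function of its radius |\<zeta> - \<eta>| and may therefore be
  moved into the integrand on pairs; the exponents d - 2 from the mass and 4 \<beta> from the
  squared data add up to \<kappa>.\<close>

lemma nn_integral_sph_energy:
  assumes \<kappa>: "\<kappa> = 4 * \<beta> + real DIM('a) - 2"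
  shows "(\<integral>\<^sup>+y. sph_energy \<beta> \<rho> F G y \<partial>lborel) = ennreal (sphere_area DIM('a) * (1/2) ^ DIM('a)) * pair_energy \<kappa> \<rho> F G"
proof -
  define C where "C = sphere_area DIM('a) * (1/2) ^ DIM('a)"
  have C: "C \<ge> 0" using sphere_area_pos[of "DIM('a)"] by (simp add: C_def)
  define \<Psi> where "\<Psi> z = ennreal (C * norm (fst z - snd z) ^ (DIM('a) - 2)) * ennreal ((cmod (sph_data \<beta> \<rho> F G z))\<^sup>2)" for z
  have \<Psi>m [measurable]: "\<Psi> \<in> borel_measurable borel"
    unfolding \<Psi>_def[abs_def] by measurable
  have "sph_energy \<beta> \<rho> F G y = (\<integral>\<^sup>+x. ennreal (sph_density (y, x)) * \<Psi> (sph_param (y, x)) \<partial>lborel)" for y :: "real \<times> 'a"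
  proof -
    have "sph_energy \<beta> \<rho> F G y = (\<integral>\<^sup>+x. ennreal (sphere_area DIM('a) * sph_factor y) * (ennreal (sph_density (y, x)) * ennreal ((cmod (sph_data \<beta> \<rho> F G (sph_param (y, x))))\<^sup>2)) \<partial>lborel)"
      unfolding sph_energy_def by (rule nn_integral_cmult[symmetric]) measurable
    also have "\<dots> = (\<integral>\<^sup>+x. ennreal (sph_density (y, x)) * \<Psi> (sph_param (y, x)) \<partial>lborel)"
    proof (rule nn_integral_cong)
      fix x :: 'a
      show "ennreal (sphere_area DIM('a) * sph_factor y) * (ennreal (sph_density (y, x)) * ennreal ((cmod (sph_data \<beta> \<rho> F G (sph_param (y, x))))\<^sup>2)) = ennreal (sph_density (y, x)) * \<Psi> (sph_param (y, x))"
      proof (cases "sph_density (y, x) = 0")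
        case False
        then have r: "sph_radius y > 0" "x \<noteq> 0" by (auto simp: sph_density_def sph_factor_def split: split_indicator_asm)
        have "sphere_area DIM('a) * sph_factor y = C * norm (fst (sph_param (y, x)) - snd (sph_param (y, x))) ^ (DIM('a) - 2)"
          unfolding sph_proj_param(2)[OF r] using r by (simp add: C_def sph_factor_def)
        then show ?thesis unfolding \<Psi>_def by (simp add: mult_ac)
      qed simp
    qed
    finally show ?thesis .
  qed
  then have "(\<integral>\<^sup>+y. sph_energy \<beta> \<rho> F G y \<partial>lborel) = (\<integral>\<^sup>+z. \<Psi> z \<partial>lborel)"
    by (simp add: sph.nn_integral_fibres[OF \<Psi>m])
  also have "\<dots> = (\<integral>\<^sup>+z. ennreal C * ennreal ((cmod (damp \<rho> F (fst z)))\<^sup>2 * (cmod (damp \<rho> G (snd z)))\<^sup>2 * norm (fst z - snd z) powr \<kappa>) \<partial>lborel)"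
  proof (rule nn_integral_cong)
    fix z :: "'a \<times> 'a"
    define r where "r = norm (fst z - snd z)"
    have r0: "r \<ge> 0" by (simp add: r_def)
    \<comment> \<open>For r = 0 both sides are 0, because 0 raised to any power by
      \<open>powr\<close> is 0.\<close>
    have "r ^ (DIM('a) - 2) * (r powr (2 * \<beta>))\<^sup>2 = r powr \<kappa>"
    proof (cases "r = 0")
      case False
      with r0 have "r > 0" by simp
      then have "r ^ (DIM('a) - 2) = r powr (real DIM('a) - 2)"
        using d by (subst powr_realpow[symmetric]) (auto simp: of_nat_diff)
      moreover have "(r powr (2 * \<beta>))\<^sup>2 = r powr (4 * \<beta>)" by (simp add: power2_eq_square flip: powr_add)
      ultimately show ?thesis unfolding \<kappa> by (simp add: algebra_simps flip: powr_add)
    qed simp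
    then have "C * r ^ (DIM('a) - 2) * (cmod (sph_data \<beta> \<rho> F G z))\<^sup>2 = C * ((cmod (damp \<rho> F (fst z)))\<^sup>2 * (cmod (damp \<rho> G (snd z)))\<^sup>2 * r powr \<kappa>)"
      unfolding sph_data_def r_def[symmetric] by (simp add: norm_mult power_mult_distrib)
    then show "\<Psi> z = ennreal C * ennreal ((cmod (damp \<rho> F (fst z)))\<^sup>2 * (cmod (damp \<rho> G (snd z)))\<^sup>2 * norm (fst z - snd z) powr \<kappa>)"
      unfolding \<Psi>_def r_def[symmetric] using C r0 by (simp add: ennreal_mult[symmetric] del: ennreal_mult)
  qed
  also have "\<dots> = ennreal C * pair_energy \<kappa> \<rho> F G"
    unfolding pair_energy_def by (rule nn_integral_cmult) measurable
  finally show ?thesis unfolding C_def .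
qed

end

section \<open>Integrability of the weighted data\<close>

lemma pair_energy_mono:
  assumes "0 \<le> \<rho>"
  shows "pair_energy \<kappa> \<rho> F G \<le> pair_energy \<kappa> 0 F G"
proof -
  have "(cmod (damp \<rho> F z))\<^sup>2 \<le> (cmod (damp 0 F z))\<^sup>2" for F :: "'b::euclidean_space \<Rightarrow> complex" and z
    using assms by (intro power_mono) (auto simp: cmod_damp mult_left_le_one_le)
  then show ?thesis
    unfolding pair_energy_def by (intro nn_integral_mono ennreal_leI mult_mono mult_nonneg_nonneg) auto
qed

text \<open>The Jacobian r^(d-1) of polar coordinates leaves the integrand r, which is at most 1 on
  the unit interval.\<close>

lemma nn_integral_norm_powr_near_0:
  assumes d: "DIM('a::euclidean_space) \<ge> 2"
  shows "(\<integral>\<^sup>+(q::'a). ennreal (indicator (cball 0 1) q * norm q powr (2 - real DIM('a))) \<partial>lborel) < \<infinity>"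
proof -
  let ?d = "DIM('a)"
  let ?g = "\<lambda>q::'a. ennreal (indicator (cball 0 1) q * norm q powr (2 - real ?d))"
  have "(\<integral>\<^sup>+q. ?g q \<partial>lborel) = (\<integral>\<^sup>+(y::'a). ennreal (sphere_weight y) * (\<integral>\<^sup>+r. indicator {0<..} r * ennreal (r ^ (?d - 1)) * ?g (r *\<^sub>R sgn y) \<partial>lborel) \<partial>lborel)"
    by (rule nn_integral_polar) measurable
  also have "\<dots> \<le> (\<integral>\<^sup>+(y::'a). ennreal (sphere_weight y) * 1 \<partial>lborel)"
  proof (rule nn_integral_mono_AE)
    show "AE y in lborel. ennreal (sphere_weight y) * (\<integral>\<^sup>+r. indicator {0<..} r * ennreal (r ^ (?d - 1)) * ?g (r *\<^sub>R sgn y) \<partial>lborel) \<le> ennreal (sphere_weight y) * 1"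
      using AE_lborel_singleton[of "0::'a"]
    proof eventually_elim
      case (elim y)
      have "(\<integral>\<^sup>+r. indicator {0<..} r * ennreal (r ^ (?d - 1)) * ?g (r *\<^sub>R sgn y) \<partial>lborel) \<le> (\<integral>\<^sup>+(r::real). indicator {0..1} r \<partial>lborel)"
      proof (rule nn_integral_mono)
        fix r :: real
        show "indicator {0<..} r * ennreal (r ^ (?d - 1)) * ?g (r *\<^sub>R sgn y) \<le> indicator {0..1} r"
        proof (cases "0 < r \<and> r \<le> 1")
          case True
          have "r ^ (?d - 1) = r powr (real ?d - 1)"
            using True d by (subst powr_realpow[symmetric]) (auto simp: of_nat_diff)
          then have "r ^ (?d - 1) * r powr (2 - real ?d) = r" using True by (simp flip: powr_add)
          then show ?thesis using True elim by (simp add: norm_sgn flip: ennreal_mult)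
        next
          case False
          then show ?thesis using elim by (auto simp: norm_sgn indicator_def)
        qed
      qed
      also have "\<dots> = 1" by simp
      finally show ?case by (intro mult_left_mono) auto
    qed
  qed
  also have "\<dots> < \<infinity>" using nn_integral_sphere_weight[where 'a='a] by simp
  finally show ?thesis .
qed

text \<open>For |\<xi>| \<le> 1 the Gaussian in \<xi> + \<eta> is dropped and the singularity is
  integrated; for |\<xi>| > 1 the power is at most 1, since the exponent 2 - d is not positive, and
  the Gaussian remains.\<close>

lemma nn_integral_gaussian_norm_powr:
  assumes d: "DIM('a::euclidean_space) \<ge> 2" and a: "a > 0"
  shows "(\<integral>\<^sup>+(z::'a \<times> 'a). ennreal (exp (- a * (norm (fst z))\<^sup>2) * exp (- a * (norm (snd z))\<^sup>2) * norm (fst z - snd z) powr (2 - real DIM('a))) \<partial>lborel) < \<infinity>"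
proof -
  let ?p = "2 - real DIM('a)"
  define N where "N = (\<integral>\<^sup>+(q::'a). ennreal (indicator (cball 0 1) q * norm q powr ?p) \<partial>lborel)"
  define S where "S = (\<integral>\<^sup>+(x::'a). ennreal (exp (- a * (norm x)\<^sup>2)) \<partial>lborel)"
  have fin: "N < \<infinity>" "S < \<infinity>"
    unfolding N_def S_def using nn_integral_norm_powr_near_0[OF d] nn_integral_gaussian[OF a, where 'a='a] by simp_all
  have "(\<integral>\<^sup>+(z::'a \<times> 'a). ennreal (exp (- a * (norm (fst z))\<^sup>2) * exp (- a * (norm (snd z))\<^sup>2) * norm (fst z - snd z) powr ?p) \<partial>lborel)
     = (\<integral>\<^sup>+(\<eta>::'a). (\<integral>\<^sup>+(\<xi>::'a). ennreal (exp (- a * (norm (\<xi> + \<eta>))\<^sup>2) * exp (- a * (norm \<eta>)\<^sup>2) * norm \<xi> powr ?p) \<partial>lborel) \<partial>lborel)"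
    by (subst nn_integral_shear) simp_all
  also have "\<dots> \<le> (\<integral>\<^sup>+(\<eta>::'a). (\<integral>\<^sup>+(\<xi>::'a). ennreal (exp (- a * (norm \<eta>)\<^sup>2)) * (ennreal (indicator (cball 0 1) \<xi> * norm \<xi> powr ?p) + ennreal (exp (- a * (norm (\<xi> + \<eta>))\<^sup>2))) \<partial>lborel) \<partial>lborel)"
  proof (intro nn_integral_mono)
    fix \<eta> \<xi> :: 'a
    have "exp (- a * (norm (\<xi> + \<eta>))\<^sup>2) * norm \<xi> powr ?p \<le> indicator (cball 0 1) \<xi> * norm \<xi> powr ?p + exp (- a * (norm (\<xi> + \<eta>))\<^sup>2)"
    proof (cases "norm \<xi> \<le> 1")
      case True
      have "exp (- a * (norm (\<xi> + \<eta>))\<^sup>2) * norm \<xi> powr ?p \<le> 1 * norm \<xi> powr ?p" using a by (intro mult_right_mono) auto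
      with True show ?thesis by (simp add: add_increasing2)
    next
      case False
      then have "norm \<xi> powr ?p \<le> norm \<xi> powr 0" using d by (intro powr_mono) auto
      also have "\<dots> = 1" using False by (cases "\<xi> = 0") auto
      finally show ?thesis using False by (simp add: mult_left_le)
    qed
    from mult_left_mono[OF this, of "exp (- a * (norm \<eta>)\<^sup>2)"]
    have "ennreal (exp (- a * (norm (\<xi> + \<eta>))\<^sup>2) * exp (- a * (norm \<eta>)\<^sup>2) * norm \<xi> powr ?p) \<le> ennreal (exp (- a * (norm \<eta>)\<^sup>2) * (indicator (cball 0 1) \<xi> * norm \<xi> powr ?p + exp (- a * (norm (\<xi> + \<eta>))\<^sup>2)))"
      by (intro ennreal_leI) (simp add: mult_ac)
    then show "ennreal (exp (- a * (norm (\<xi> + \<eta>))\<^sup>2) * exp (- a * (norm \<eta>)\<^sup>2) * norm \<xi> powr ?p) \<le> ennreal (exp (- a * (norm \<eta>)\<^sup>2)) * (ennreal (indicator (cball 0 1) \<xi> * norm \<xi> powr ?p) + ennreal (exp (- a * (norm (\<xi> + \<eta>))\<^sup>2)))"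
      by (simp add: ennreal_mult)
  qed
  also have "\<dots> = (\<integral>\<^sup>+(\<eta>::'a). ennreal (exp (- a * (norm \<eta>)\<^sup>2)) * (N + S) \<partial>lborel)"
  proof (rule nn_integral_cong)
    fix \<eta> :: 'a
    have "(\<integral>\<^sup>+(\<xi>::'a). ennreal (exp (- a * (norm (\<xi> + \<eta>))\<^sup>2)) \<partial>lborel) = S"
      unfolding S_def by (rule nn_integral_lborel_translate[where f="\<lambda>x. ennreal (exp (- a * (norm x)\<^sup>2))"]) measurable
    then show "(\<integral>\<^sup>+(\<xi>::'a). ennreal (exp (- a * (norm \<eta>)\<^sup>2)) * (ennreal (indicator (cball 0 1) \<xi> * norm \<xi> powr ?p) + ennreal (exp (- a * (norm (\<xi> + \<eta>))\<^sup>2))) \<partial>lborel) = ennreal (exp (- a * (norm \<eta>)\<^sup>2)) * (N + S)"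
      unfolding N_def by (subst nn_integral_cmult, measurable, subst nn_integral_add, measurable)
  qed
  also have "\<dots> = S * (N + S)"
    unfolding S_def by (rule nn_integral_multc) measurable
  also have "\<dots> < \<infinity>" using fin by (simp add: ennreal_mult_less_top)
  finally show ?thesis .
qed

text \<open>The exponent splits as 2 \<sigma> = \<kappa> / 2 + (2 - d) / 2, and a product is at most
  the sum of the squares of its factors. The factor with \<open>F\<close> and \<open>G\<close> gives
  the energy without damping, which is finite; the factor with the heat weights gives the integral
  of \<open>nn_integral_gaussian_norm_powr\<close>.\<close>

lemma pair_data_integrable:
  fixes F G :: "'a::euclidean_space \<Rightarrow> complex" and f :: "'a \<times> 'a \<Rightarrow> complex"
  assumes d: "DIM('a) \<ge> 2"
    and [measurable]: "F \<in> borel_measurable borel" "G \<in> borel_measurable borel" "f \<in> borel_measurable borel"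
    and \<kappa>: "\<kappa> = 4 * \<sigma> + real DIM('a) - 2" and fin: "pair_energy \<kappa> 0 F G < \<infinity>" and \<rho>: "\<rho> > 0"
    and f: "\<And>z. cmod (f z) = norm (fst z - snd z) powr (2 * \<sigma>) * (cmod (damp \<rho> F (fst z)) * cmod (damp \<rho> G (snd z)))"
  shows "integrable lborel f"
proof -
  let ?e = "\<lambda>z::'a \<times> 'a. ennreal ((cmod (damp 0 F (fst z)))\<^sup>2 * (cmod (damp 0 G (snd z)))\<^sup>2 * norm (fst z - snd z) powr \<kappa>)"
  let ?g = "\<lambda>z::'a \<times> 'a. ennreal (exp (- (2 * \<rho>) * (norm (fst z))\<^sup>2) * exp (- (2 * \<rho>) * (norm (snd z))\<^sup>2) * norm (fst z - snd z) powr (2 - real DIM('a)))"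
  have "(\<integral>\<^sup>+z. ennreal (cmod (f z)) \<partial>lborel) \<le> (\<integral>\<^sup>+z. ?e z + ?g z \<partial>lborel)"
  proof (rule nn_integral_mono)
    fix z :: "'a \<times> 'a"
    define r where "r = norm (fst z - snd z)"
    define A where "A = cmod (F (fst z)) * cmod (G (snd z))"
    define E where "E = exp (- \<rho> * (norm (fst z))\<^sup>2) * exp (- \<rho> * (norm (snd z))\<^sup>2)"
    have A0: "A \<ge> 0" and E0: "E \<ge> 0" and r0: "r \<ge> 0" by (simp_all add: A_def E_def r_def)
    have E2: "E\<^sup>2 = exp (- (2 * \<rho>) * (norm (fst z))\<^sup>2) * exp (- (2 * \<rho>) * (norm (snd z))\<^sup>2)"
      by (simp add: E_def power_mult_distrib exp_double[symmetric] mult.assoc)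
    have fz: "cmod (f z) = r powr (2 * \<sigma>) * (A * E)"
      unfolding f cmod_damp by (simp add: r_def A_def E_def mult_ac)
    have "r powr (2 * \<sigma>) * (A * E) \<le> A\<^sup>2 * r powr \<kappa> + E\<^sup>2 * r powr (2 - real DIM('a))"
    proof (cases "r = 0")
      case False
      define s where "s = r powr (\<kappa> / 2)"
      define t where "t = r powr ((2 - real DIM('a)) / 2)"
      have st: "s * t = r powr (2 * \<sigma>)" unfolding s_def t_def \<kappa> by (simp add: field_simps flip: powr_add)
      have s2: "s\<^sup>2 = r powr \<kappa>" "t\<^sup>2 = r powr (2 - real DIM('a))"
        unfolding s_def t_def by (simp_all add: power2_eq_square flip: powr_add)
      have "0 \<le> (A * s) * (E * t)" using A0 E0 by (simp add: s_def t_def)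
      then have "(A * s) * (E * t) \<le> (A * s)\<^sup>2 + (E * t)\<^sup>2"
        using sum_squares_bound[of "A * s" "E * t"] unfolding mult.assoc by linarith
      then show ?thesis unfolding st[symmetric] s2[symmetric] by (simp add: power_mult_distrib mult_ac)
    qed simp
    then have "ennreal (cmod (f z)) \<le> ennreal (A\<^sup>2 * r powr \<kappa> + E\<^sup>2 * r powr (2 - real DIM('a)))"
      unfolding fz by (rule ennreal_leI)
    also have "\<dots> = ?e z + ?g z"
      unfolding E2[symmetric] by (simp add: cmod_damp A_def r_def power_mult_distrib)
    finally show "ennreal (cmod (f z)) \<le> ?e z + ?g z" .
  qed
  also have "\<dots> = pair_energy \<kappa> 0 F G + (\<integral>\<^sup>+z. ?g z \<partial>lborel)"
    unfolding pair_energy_def by (rule nn_integral_add) measurable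
  also have "\<dots> < \<infinity>"
    using fin nn_integral_gaussian_norm_powr[OF d, of "2 * \<rho>"] \<rho> by simp
  finally show ?thesis by (simp add: integrable_iff_bounded)
qed

lemma
  fixes F G :: "'a::euclidean_space \<Rightarrow> complex"
  assumes "DIM('a) \<ge> 2" "F \<in> borel_measurable borel" "G \<in> borel_measurable borel"
    and "\<kappa> = 4 * \<sigma> + real DIM('a) - 2" and "pair_energy \<kappa> 0 F G < \<infinity>" and "\<rho> > 0"
  shows integrable_hyp_data: "integrable lborel (hyp_data \<sigma> \<rho> F G)"
    and integrable_sph_data: "integrable lborel (sph_data \<sigma> \<rho> F G)"
proof -
  note [measurable] = assms(2,3)
  show "integrable lborel (hyp_data \<sigma> \<rho> F G)"
    by (rule pair_data_integrable[OF assms(1-3) _ assms(4-6)]) (simp_all add: hyp_data_def norm_mult)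
  show "integrable lborel (sph_data \<sigma> \<rho> F G)"
    by (rule pair_data_integrable[OF assms(1-3) _ assms(4-6)]) (simp_all add: sph_data_def norm_mult)
qed

subsection \<open>The functionals in the theorem\<close>

lemma inverse_power_mult_self: "1 / x ^ n * (1 / x ^ n) = 1 / (x::real) ^ (2 * n)"
  by (simp add: power_even_eq power2_eq_square)

lemma lborel_times_integral:
  fixes f :: "'a::euclidean_space \<Rightarrow> complex" and g :: "'b::euclidean_space \<Rightarrow> complex"
  assumes f: "integrable lborel f" and g: "integrable lborel g"
  shows "integrable lborel (\<lambda>z. f (fst z) * g (snd z))"
    and "(\<integral>z. f (fst z) * g (snd z) \<partial>lborel) = (\<integral>x. f x \<partial>lborel) * (\<integral>y. g y \<partial>lborel)"
proof -
  have [measurable]: "f \<in> borel_measurable borel" "g \<in> borel_measurable borel"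
    using borel_measurable_integrable[OF f] borel_measurable_integrable[OF g] by auto
  have i: "integrable (lborel \<Otimes>\<^sub>M lborel) (\<lambda>z. f (fst z) * g (snd z))"
    by (rule lborel_pair.Fubini_integrable) (use f g in \<open>auto simp: norm_mult\<close>)
  then show "integrable lborel (\<lambda>z. f (fst z) * g (snd z))" by (simp add: lborel_prod)
  show "(\<integral>z. f (fst z) * g (snd z) \<partial>lborel) = (\<integral>x. f x \<partial>lborel) * (\<integral>y. g y \<partial>lborel)"
    using lborel_pair.integral_fst'[OF i] by (simp add: lborel_prod)
qed

lemma inverse_fourier_integral_cong_AE:
  assumes "AE \<xi> in lborel. F \<xi> = G \<xi>"
    and [measurable]: "F \<in> borel_measurable borel" "G \<in> borel_measurable borel"
  shows "inverse_fourier_integral F x = inverse_fourier_integral G x"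
  unfolding inverse_fourier_integral_def
  by (rule arg_cong[where f="scaleR _"], rule integral_cong_AE) (use assms(1) in \<open>auto elim: eventually_mono\<close>)

lemma inverse_fourier_integral_scaleR:
  "inverse_fourier_integral (\<lambda>\<xi>. c *\<^sub>R F \<xi>) x = c *\<^sub>R inverse_fourier_integral F x"
  by (simp add: inverse_fourier_integral_def)

text \<open>\<open>fourier\<close> returns some representative of the transform, determined only up
  to null sets, which the inversion integral does not see.\<close>

lemma fourier_multiplier_inverse:
  fixes H :: "'a::euclidean_space \<Rightarrow> complex"
  assumes H: "integrable lborel H" and [measurable]: "m \<in> borel_measurable borel"
  shows "fourier_multiplier m (inverse_fourier_integral H) = inverse_fourier_integral (\<lambda>\<xi>. m \<xi> * H \<xi>)"
proof
  fix x
  have [measurable]: "H \<in> borel_measurable borel" using borel_measurable_integrable[OF H] by simp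
  have [measurable]: "fourier (inverse_fourier_integral H) \<in> borel_measurable borel"
    using fourier_inverse_AE(2)[OF H] by (simp add: has_fourier_transform_def)
  show "fourier_multiplier m (inverse_fourier_integral H) x = inverse_fourier_integral (\<lambda>\<xi>. m \<xi> * H \<xi>) x"
    unfolding fourier_multiplier_def
    by (rule inverse_fourier_integral_cong_AE) (use fourier_inverse_AE(1)[OF H] in \<open>auto elim: eventually_mono\<close>)
qed

lemma heat_eq: "heat \<rho> f = inverse_fourier_integral (damp \<rho> (fourier f))"
  by (rule ext) (simp add: heat_def fourier_multiplier_def damp_def[abs_def])

lemma heat_solution_eq:
  "heat_solution \<rho> f t = inverse_fourier_integral (\<lambda>\<xi>. damp \<rho> (fourier f) \<xi> * cis (- t * (norm \<xi>)\<^sup>2))"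
  by (rule ext) (simp add: heat_solution_def solution_hat_def damp_def[abs_def] mult_ac)

text \<open>Plancherel in space-time, whose dimension is \<open>DIM('a) + 1\<close>.\<close>

lemma L2_norm_sq_osc:
  fixes w :: "real \<times> 'a::euclidean_space \<Rightarrow> complex"
  assumes k: "integrable lborel k" and w: "\<And>p. w p = c *\<^sub>R osc_integral k p"
  shows "L2_norm_sq w = ennreal (c\<^sup>2 * (2 * pi) ^ (DIM('a) + 1)) * (\<integral>\<^sup>+y. ennreal ((cmod (k y))\<^sup>2) \<partial>lborel)"
proof -
  have [measurable]: "k \<in> borel_measurable borel" using borel_measurable_integrable[OF k] by simp
  have "L2_norm_sq w = (\<integral>\<^sup>+p. ennreal (c\<^sup>2) * ennreal ((cmod (osc_integral k p))\<^sup>2) \<partial>lborel)"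
    unfolding L2_norm_sq_def w by (simp add: power_mult_distrib ennreal_mult)
  also have "\<dots> = ennreal (c\<^sup>2) * (\<integral>\<^sup>+p. ennreal ((cmod (osc_integral k p))\<^sup>2) \<partial>lborel)"
    by (rule nn_integral_cmult) measurable
  finally show ?thesis
    by (simp add: osc_integral_plancherel[OF k] ennreal_mult mult.assoc)
qed

text \<open>The exceptional sets of the two functions live in different variables; iterated
  integration treats them one after the other.\<close>

lemma pair_energy_cong_AE:
  fixes F G F' G' :: "'a::euclidean_space \<Rightarrow> complex"
  assumes [measurable]: "F \<in> borel_measurable borel" "G \<in> borel_measurable borel"
      "F' \<in> borel_measurable borel" "G' \<in> borel_measurable borel"
    and F: "AE z in lborel. F z = F' z" and G: "AE z in lborel. G z = G' z"
  shows "(\<integral>\<^sup>+z. ennreal ((cmod (F (fst z)))\<^sup>2 * (cmod (G (snd z)))\<^sup>2 * norm (fst z - snd z) powr \<kappa>) \<partial>lborel)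
    = (\<integral>\<^sup>+z. ennreal ((cmod (F' (fst z)))\<^sup>2 * (cmod (G' (snd z)))\<^sup>2 * norm (fst z - snd z) powr \<kappa>) \<partial>lborel)"
proof -
  have "(\<integral>\<^sup>+z. ennreal ((cmod (F (fst z)))\<^sup>2 * (cmod (G (snd z)))\<^sup>2 * norm (fst z - snd z) powr \<kappa>) \<partial>lborel)
    = (\<integral>\<^sup>+x. (\<integral>\<^sup>+y. ennreal ((cmod (F x))\<^sup>2 * (cmod (G y))\<^sup>2 * norm (x - y) powr \<kappa>) \<partial>lborel) \<partial>lborel)"
    by (subst nn_integral_lborel_pair(1)) simp_all
  also have "\<dots> = (\<integral>\<^sup>+x. (\<integral>\<^sup>+y. ennreal ((cmod (F' x))\<^sup>2 * (cmod (G' y))\<^sup>2 * norm (x - y) powr \<kappa>) \<partial>lborel) \<partial>lborel)"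
  proof (rule nn_integral_cong_AE)
    show "AE x in lborel. (\<integral>\<^sup>+y. ennreal ((cmod (F x))\<^sup>2 * (cmod (G y))\<^sup>2 * norm (x - y) powr \<kappa>) \<partial>lborel) = (\<integral>\<^sup>+y. ennreal ((cmod (F' x))\<^sup>2 * (cmod (G' y))\<^sup>2 * norm (x - y) powr \<kappa>) \<partial>lborel)"
      using F
    proof eventually_elim
      case (elim x)
      show ?case
      proof (rule nn_integral_cong_AE)
        show "AE y in lborel. ennreal ((cmod (F x))\<^sup>2 * (cmod (G y))\<^sup>2 * norm (x - y) powr \<kappa>) = ennreal ((cmod (F' x))\<^sup>2 * (cmod (G' y))\<^sup>2 * norm (x - y) powr \<kappa>)"
          using G by eventually_elim (simp add: elim)
      qed
    qed
  qed
  also have "\<dots> = (\<integral>\<^sup>+z. ennreal ((cmod (F' (fst z)))\<^sup>2 * (cmod (G' (snd z)))\<^sup>2 * norm (fst z - snd z) powr \<kappa>) \<partial>lborel)"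
    by (subst nn_integral_lborel_pair(1)) simp_all
  finally show ?thesis .
qed

lemma I_functional_altdef:
  "I_functional s f g = (\<integral>\<^sup>+z. ennreal ((cmod (fourier f (fst z)))\<^sup>2 * (cmod (fourier g (snd z)))\<^sup>2
      * norm (fst z - snd z) powr (4 * s + real DIM('a) - 2)) \<partial>lborel)"
  for f g :: "'a::euclidean_space \<Rightarrow> complex"
  unfolding I_functional_def by (rule nn_integral_cong) (simp add: split_beta)

text \<open>The hypothesis adds instead of subtracting and so makes sense for infinite
  \<open>N\<close>. Finiteness of \<open>I\<close> prevents infinity minus infinity in
  \<open>ereal\<close>: if \<open>N \<rho>2\<close> is infinite the difference there is minus
  infinity, and otherwise the hypothesis forces \<open>N \<rho>1\<close> to be finite.\<close>

lemma antimono_on_defect: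
  fixes I N :: "real \<Rightarrow> ennreal"
  assumes fin: "\<And>\<rho>. \<rho> > 0 \<Longrightarrow> I \<rho> < \<infinity>" and C: "C \<ge> 0"
    and le: "\<And>\<rho>1 \<rho>2. 0 < \<rho>1 \<Longrightarrow> \<rho>1 \<le> \<rho>2 \<Longrightarrow> ennreal C * I \<rho>2 + N \<rho>1 \<le> ennreal C * I \<rho>1 + N \<rho>2"
  shows "antimono_on {0<..} (\<lambda>\<rho>. ereal C * enn2ereal (I \<rho>) - enn2ereal (N \<rho>))"
proof (rule monotone_onI)
  fix \<rho>1 \<rho>2 :: real assume "\<rho>1 \<in> {0<..}" "\<rho>2 \<in> {0<..}" and "\<rho>1 \<le> \<rho>2"
  then have \<rho>: "0 < \<rho>1" "0 < \<rho>2" by auto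
  obtain i1 where i1: "I \<rho>1 = ennreal i1" "i1 \<ge> 0" using fin[OF \<rho>(1)] by (cases "I \<rho>1") auto
  obtain i2 where i2: "I \<rho>2 = ennreal i2" "i2 \<ge> 0" using fin[OF \<rho>(2)] by (cases "I \<rho>2") auto
  have le': "ennreal (C * i2) + N \<rho>1 \<le> ennreal (C * i1) + N \<rho>2"
    using le[OF \<rho>(1) \<open>\<rho>1 \<le> \<rho>2\<close>] i1 i2 C by (simp add: ennreal_mult)
  show "ereal C * enn2ereal (I \<rho>2) - enn2ereal (N \<rho>2) \<le> ereal C * enn2ereal (I \<rho>1) - enn2ereal (N \<rho>1)"
  proof (cases "N \<rho>2")
    case top
    then show ?thesis using i1 i2 by simp
  next
    case (real n2)
    then have "N \<rho>1 \<noteq> top" using le' by (auto simp: top_unique)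
    then obtain n1 where n1: "N \<rho>1 = ennreal n1" "n1 \<ge> 0" by (cases "N \<rho>1") auto
    have "C * i2 + n1 \<le> C * i1 + n2"
      using le' real n1 i1 i2 C by (simp add: ennreal_le_iff flip: ennreal_plus)
    then show ?thesis using real n1 i1 i2 by simp
  qed
qed

lemma borel_measurable_hyp_energy [measurable]:
  fixes F G :: "'a::euclidean_space \<Rightarrow> complex"
  assumes [measurable]: "F \<in> borel_measurable borel" "G \<in> borel_measurable borel"
  shows "hyp_energy \<sigma> \<rho> F G \<in> borel_measurable borel"
proof -
  have [measurable]: "(\<lambda>p. hyp_point (f p) (g p)) \<in> borel_measurable M"
    if [measurable]: "f \<in> borel_measurable M" "g \<in> borel_measurable M" for f :: "'m \<Rightarrow> real \<times> 'a" and g and M :: "'m measure"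
    unfolding hyp_point_def by measurable
  show ?thesis unfolding hyp_energy_def[abs_def] by measurable
qed

lemma borel_measurable_sph_energy [measurable]:
  fixes F G :: "'a::euclidean_space \<Rightarrow> complex"
  assumes d: "DIM('a) \<ge> 2" and [measurable]: "F \<in> borel_measurable borel" "G \<in> borel_measurable borel"
  shows "sph_energy \<sigma> \<rho> F G \<in> borel_measurable borel"
proof -
  interpret sph: disintegration sph_density sph_param "sph_proj :: 'a \<times> 'a \<Rightarrow> real \<times> 'a"
    by (rule disintegration_sph[OF d])
  show ?thesis unfolding sph_energy_def[abs_def] by measurable
qed

section \<open>The numerical constants\<close>

lemma inverse_power_sq_mult_power:
  assumes "x > 0"
  shows "(1 / x ^ (2 * d))\<^sup>2 * x ^ (d + 1) = x powr (1 - 3 * real d)"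
proof -
  have "(1 / x ^ (2 * d))\<^sup>2 * x ^ (d + 1) = x ^ (d + 1) / x ^ (4 * d)"
    by (simp add: power_divide flip: power_mult)
  also have "\<dots> = x powr real (d + 1) / x powr real (4 * d)"
    using assms by (subst (1 2) powr_realpow) auto
  also have "\<dots> = x powr (1 - 3 * real d)"
    by (simp add: powr_diff[symmetric])
  finally show ?thesis .
qed

text \<open>The factors are the squared normalisation of two inverse transforms, Plancherel's
  constant in dimension d + 1, and the constant of \<open>nn_integral_hyp_energy\<close>. The
  arguments of \<open>Gamma\<close> in \<open>OT\<close> are (\<kappa> + 1) / 2 and (\<kappa> + d) /
  2 expressed by \<sigma>.\<close>

lemma OT_eq:
  assumes d: "d > 0" and \<kappa>: "\<kappa> = 4 * \<sigma> + real d - 2"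
  shows "OT d \<sigma> = (1 / (2 * pi) ^ (2 * d))\<^sup>2 * (2 * pi) ^ (d + 1) * (sphere_const \<kappa> d / 2)"
proof -
  have 1: "(\<kappa> + 1) / 2 = 2 * \<sigma> + (real d - 1) / 2" "(\<kappa> + real d) / 2 = 2 * \<sigma> + real d - 1"
    unfolding \<kappa> by (simp_all add: field_simps)
  have 2: "sqrt pi ^ (d - 1) = pi powr ((real d - 1) / 2)"
  proof -
    have "sqrt pi ^ (d - 1) = (pi powr (1/2)) powr (real (d - 1))"
      by (simp add: powr_half_sqrt powr_realpow)
    also have "\<dots> = pi powr ((real d - 1) / 2)" using d by (simp add: powr_powr of_nat_diff)
    finally show ?thesis .
  qed
  have 3: "(1 / (2 * pi) ^ (2 * d))\<^sup>2 * (2 * pi) ^ (d + 1) = (2 * pi) powr (1 - 3 * real d)"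
    by (rule inverse_power_sq_mult_power) simp
  have 4: "(2 * pi) powr (1 - 3 * real d) = 2 * 2 powr (- 3 * real d) * pi powr (1 - 3 * real d)"
  proof -
    have "(2::real) powr (1 - 3 * real d) = 2 powr 1 * 2 powr (- 3 * real d)"
      unfolding powr_add[symmetric] by simp
    then show ?thesis by (simp add: powr_mult)
  qed
  have 5: "pi powr (1 - 3 * real d) * pi powr ((real d - 1) / 2) = pi powr ((1 - 5 * real d) / 2)"
    unfolding powr_add[symmetric] by (rule arg_cong[where f="\<lambda>e. pi powr e"]) (simp add: field_simps)
  show ?thesis
    unfolding OT_def 3 4 sphere_const_def 1 2 5[symmetric] by (simp add: mult_ac)
qed

text \<open>The Fourier factors are those of \<open>OT_eq\<close>; the last one is the constant of
  \<open>nn_integral_sph_energy\<close>, the area of the sphere times the Jacobian 2^(-d).\<close>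

lemma C_const_eq:
  assumes d: "d > 0"
  shows "C_const d = (1 / (2 * pi) ^ (2 * d))\<^sup>2 * (2 * pi) ^ (d + 1) * (sphere_area d * (1/2) ^ d)"
proof -
  have 3: "(1 / (2 * pi) ^ (2 * d))\<^sup>2 * (2 * pi) ^ (d + 1) = (2 * pi) powr (1 - 3 * real d)"
    by (rule inverse_power_sq_mult_power) simp
  have 4: "(1/2::real) ^ d = 2 powr (- real d)"
    by (simp add: powr_minus powr_realpow power_divide inverse_eq_divide)
  have 5: "2 powr (1 - 3 * real d) * (2 * 2 powr (- real d)) = 2 powr (2 - 4 * real d)"
  proof -
    have "2 * 2 powr (- real d) = (2::real) powr (1 - real d)" by (simp add: powr_diff powr_minus divide_inverse)
    then show ?thesis by (simp flip: powr_add)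
  qed
  have 6: "pi powr (1 - 3 * real d) * pi powr (real d / 2) = pi powr ((2 - 5 * real d) / 2)"
    unfolding powr_add[symmetric] by (rule arg_cong[where f="\<lambda>e. pi powr e"]) (simp add: field_simps)
  show ?thesis
    unfolding C_const_def 3 4 sphere_area_def 5[symmetric] 6[symmetric] by (simp add: powr_mult mult_ac)
qed

section \<open>The regularised products as oscillatory integrals, and the two defects\<close>

context
  fixes u\<^sub>0 v\<^sub>0 :: "'a::euclidean_space \<Rightarrow> complex" and s \<kappa> :: real
  assumes d: "DIM('a) \<ge> 2" and ups: "(u\<^sub>0, v\<^sub>0) \<in> Upsilon s" and \<kappa>: "\<kappa> = 4 * s + real DIM('a) - 2"
begin

interpretation shear: disintegration "\<lambda>_. 1" "\<lambda>(\<xi>, \<eta>). (\<xi> + \<eta>, \<eta>)" "\<lambda>(\<zeta>, \<eta>). \<zeta> - \<eta> :: 'a"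
  by (rule disintegration_shear)

interpretation hyp: disintegration hyp_density hyp_param "hyp_proj :: 'a \<times> 'a \<Rightarrow> real \<times> 'a"
  by (rule disintegration_hyp)

interpretation sph: disintegration sph_density sph_param "sph_proj :: 'a \<times> 'a \<Rightarrow> real \<times> 'a"
  by (rule disintegration_sph[OF d])

lemma has_fourier_FG: "has_fourier_transform u\<^sub>0 (fourier u\<^sub>0)" "has_fourier_transform v\<^sub>0 (fourier v\<^sub>0)"
  using ups by (auto simp: Upsilon_def intro: has_fourier_transform_fourier)

lemma borel_measurable_FG [measurable]: "(fourier u\<^sub>0) \<in> borel_measurable borel" "(fourier v\<^sub>0) \<in> borel_measurable borel"
  using has_fourier_FG by (simp_all add: has_fourier_transform_def)

lemma integrable_damp_FG: "\<rho> > 0 \<Longrightarrow> integrable lborel (damp \<rho> (fourier u\<^sub>0))" "\<rho> > 0 \<Longrightarrow> integrable lborel (damp \<rho> (fourier v\<^sub>0))"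
proof -
  show "\<rho> > 0 \<Longrightarrow> integrable lborel (damp \<rho> (fourier u\<^sub>0))" "\<rho> > 0 \<Longrightarrow> integrable lborel (damp \<rho> (fourier v\<^sub>0))"
    unfolding damp_def[abs_def]
    using has_fourier_transform_gaussian_integrable has_fourier_FG by blast+
qed

lemma pair_energy_finite: "pair_energy \<kappa> 0 (fourier u\<^sub>0) (fourier v\<^sub>0) < \<infinity>"
  using ups unfolding Upsilon_def I_functional_altdef pair_energy_def \<kappa> by (simp add: damp_def)

lemma I_functional_heat:
  assumes \<rho>: "\<rho> > 0"
  shows "I_functional s (heat \<rho> u\<^sub>0) (heat \<rho> v\<^sub>0) = pair_energy \<kappa> \<rho> (fourier u\<^sub>0) (fourier v\<^sub>0)"
  unfolding I_functional_altdef pair_energy_def \<kappa>[symmetric] heat_eq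
proof (rule pair_energy_cong_AE)
  show "fourier (inverse_fourier_integral (damp \<rho> (fourier u\<^sub>0))) \<in> borel_measurable borel"
    "fourier (inverse_fourier_integral (damp \<rho> (fourier v\<^sub>0))) \<in> borel_measurable borel"
    using fourier_inverse_AE(2)[OF integrable_damp_FG(1)[OF \<rho>]] fourier_inverse_AE(2)[OF integrable_damp_FG(2)[OF \<rho>]]
    by (simp_all add: has_fourier_transform_def)
qed (use fourier_inverse_AE(1)[OF integrable_damp_FG(1)[OF \<rho>]] fourier_inverse_AE(1)[OF integrable_damp_FG(2)[OF \<rho>]] in simp_all)

text \<open>Two fibrations are needed. The multiplier acts in space at a fixed time, where the
  product of the solutions is the inverse transform of an integral over the fibres \<zeta> - \<eta>
  = \<xi>. Once the multiplier has been applied, the integral over all pairs is restored and split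
  again along \<open>hyp_proj\<close>, which sees time and space together. Integrability is
  established separately for the unweighted and for the weighted data.\<close>

lemma frac_laplacian_eq:
  assumes \<rho>: "\<rho> > 0"
  shows "frac_laplacian s (\<lambda>(t, x). heat_solution \<rho> u\<^sub>0 t x * cnj (heat_solution \<rho> v\<^sub>0 t x)) p
     = (1 / (2 * pi) ^ (2 * DIM('a))) *\<^sub>R osc_integral (hyp.fibre_integral (hyp_data s \<rho> (fourier u\<^sub>0) (fourier v\<^sub>0))) p"
proof -
  obtain t x where p: "p = (t, x)" by fastforce
  define c where "c = 1 / (2 * pi) ^ DIM('a)"
  have cc: "c * c = 1 / (2 * pi) ^ (2 * DIM('a))" unfolding c_def by (rule inverse_power_mult_self)
  define U where "U \<zeta> = damp \<rho> (fourier u\<^sub>0) \<zeta> * cis (- t * (norm \<zeta>)\<^sup>2)" for \<zeta>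
  define V where "V \<zeta> = damp \<rho> (fourier v\<^sub>0) \<zeta> * cis (- t * (norm \<zeta>)\<^sup>2)" for \<zeta>
  define g where "g z = U (fst z) * cnj (V (snd z))" for z
  have iU: "integrable lborel U" and iV: "integrable lborel V"
    unfolding U_def V_def by (intro integrable_mult_cis integrable_damp_FG \<rho>; measurable)+
  have ig: "integrable lborel g"
    unfolding g_def by (rule lborel_times_integral(1)[OF iU]) (use iV in simp)
  define K where "K \<xi> = c *\<^sub>R shear.fibre_integral g \<xi>" for \<xi>
  have iK: "integrable lborel K"
    unfolding K_def[abs_def] using shear.integrable_fibre_integral[OF ig] by simp
  have w: "(\<lambda>y. heat_solution \<rho> u\<^sub>0 t y * cnj (heat_solution \<rho> v\<^sub>0 t y)) = inverse_fourier_integral K"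
  proof
    fix y :: 'a
    have "heat_solution \<rho> u\<^sub>0 t y * cnj (heat_solution \<rho> v\<^sub>0 t y)
        = (c * c) *\<^sub>R ((\<integral>\<zeta>. U \<zeta> * cis (y \<bullet> \<zeta>) \<partial>lborel) * (\<integral>\<eta>. cnj (V \<eta> * cis (y \<bullet> \<eta>)) \<partial>lborel))"
      unfolding Bochner_Integration.integral_cnj heat_solution_eq inverse_fourier_integral_def c_def[symmetric] U_def[symmetric] V_def[symmetric]
      by (simp only: complex_cnj_scaleR mult_scaleR_left mult_scaleR_right scaleR_scaleR)
    also have "(\<integral>\<zeta>. U \<zeta> * cis (y \<bullet> \<zeta>) \<partial>lborel) * (\<integral>\<eta>. cnj (V \<eta> * cis (y \<bullet> \<eta>)) \<partial>lborel)
        = (\<integral>z. (U (fst z) * cis (y \<bullet> fst z)) * cnj (V (snd z) * cis (y \<bullet> snd z)) \<partial>lborel)"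
      by (rule lborel_times_integral(2)[symmetric], unfold complex_integrable_cnj)
         (intro integrable_mult_cis iU iV; measurable)+
    also have "\<dots> = (\<integral>z. g z * cis (y \<bullet> (case z of (\<zeta>, \<eta>) \<Rightarrow> \<zeta> - \<eta>)) \<partial>lborel)"
    proof (rule Bochner_Integration.integral_cong[OF refl])
      fix z :: "'a \<times> 'a"
      have "cis (y \<bullet> (case z of (\<zeta>, \<eta>) \<Rightarrow> \<zeta> - \<eta>)) = cis (y \<bullet> fst z) * cnj (cis (y \<bullet> snd z))"
        by (simp add: split_beta cis_cnj cis_mult inner_diff_right)
      then show "(U (fst z) * cis (y \<bullet> fst z)) * cnj (V (snd z) * cis (y \<bullet> snd z)) = g z * cis (y \<bullet> (case z of (\<zeta>, \<eta>) \<Rightarrow> \<zeta> - \<eta>))"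
        by (simp add: g_def mult_ac)
    qed
    also have "\<dots> = osc_integral (shear.fibre_integral g) y"
      by (rule shear.osc_integral_fibre[OF ig])
    also have "(c * c) *\<^sub>R osc_integral (shear.fibre_integral g) y = inverse_fourier_integral K y"
      unfolding K_def[abs_def] inverse_fourier_integral_scaleR by (simp add: inverse_fourier_integral_eq c_def)
    finally show "heat_solution \<rho> u\<^sub>0 t y * cnj (heat_solution \<rho> v\<^sub>0 t y) = inverse_fourier_integral K y" .
  qed
  define m where "m \<xi> = complex_of_real (norm \<xi> powr (2 * s))" for \<xi> :: 'a
  have [measurable]: "m \<in> borel_measurable borel" unfolding m_def[abs_def] by measurable
  \<comment> \<open>The time phase is kept in \<open>h\<close> while the spatial multiplier acts;
    afterwards it merges with the spatial phase into
    \<open>cis (p \<bullet> hyp_proj z)\<close>.\<close>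
  define h where "h z = hyp_data s \<rho> (fourier u\<^sub>0) (fourier v\<^sub>0) z * cis (t * ((norm (snd z))\<^sup>2 - (norm (fst z))\<^sup>2))" for z
  have ih: "integrable lborel h"
    unfolding h_def
    by (intro integrable_mult_cis integrable_hyp_data[OF d _ _ \<kappa>] borel_measurable_FG pair_energy_finite \<rho>) measurable
  have hg: "h z = m (fst z - snd z) * g z" for z
  proof -
    have "cis (t * ((norm (snd z))\<^sup>2 - (norm (fst z))\<^sup>2)) = cis (- t * (norm (fst z))\<^sup>2) * cnj (cis (- t * (norm (snd z))\<^sup>2))"
      by (simp add: cis_cnj cis_mult algebra_simps)
    then show ?thesis by (simp add: h_def hyp_data_def m_def g_def U_def V_def mult_ac)
  qed
  have mK: "m \<xi> * K \<xi> = c *\<^sub>R shear.fibre_integral h \<xi>" for \<xi>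
    by (simp add: K_def shear.fibre_integral_def hg)
  have "frac_laplacian s (\<lambda>(t, x). heat_solution \<rho> u\<^sub>0 t x * cnj (heat_solution \<rho> v\<^sub>0 t x)) p
     = fourier_multiplier m (inverse_fourier_integral K) x"
    by (simp add: p frac_laplacian_def w m_def[abs_def])
  also have "\<dots> = inverse_fourier_integral (\<lambda>\<xi>. m \<xi> * K \<xi>) x"
    by (subst fourier_multiplier_inverse[OF iK]) simp_all
  also have "\<dots> = (c * c) *\<^sub>R osc_integral (shear.fibre_integral h) x"
    unfolding mK inverse_fourier_integral_scaleR by (simp add: inverse_fourier_integral_eq c_def)
  also have "osc_integral (shear.fibre_integral h) x = (\<integral>z. h z * cis (x \<bullet> (case z of (\<zeta>, \<eta>) \<Rightarrow> \<zeta> - \<eta>)) \<partial>lborel)"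
    by (rule shear.osc_integral_fibre[OF ih, symmetric])
  also have "\<dots> = (\<integral>z. hyp_data s \<rho> (fourier u\<^sub>0) (fourier v\<^sub>0) z * cis (p \<bullet> hyp_proj z) \<partial>lborel)"
  proof (rule Bochner_Integration.integral_cong[OF refl])
    fix z :: "'a \<times> 'a"
    have "cis (p \<bullet> hyp_proj z) = cis (t * ((norm (snd z))\<^sup>2 - (norm (fst z))\<^sup>2)) * cis (x \<bullet> (case z of (\<zeta>, \<eta>) \<Rightarrow> \<zeta> - \<eta>))"
      by (simp add: p hyp_proj_def cis_mult split_beta)
    then show "h z * cis (x \<bullet> (case z of (\<zeta>, \<eta>) \<Rightarrow> \<zeta> - \<eta>)) = hyp_data s \<rho> (fourier u\<^sub>0) (fourier v\<^sub>0) z * cis (p \<bullet> hyp_proj z)"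
      by (simp add: h_def)
  qed
  also have "\<dots> = osc_integral (hyp.fibre_integral (hyp_data s \<rho> (fourier u\<^sub>0) (fourier v\<^sub>0))) p"
    by (rule hyp.osc_integral_fibre integrable_hyp_data[OF d _ _ \<kappa>] borel_measurable_FG pair_energy_finite \<rho>)+
  finally show ?thesis unfolding cc .
qed

text \<open>Here the multiplier acts in space-time, so the unweighted product is first written as
  the inverse transform of a fibre integral along \<open>sph_proj\<close>. The multiplier is
  constant on each fibre and equals there the weight of \<open>sph_data\<close> times
  2^(-s).\<close>

lemma frac_D_eq:
  assumes \<rho>: "\<rho> > 0"
  shows "frac_D s (\<lambda>(t, x). heat_solution \<rho> u\<^sub>0 t x * heat_solution \<rho> v\<^sub>0 t x) p
     = (2 powr (- s) * (1 / (2 * pi) ^ (2 * DIM('a)))) *\<^sub>R osc_integral (sph.fibre_integral (sph_data s \<rho> (fourier u\<^sub>0) (fourier v\<^sub>0))) p"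
proof -
  define c where "c = 1 / (2 * pi) ^ DIM('a)"
  have cc: "c * c = 1 / (2 * pi) ^ (2 * DIM('a))" unfolding c_def by (rule inverse_power_mult_self)
  define e where "e = 1 / (2 * pi) ^ DIM(real \<times> 'a)"
  have e: "e \<noteq> 0" by (simp add: e_def)
  define g where "g z = damp \<rho> (fourier u\<^sub>0) (fst z) * damp \<rho> (fourier v\<^sub>0) (snd z)" for z
  have ig: "integrable lborel g"
    unfolding g_def by (intro lborel_times_integral(1) integrable_damp_FG \<rho>)
  \<comment> \<open>\<open>e\<close> is the normalisation of the inverse transform on space-time and
    \<open>c * c\<close> that of two inverse transforms on space; the quotient converts one into the
    other.\<close>
  define K where "K y = (c * c / e) *\<^sub>R sph.fibre_integral g y" for y
  have iK: "integrable lborel K"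
    unfolding K_def[abs_def] using sph.integrable_fibre_integral[OF ig] by simp
  have w: "(\<lambda>(t, x). heat_solution \<rho> u\<^sub>0 t x * heat_solution \<rho> v\<^sub>0 t x) = inverse_fourier_integral K"
  proof
    fix p :: "real \<times> 'a"
    obtain t x where p: "p = (t, x)" by fastforce
    define U where "U \<zeta> = damp \<rho> (fourier u\<^sub>0) \<zeta> * cis (- t * (norm \<zeta>)\<^sup>2) * cis (x \<bullet> \<zeta>)" for \<zeta>
    define V where "V \<zeta> = damp \<rho> (fourier v\<^sub>0) \<zeta> * cis (- t * (norm \<zeta>)\<^sup>2) * cis (x \<bullet> \<zeta>)" for \<zeta>
    have iU: "integrable lborel U" and iV: "integrable lborel V"
      unfolding U_def V_def by (intro integrable_mult_cis integrable_damp_FG \<rho>; measurable)+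
    have "(case p of (t, x) \<Rightarrow> heat_solution \<rho> u\<^sub>0 t x * heat_solution \<rho> v\<^sub>0 t x) = (c * c) *\<^sub>R ((\<integral>\<zeta>. U \<zeta> \<partial>lborel) * (\<integral>\<eta>. V \<eta> \<partial>lborel))"
      by (simp add: p heat_solution_eq inverse_fourier_integral_def c_def U_def V_def scaleR_conv_of_real mult_ac)
    also have "(\<integral>\<zeta>. U \<zeta> \<partial>lborel) * (\<integral>\<eta>. V \<eta> \<partial>lborel) = (\<integral>z. U (fst z) * V (snd z) \<partial>lborel)"
      by (rule lborel_times_integral(2)[symmetric, OF iU iV])
    also have "\<dots> = (\<integral>z. g z * cis (p \<bullet> sph_proj z) \<partial>lborel)"
    proof (rule Bochner_Integration.integral_cong[OF refl])
      fix z :: "'a \<times> 'a"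
      have "cis (p \<bullet> sph_proj z) = (cis (- t * (norm (fst z))\<^sup>2) * cis (x \<bullet> fst z)) * (cis (- t * (norm (snd z))\<^sup>2) * cis (x \<bullet> snd z))"
        unfolding cis_mult by (simp add: p sph_proj_def inner_add_right algebra_simps)
      then show "U (fst z) * V (snd z) = g z * cis (p \<bullet> sph_proj z)"
        by (simp add: g_def U_def V_def mult_ac)
    qed
    also have "\<dots> = osc_integral (sph.fibre_integral g) p"
      by (rule sph.osc_integral_fibre[OF ig])
    also have "(c * c) *\<^sub>R osc_integral (sph.fibre_integral g) p = inverse_fourier_integral K p"
      unfolding K_def[abs_def] inverse_fourier_integral_scaleR inverse_fourier_integral_eq e_def[symmetric] using e by simp
    finally show "(case p of (t, x) \<Rightarrow> heat_solution \<rho> u\<^sub>0 t x * heat_solution \<rho> v\<^sub>0 t x) = inverse_fourier_integral K p" .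
  qed
  define m where "m y = complex_of_real (\<bar>fst y + (norm (snd y))\<^sup>2 / 2\<bar> powr s)" for y :: "real \<times> 'a"
  have [measurable]: "m \<in> borel_measurable borel" unfolding m_def[abs_def] by measurable
  have mg: "m y * sph.fibre_integral g y = 2 powr (- s) *\<^sub>R sph.fibre_integral (sph_data s \<rho> (fourier u\<^sub>0) (fourier v\<^sub>0)) y" for y
    unfolding sph.fibre_integral_def integral_scaleR_right[symmetric] integral_mult_right_zero[symmetric]
  proof (rule Bochner_Integration.integral_cong[OF refl])
    fix x :: 'a
    show "m y * sph_density (y, x) *\<^sub>R g (sph_param (y, x)) = 2 powr (- s) *\<^sub>R sph_density (y, x) *\<^sub>R sph_data s \<rho> (fourier u\<^sub>0) (fourier v\<^sub>0) (sph_param (y, x))"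
    proof (cases "sph_density (y, x) = 0")
      case False
      define r where "r = sph_radius y"
      from False have r: "sph_radius y > 0" "x \<noteq> 0" by (auto simp: sph_density_def sph_factor_def split: split_indicator_asm)
      have r2: "r\<^sup>2 = - 2 * fst y - (norm (snd y))\<^sup>2"
        using r(1) unfolding r_def sph_radius_def by simp
      \<comment> \<open>The quantity inside is - r^2 / 2, and the halving of r^2 produces the factor
        2^(-s).\<close>
      then have "\<bar>fst y + (norm (snd y))\<^sup>2 / 2\<bar> = r\<^sup>2 / 2"
        using zero_le_power2[of r] by (simp add: abs_if)
      also have "(r\<^sup>2 / 2) powr s = 2 powr (- s) * r powr (2 * s)"
      proof -
        have "(r\<^sup>2) powr s = r powr (2 * s)" using r(1) powr_powr[of r 2 s] by (simp add: r_def)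
        then show ?thesis by (simp add: powr_divide powr_minus_divide)
      qed
      finally have "m y = of_real (2 powr (- s)) * of_real (r powr (2 * s))" by (simp add: m_def)
      moreover have "norm (fst (sph_param (y, x)) - snd (sph_param (y, x))) = r"
        unfolding r_def by (rule sph_proj_param(2)[OF r])
      ultimately show ?thesis by (simp add: sph_data_def g_def scaleR_conv_of_real)
    qed simp
  qed
  have mK: "m y * K y = (c * c / e * 2 powr (- s)) *\<^sub>R sph.fibre_integral (sph_data s \<rho> (fourier u\<^sub>0) (fourier v\<^sub>0)) y" for y
  proof -
    have "m y * K y = (c * c / e) *\<^sub>R (m y * sph.fibre_integral g y)" by (simp add: K_def)
    then show ?thesis unfolding mg by simp
  qed
  have "frac_D s (\<lambda>(t, x). heat_solution \<rho> u\<^sub>0 t x * heat_solution \<rho> v\<^sub>0 t x) p = fourier_multiplier m (inverse_fourier_integral K) p"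
    unfolding frac_D_def w by (simp add: m_def[abs_def] split_beta')
  also have "\<dots> = inverse_fourier_integral (\<lambda>\<xi>. m \<xi> * K \<xi>) p"
    by (subst fourier_multiplier_inverse[OF iK]) simp_all
  also have "\<dots> = (2 powr (- s) * (c * c)) *\<^sub>R osc_integral (sph.fibre_integral (sph_data s \<rho> (fourier u\<^sub>0) (fourier v\<^sub>0))) p"
    unfolding mK inverse_fourier_integral_scaleR inverse_fourier_integral_eq e_def[symmetric] using e by simp
  finally show ?thesis unfolding cc .
qed

lemma laplacian_defect_antimono:
  assumes s: "s > (1 - real DIM('a)) / 4"
  shows "antimono_on {0<..} (\<lambda>\<rho>::real.
    ereal (OT DIM('a) s) * enn2ereal (I_functional s (heat \<rho> u\<^sub>0) (heat \<rho> v\<^sub>0))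
    - enn2ereal (L2_norm_sq (frac_laplacian s
        (\<lambda>(t, x). heat_solution \<rho> u\<^sub>0 t x * cnj (heat_solution \<rho> v\<^sub>0 t x)))))"
proof (rule antimono_on_defect)
  \<comment> \<open>The hypothesis on \<open>s\<close> says exactly that \<kappa> > - 1, the
    condition under which \<open>pospow \<kappa>\<close> is integrable at 0 and
    \<open>sphere_const\<close> arises.\<close>
  have \<kappa>1: "\<kappa> > - 1" using s unfolding \<kappa> by (simp add: field_simps)
  define c where "c = (1 / (2 * pi) ^ (2 * DIM('a)))\<^sup>2 * (2 * pi) ^ (DIM('a) + 1)"
  have c: "c \<ge> 0" by (simp add: c_def)
  have sc: "sphere_const \<kappa> DIM('a) \<ge> 0" by (rule sphere_const_nonneg[OF \<kappa>1 DIM_positive])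
  have OT: "OT DIM('a) s = c * (sphere_const \<kappa> DIM('a) / 2)"
    unfolding c_def by (rule OT_eq[OF DIM_positive \<kappa>])
  show "OT DIM('a) s \<ge> 0" unfolding OT using c sc by simp
  show "I_functional s (heat \<rho> u\<^sub>0) (heat \<rho> v\<^sub>0) < \<infinity>" if "\<rho> > 0" for \<rho>
    using le_less_trans[OF pair_energy_mono pair_energy_finite] that by (simp add: I_functional_heat)
  define k where "k \<rho> = hyp.fibre_integral (hyp_data s \<rho> (fourier u\<^sub>0) (fourier v\<^sub>0))" for \<rho>
  have ik: "integrable lborel (k \<rho>)" if "\<rho> > 0" for \<rho>
    unfolding k_def
    by (intro hyp.integrable_fibre_integral integrable_hyp_data[OF d _ _ \<kappa>] borel_measurable_FG pair_energy_finite that)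
  have [measurable]: "k \<rho> \<in> borel_measurable borel" for \<rho> unfolding k_def by measurable
  fix \<rho>1 \<rho>2 :: real assume \<rho>1: "0 < \<rho>1" and le: "\<rho>1 \<le> \<rho>2"
  then have \<rho>2: "0 < \<rho>2" by simp
  let ?N = "\<lambda>\<rho>. L2_norm_sq (frac_laplacian s (\<lambda>(t, x). heat_solution \<rho> u\<^sub>0 t x * cnj (heat_solution \<rho> v\<^sub>0 t x)))"
  let ?I = "\<lambda>\<rho>. I_functional s (heat \<rho> u\<^sub>0) (heat \<rho> v\<^sub>0)"
  have N: "?N \<rho> = ennreal c * (\<integral>\<^sup>+y. ennreal ((cmod (k \<rho> y))\<^sup>2) \<partial>lborel)" if "\<rho> > 0" for \<rho>
    unfolding c_def by (rule L2_norm_sq_osc[OF ik[OF that]]) (simp add: frac_laplacian_eq[OF that] k_def)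
  have I: "ennreal (OT DIM('a) s) * ?I \<rho> = ennreal c * (\<integral>\<^sup>+y. hyp_energy s \<rho> (fourier u\<^sub>0) (fourier v\<^sub>0) y \<partial>lborel)" if "\<rho> > 0" for \<rho>
  proof -
    have "ennreal (OT DIM('a) s) = ennreal c * ennreal (sphere_const \<kappa> DIM('a) / 2)"
      unfolding OT using c sc by (intro ennreal_mult) auto
    then show ?thesis
      unfolding I_functional_heat[OF that] nn_integral_hyp_energy[OF borel_measurable_FG \<kappa> \<kappa>1] by (simp add: mult.assoc)
  qed
  \<comment> \<open>The inequality holds on every fibre; the integrals of the sums split because all
    terms are nonnegative, so nothing has to be finite here.\<close>
  have "(\<integral>\<^sup>+y. hyp_energy s \<rho>2 (fourier u\<^sub>0) (fourier v\<^sub>0) y + ennreal ((cmod (k \<rho>1 y))\<^sup>2) \<partial>lborel) \<le> (\<integral>\<^sup>+y. hyp_energy s \<rho>1 (fourier u\<^sub>0) (fourier v\<^sub>0) y + ennreal ((cmod (k \<rho>2 y))\<^sup>2) \<partial>lborel)"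
    unfolding k_def by (intro nn_integral_mono hyp_energy_antimono borel_measurable_FG le)
  then have "ennreal c * ((\<integral>\<^sup>+y. hyp_energy s \<rho>2 (fourier u\<^sub>0) (fourier v\<^sub>0) y \<partial>lborel) + (\<integral>\<^sup>+y. ennreal ((cmod (k \<rho>1 y))\<^sup>2) \<partial>lborel))
     \<le> ennreal c * ((\<integral>\<^sup>+y. hyp_energy s \<rho>1 (fourier u\<^sub>0) (fourier v\<^sub>0) y \<partial>lborel) + (\<integral>\<^sup>+y. ennreal ((cmod (k \<rho>2 y))\<^sup>2) \<partial>lborel))"
    by (intro mult_left_mono) (simp_all add: nn_integral_add)
  then show "ennreal (OT DIM('a) s) * ?I \<rho>2 + ?N \<rho>1 \<le> ennreal (OT DIM('a) s) * ?I \<rho>1 + ?N \<rho>2"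
    unfolding I[OF \<rho>1] I[OF \<rho>2] N[OF \<rho>1] N[OF \<rho>2] by (simp add: distrib_left)
qed

lemma D_defect_antimono:
  "antimono_on {0<..} (\<lambda>\<rho>::real.
    ereal (2 powr (- 2 * s) * C_const DIM('a)) * enn2ereal (I_functional s (heat \<rho> u\<^sub>0) (heat \<rho> v\<^sub>0))
    - enn2ereal (L2_norm_sq (frac_D s (\<lambda>(t, x). heat_solution \<rho> u\<^sub>0 t x * heat_solution \<rho> v\<^sub>0 t x))))"
proof (rule antimono_on_defect)
  define c where "c = (2 powr (- s) * (1 / (2 * pi) ^ (2 * DIM('a))))\<^sup>2 * (2 * pi) ^ (DIM('a) + 1)"
  have c: "c \<ge> 0" by (simp add: c_def)
  define A where "A = sphere_area DIM('a) * (1/2) ^ DIM('a)"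
  have A: "A \<ge> 0" using sphere_area_pos[of "DIM('a)"] by (simp add: A_def)
  have C: "2 powr (- 2 * s) * C_const DIM('a) = c * A"
  proof -
    \<comment> \<open>The norm is squared, so the constant \<open>2 powr (- s)\<close> of
      \<open>frac_D_eq\<close> enters twice.\<close>
    have "(2::real) powr (- 2 * s) = (2 powr (- s))\<^sup>2" by (simp add: power2_eq_square flip: powr_add)
    then show ?thesis unfolding C_const_eq[OF DIM_positive] c_def A_def by (simp only: power_mult_distrib mult.assoc)
  qed
  show "2 powr (- 2 * s) * C_const DIM('a) \<ge> 0" unfolding C using c A by simp
  show "I_functional s (heat \<rho> u\<^sub>0) (heat \<rho> v\<^sub>0) < \<infinity>" if "\<rho> > 0" for \<rho>
    using le_less_trans[OF pair_energy_mono pair_energy_finite] that by (simp add: I_functional_heat)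
  define k where "k \<rho> = sph.fibre_integral (sph_data s \<rho> (fourier u\<^sub>0) (fourier v\<^sub>0))" for \<rho>
  have ik: "integrable lborel (k \<rho>)" if "\<rho> > 0" for \<rho>
    unfolding k_def
    by (intro sph.integrable_fibre_integral integrable_sph_data[OF d _ _ \<kappa>] borel_measurable_FG pair_energy_finite that)
  have [measurable]: "k \<rho> \<in> borel_measurable borel" for \<rho> unfolding k_def by measurable
  note [measurable] = borel_measurable_sph_energy[OF d borel_measurable_FG]
  fix \<rho>1 \<rho>2 :: real assume \<rho>1: "0 < \<rho>1" and le: "\<rho>1 \<le> \<rho>2"
  then have \<rho>2: "0 < \<rho>2" by simp
  let ?N = "\<lambda>\<rho>. L2_norm_sq (frac_D s (\<lambda>(t, x). heat_solution \<rho> u\<^sub>0 t x * heat_solution \<rho> v\<^sub>0 t x))"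
  let ?I = "\<lambda>\<rho>. I_functional s (heat \<rho> u\<^sub>0) (heat \<rho> v\<^sub>0)"
  have N: "?N \<rho> = ennreal c * (\<integral>\<^sup>+y. ennreal ((cmod (k \<rho> y))\<^sup>2) \<partial>lborel)" if "\<rho> > 0" for \<rho>
    unfolding c_def by (rule L2_norm_sq_osc[OF ik[OF that]]) (simp only: frac_D_eq[OF that] k_def)
  have I: "ennreal (2 powr (- 2 * s) * C_const DIM('a)) * ?I \<rho> = ennreal c * (\<integral>\<^sup>+y. sph_energy s \<rho> (fourier u\<^sub>0) (fourier v\<^sub>0) y \<partial>lborel)" if "\<rho> > 0" for \<rho>
  proof -
    have "ennreal (2 powr (- 2 * s) * C_const DIM('a)) = ennreal c * ennreal A"
      unfolding C using c A by (intro ennreal_mult) auto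
    then show ?thesis
      unfolding I_functional_heat[OF that] nn_integral_sph_energy[OF d borel_measurable_FG \<kappa>] A_def by (simp add: mult.assoc)
  qed
  have "(\<integral>\<^sup>+y. sph_energy s \<rho>2 (fourier u\<^sub>0) (fourier v\<^sub>0) y + ennreal ((cmod (k \<rho>1 y))\<^sup>2) \<partial>lborel) \<le> (\<integral>\<^sup>+y. sph_energy s \<rho>1 (fourier u\<^sub>0) (fourier v\<^sub>0) y + ennreal ((cmod (k \<rho>2 y))\<^sup>2) \<partial>lborel)"
    unfolding k_def by (intro nn_integral_mono sph_energy_antimono d borel_measurable_FG le)
  then have "ennreal c * ((\<integral>\<^sup>+y. sph_energy s \<rho>2 (fourier u\<^sub>0) (fourier v\<^sub>0) y \<partial>lborel) + (\<integral>\<^sup>+y. ennreal ((cmod (k \<rho>1 y))\<^sup>2) \<partial>lborel))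
     \<le> ennreal c * ((\<integral>\<^sup>+y. sph_energy s \<rho>1 (fourier u\<^sub>0) (fourier v\<^sub>0) y \<partial>lborel) + (\<integral>\<^sup>+y. ennreal ((cmod (k \<rho>2 y))\<^sup>2) \<partial>lborel))"
    by (intro mult_left_mono) (simp_all add: nn_integral_add)
  then show "ennreal (2 powr (- 2 * s) * C_const DIM('a)) * ?I \<rho>2 + ?N \<rho>1 \<le> ennreal (2 powr (- 2 * s) * C_const DIM('a)) * ?I \<rho>1 + ?N \<rho>2"
    unfolding I[OF \<rho>1] I[OF \<rho>2] N[OF \<rho>1] N[OF \<rho>2] by (simp add: distrib_left)
qed

end

theorem theorem1p6:
  assumes "DIM('a::euclidean_space) \<ge> 2"
  shows "(\<forall>(\<sigma>::real) (u\<^sub>0::'a \<Rightarrow> complex) (v\<^sub>0::'a \<Rightarrow> complex).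
            \<sigma> > (1 - real DIM('a)) / 4 \<and> (u\<^sub>0, v\<^sub>0) \<in> Upsilon \<sigma> \<longrightarrow>
            antimono_on {0<..} (\<lambda>\<rho>::real.
              ereal (OT DIM('a) \<sigma>) * enn2ereal (I_functional \<sigma> (heat \<rho> u\<^sub>0) (heat \<rho> v\<^sub>0))
              - enn2ereal (L2_norm_sq (frac_laplacian \<sigma>
                  (\<lambda>(t, x). heat_solution \<rho> u\<^sub>0 t x * cnj (heat_solution \<rho> v\<^sub>0 t x))))))
       \<and> (\<forall>(\<beta>::real) (u\<^sub>0::'a \<Rightarrow> complex) (v\<^sub>0::'a \<Rightarrow> complex).
            \<beta> > (1 - real DIM('a)) / 2 \<and> (u\<^sub>0, v\<^sub>0) \<in> Upsilon \<beta> \<longrightarrow>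
            antimono_on {0<..} (\<lambda>\<rho>::real.
              ereal (2 powr (- 2 * \<beta>) * C_const DIM('a))
                * enn2ereal (I_functional \<beta> (heat \<rho> u\<^sub>0) (heat \<rho> v\<^sub>0))
              - enn2ereal (L2_norm_sq (frac_D \<beta>
                  (\<lambda>(t, x). heat_solution \<rho> u\<^sub>0 t x * heat_solution \<rho> v\<^sub>0 t x)))))"
  using laplacian_defect_antimono[OF assms _ refl] D_defect_antimono[OF assms _ refl] by blast

end
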